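(* Let $\mathcal{P}$ be a (finite) homogeneous simplicial $d$-complex with integer vertices in $\mathbb{R}^{d}$. Let $w$ be a non-negative integer and let $f\in C^{w+1}(\mathbb{R}^{d})$. Then there exists a numerical sequence $\{\gamma_{k}\}_{0<k\leqslant w/2}$ (not depending on $N$) such that for every positive integer $N$ $$S_{N}(f,\mathcal{P})=\int_{\mathcal{P}}f(x)\,dx+\sum_{0<k\leqslant w/2}\gamma_{k}N^{-2k}+O(N^{-w-1}),$$ where the implied constant does not depend on $N$.
   Context: A homogeneous simplicial $d$-complex is a simplicial complex in which every simplex of dimension less than $d$ is a face of some simplex of dimension $d$; it has integer vertices if all its vertices lie in $\mathbb{Z}^d$. In integrals and in $\omega_{\mathcal P}$, $\mathcal P$ denotes the union of its simplices. The normalized solid angle is $\omega_{\mathcal{P}}(x)=\lim_{\varepsilon\to0+}\frac{1}{|\{|y|\le1\}|}\int_{|y|\le1}\chi_{\mathcal{P}}(x-\varepsilon y)\,dy$, and for a continuous function $f$ and a positive integer $N$, $S_{N}(f,\mathcal{P})=N^{-d}\sum_{n\in\mathbb{Z}^{d}}\omega_{\mathcal{P}}(N^{-1}n)f(N^{-1}n)$. *)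

theory Defs
  imports "HOL-Analysis.Analysis"
begin

definition integer_lattice :: "(real ^ 'n) set" where
  "integer_lattice = {x. \<forall>i. x $ i \<in> \<int>}"

(* The library's simplicial_complex includes finiteness, and allows the empty simplex,
   of dimension -1. *)
definition homogeneous_complex :: "nat \<Rightarrow> 'a::euclidean_space set set \<Rightarrow> bool" where
  "homogeneous_complex d \<C> \<longleftrightarrow>
     simplicial_complex \<C> \<and>
     (\<forall>S\<in>\<C>. \<forall>n. n simplex S \<and> n < int d \<longrightarrow>
        (\<exists>T\<in>\<C>. int d simplex T \<and> S face_of T))"

definition complex_vertices :: "'a::euclidean_space set set \<Rightarrow> 'a set" where
  "complex_vertices \<C> = {v. {v} \<in> \<C>}"

(* The class C^k on the whole space. *)
primrec C_k :: "nat \<Rightarrow> ('a::euclidean_space \<Rightarrow> 'b::real_normed_vector) \<Rightarrow> bool" where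
  "C_k 0 f \<longleftrightarrow> continuous_on UNIV f"
| "C_k (Suc k) f \<longleftrightarrow>
     (\<forall>x. f differentiable (at x)) \<and>
     (\<forall>b\<in>Basis. C_k k (\<lambda>x. frechet_derivative f (at x) b))"

definition solid_angle :: "'a::euclidean_space set \<Rightarrow> 'a \<Rightarrow> real" where
  "solid_angle P x =
     Lim (at_right 0) (\<lambda>\<epsilon>.
       1 / measure lborel (cball (0::'a) 1) *
       (LINT y:cball 0 1|lborel. indicat_real P (x - \<epsilon> *\<^sub>R y)))"

(* For bounded P only finitely many terms of the sum are nonzero. *)
definition lattice_sum ::
  "nat \<Rightarrow> (real ^ 'n \<Rightarrow> 'b::{real_normed_field, euclidean_space}) \<Rightarrow> (real ^ 'n) set \<Rightarrow> 'b" where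
  "lattice_sum N f P =
     (1 / of_nat N ^ CARD('n)) *
     (\<Sum>\<^sub>\<infinity>n\<in>integer_lattice. solid_angle P (n /\<^sub>R real N) *\<^sub>R f (n /\<^sub>R real N))"

end

theory Submission
  imports Defs
begin

text \<open>
  Write \<open>P\<close> for the union of the complex, \<open>d\<close> for the dimension and \<open>\<omega>\<close> for the solid angle.

  Since the vertices are lattice points, the facets of the dilates \<open>N P\<close> lie on hyperplanes
  \<open>a \<bullet> x = b\<close> with integral coefficients, and only finitely many normals \<open>a\<close> occur as \<open>N\<close>
  varies. A facet that misses a lattice point therefore stays away from it by a
  distance independent of \<open>N\<close>. So there is a fixed \<open>\<epsilon> < 1/2\<close> such that \<open>\<omega> (n / N)\<close> is the
  proportion of the ball of radius \<open>\<epsilon>\<close> around \<open>n\<close> that lies in \<open>N P\<close>, for all \<open>N\<close> and \<open>n\<close>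
  (\<open>lattice_conic_affine_image\<close>, \<open>solid_angle_lattice_point\<close>). Exchanging sum and integral yields
  the exact formula (\<open>lattice_sum_eq_mollified_sum\<close>)

    \<open>S\<^sub>N(f, P) = I(N) := \<kappa> \<integral>\<^sub>P q(N x) f(x + \<theta>(N x) / N) dx\<close>,

  where \<open>\<theta>(y)\<close> is the displacement from \<open>y\<close> to the nearest lattice point, \<open>q\<close> is the indicator
  of \<open>\<bar>\<theta>\<bar> \<le> \<epsilon>\<close> and \<open>1 / \<kappa>\<close> is the volume of the ball of radius \<open>\<epsilon>\<close>. The right-hand side makes
  sense for all nonzero integers \<open>N\<close>, and \<open>I(- N) = I(N)\<close> because \<open>\<theta>\<close> is odd where \<open>q\<close> does not
  vanish. Hence it is enough to expand \<open>I(N)\<close> in all powers \<open>N\<^sup>-\<^sup>j\<close> with \<open>j \<le> w\<close>, with one set of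
  coefficients for both signs of \<open>N\<close>: averaging over \<open>N\<close> and \<open>- N\<close> removes the odd powers
  (\<open>even_expansion\<close>). The constant term is the integral of \<open>f\<close>, since the lattice sums
  converge to it (\<open>lattice_sum_tendsto_integral\<close>).

  For the expansion, consider functions that are sums of terms \<open>N\<^sup>-\<^sup>j p(N u) a(u)\<close> with \<open>p\<close> bounded
  and periodic and \<open>a\<close> of class \<open>C\<^sup>m\<^sup>-\<^sup>j\<close>, up to an error \<open>O(\<bar>N\<bar>\<^sup>-\<^sup>m)\<close>, where \<open>m = w + 1\<close>
  (\<open>osc_expandable\<close>). Taylor's formula shows that the integrand of \<open>I(N)\<close> is of this kind
  (\<open>osc_taylor\<close>). The class is stable under integral affine substitutions (\<open>osc_substitute\<close>)
  and under integration along a coordinate (\<open>osc_coord_primitive\<close>): a periodic function of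
  mean zero has a bounded periodic primitive, so integration by parts trades a
  derivative of \<open>a\<close> for a factor \<open>1 / N\<close>. A lattice simplex is the image of the
  ordered simplex \<open>0 \<le> u\<^sub>1 \<le> \<dots> \<le> u\<^sub>d \<le> 1\<close> under an affine map with integral coefficients
  (\<open>integer_simplex_parametrization\<close>), and the integral over the ordered simplex is an
  iterated one, whose limits of integration are again integral affine functions
  (\<open>integral_chain_step\<close>). This leaves a constant, which is an expansion in powers of
  \<open>1 / N\<close>.
\<close>

section \<open>Functions of class $C^k$ in coordinates\<close>

lemma has_derivative_vec_coords:
  fixes a :: "real ^ 'n \<Rightarrow> 'b::real_normed_vector"
  assumes "(a has_derivative F) (at x)"
  shows "(a has_derivative (\<lambda>v. \<Sum>i\<in>UNIV. v $ i *\<^sub>R F (axis i 1))) (at x)"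
proof -
  interpret bounded_linear F using assms by (rule has_derivative_bounded_linear)
  have "F v = (\<Sum>i\<in>UNIV. v $ i *\<^sub>R F (axis i 1))" for v
  proof -
    have "F v = F (\<Sum>i\<in>UNIV. v $ i *\<^sub>R axis i 1)"
      by (metis (no_types, lifting) basis_expansion scalar_mult_eq_scaleR sum.cong)
    then show ?thesis by (simp add: sum scaleR)
  qed
  then have "F = (\<lambda>v. \<Sum>i\<in>UNIV. v $ i *\<^sub>R F (axis i 1))" by (rule ext)
  then show ?thesis using assms by metis
qed

text \<open>
  Only the derivatives along the coordinate axes have to be named. All closure
  properties of the classes \<open>C\<^sup>k\<close> below are inductions on \<open>k\<close> through this equivalence.
\<close>

lemma C_k_Suc_iff:
  fixes a :: "real ^ 'n \<Rightarrow> 'b::real_normed_vector"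
  shows "C_k (Suc k) a \<longleftrightarrow>
    (\<exists>D. (\<forall>x. (a has_derivative (\<lambda>v. \<Sum>i\<in>UNIV. v $ i *\<^sub>R D i x)) (at x)) \<and> (\<forall>i. C_k k (D i)))"
    (is "?L \<longleftrightarrow> ?R")
proof
  assume ?L
  then have d: "\<And>x. (a has_derivative frechet_derivative a (at x)) (at x)"
    and c: "\<And>b. b \<in> Basis \<Longrightarrow> C_k k (\<lambda>x. frechet_derivative a (at x) b)"
    by (auto simp: frechet_derivative_works)
  show ?R
  proof (intro exI[of _ "\<lambda>i x. frechet_derivative a (at x) (axis i 1)"] conjI allI)
    show "(a has_derivative (\<lambda>v. \<Sum>i\<in>UNIV. v $ i *\<^sub>R frechet_derivative a (at x) (axis i 1))) (at x)" for x
      by (rule has_derivative_vec_coords[OF d])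
    show "C_k k (\<lambda>x. frechet_derivative a (at x) (axis i 1))" for i
      by (rule c) (simp add: axis_in_Basis_iff)
  qed
next
  assume ?R
  then obtain D where D: "\<And>x. (a has_derivative (\<lambda>v. \<Sum>i\<in>UNIV. v $ i *\<^sub>R D i x)) (at x)"
    and c: "\<And>i. C_k k (D i)" by blast
  have fd: "frechet_derivative a (at x) (axis i 1) = D i x" for i x
  proof -
    have "frechet_derivative a (at x) = (\<lambda>v. \<Sum>i\<in>UNIV. v $ i *\<^sub>R D i x)"
      using frechet_derivative_at[OF D] by simp
    then show ?thesis by (simp add: axis_def if_distrib[where f = "\<lambda>r. r *\<^sub>R _"] cong: if_cong)
  qed
  show ?L
    unfolding C_k.simps
  proof (intro conjI allI ballI)
    show "a differentiable (at x)" for x using D by (rule differentiableI)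
    fix b :: "real ^ 'n" assume "b \<in> Basis"
    then obtain i where "b = axis i 1" by (auto simp: Basis_vec_def)
    then show "C_k k (\<lambda>x. frechet_derivative a (at x) b)" using c by (simp add: fd)
  qed
qed

lemma C_k_SucE:
  fixes a :: "real ^ 'n \<Rightarrow> 'b::real_normed_vector"
  assumes "C_k (Suc k) a"
  obtains D where "\<And>x. (a has_derivative (\<lambda>v. \<Sum>i\<in>UNIV. v $ i *\<^sub>R D i x)) (at x)"
    and "\<And>i. C_k k (D i)"
  using assms unfolding C_k_Suc_iff by blast

lemma C_k_lessD:
  fixes a :: "real ^ 'n \<Rightarrow> 'b::real_normed_vector"
  shows "C_k (Suc k) a \<Longrightarrow> C_k k a"
proof (induction k arbitrary: a)
  case 0
  then show ?case
    by (auto intro!: differentiable_imp_continuous_on simp: differentiable_on_def)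
next
  case (Suc k)
  then show ?case by (subst C_k_Suc_iff, subst (asm) C_k_Suc_iff) blast
qed

lemma C_k_antimono:
  fixes a :: "real ^ 'n \<Rightarrow> 'b::real_normed_vector"
  shows "C_k k a \<Longrightarrow> j \<le> k \<Longrightarrow> C_k j a"
  by (induction k) (auto simp: le_Suc_eq dest: C_k_lessD simp del: C_k.simps(2))

lemma C_k_continuous:
  fixes a :: "real ^ 'n \<Rightarrow> 'b::real_normed_vector"
  shows "C_k k a \<Longrightarrow> continuous_on UNIV a"
  using C_k_antimono[of k a 0] by simp

lemma C_k_zero: "C_k k (\<lambda>_ :: real ^ 'n. 0 :: 'b::real_normed_vector)"
proof (induction k)
  case (Suc k)
  then show ?case unfolding C_k_Suc_iff by (intro exI[of _ "\<lambda>_ _. 0"]) auto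
qed simp

lemma C_k_add:
  fixes a b :: "real ^ 'n \<Rightarrow> 'b::real_normed_vector"
  shows "C_k k a \<Longrightarrow> C_k k b \<Longrightarrow> C_k k (\<lambda>x. a x + b x)"
proof (induction k arbitrary: a b)
  case (Suc k)
  from Suc.prems obtain D E where
    D: "\<And>x. (a has_derivative (\<lambda>v. \<Sum>i\<in>UNIV. v $ i *\<^sub>R D i x)) (at x)" "\<And>i. C_k k (D i)" and
    E: "\<And>x. (b has_derivative (\<lambda>v. \<Sum>i\<in>UNIV. v $ i *\<^sub>R E i x)) (at x)" "\<And>i. C_k k (E i)"
    by (elim C_k_SucE) (rule that; assumption)
  show ?case unfolding C_k_Suc_iff
  proof (intro exI[of _ "\<lambda>i x. D i x + E i x"] conjI allI)
    show "((\<lambda>x. a x + b x) has_derivative (\<lambda>v. \<Sum>i\<in>UNIV. v $ i *\<^sub>R (D i x + E i x))) (at x)" for x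
      using has_derivative_add[OF D(1) E(1)] by (simp add: scaleR_add_right sum.distrib)
  qed (intro Suc.IH D E)
qed (simp add: continuous_on_add)

lemma C_k_scaleR:
  fixes a :: "real ^ 'n \<Rightarrow> 'b::real_normed_vector"
  shows "C_k k a \<Longrightarrow> C_k k (\<lambda>x. c *\<^sub>R a x)"
proof (induction k arbitrary: a)
  case (Suc k)
  from Suc.prems obtain D where
    D: "\<And>x. (a has_derivative (\<lambda>v. \<Sum>i\<in>UNIV. v $ i *\<^sub>R D i x)) (at x)" "\<And>i. C_k k (D i)"
    by (elim C_k_SucE) (rule that; assumption)
  show ?case unfolding C_k_Suc_iff
  proof (intro exI[of _ "\<lambda>i x. c *\<^sub>R D i x"] conjI allI)
    show "((\<lambda>x. c *\<^sub>R a x) has_derivative (\<lambda>v. \<Sum>i\<in>UNIV. v $ i *\<^sub>R c *\<^sub>R D i x)) (at x)" for x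
      using has_derivative_scaleR_right[OF D(1), of c]
      by (simp add: scaleR_sum_right mult.commute)
  qed (intro Suc.IH D)
qed (simp add: continuous_on_scaleR continuous_on_const)

lemma C_k_sum:
  fixes a :: "'i \<Rightarrow> real ^ 'n \<Rightarrow> 'b::real_normed_vector"
  shows "(\<And>i. i \<in> I \<Longrightarrow> C_k k (a i)) \<Longrightarrow> C_k k (\<lambda>x. \<Sum>i\<in>I. a i x)"
  by (induction I rule: infinite_finite_induct) (auto intro: C_k_add C_k_zero)

lemma C_k_coord_mult:
  fixes a :: "real ^ 'n \<Rightarrow> 'b::real_normed_vector"
  shows "C_k k a \<Longrightarrow> C_k k (\<lambda>x. x $ i *\<^sub>R a x)"
proof (induction k arbitrary: a)
  case (Suc k)
  from Suc.prems obtain D where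
    D: "\<And>x. (a has_derivative (\<lambda>v. \<Sum>i\<in>UNIV. v $ i *\<^sub>R D i x)) (at x)" "\<And>i. C_k k (D i)"
    by (elim C_k_SucE) (rule that; assumption)
  let ?E = "\<lambda>j x. (if j = i then a x else 0) + x $ i *\<^sub>R D j x"
  show ?case unfolding C_k_Suc_iff
  proof (intro exI[of _ ?E] conjI allI)
    fix x :: "real ^ 'n"
    have "bounded_linear (\<lambda>v :: real ^ 'n. v $ i)" by (rule bounded_linear_vec_nth)
    then have "((\<lambda>x. x $ i *\<^sub>R a x) has_derivative
        (\<lambda>v. x $ i *\<^sub>R (\<Sum>j\<in>UNIV. v $ j *\<^sub>R D j x) + v $ i *\<^sub>R a x)) (at x)"
      by (intro has_derivative_scaleR D bounded_linear_imp_has_derivative)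
    moreover have "x $ i *\<^sub>R (\<Sum>j\<in>UNIV. v $ j *\<^sub>R D j x) + v $ i *\<^sub>R a x
      = (\<Sum>j\<in>UNIV. v $ j *\<^sub>R ?E j x)" for v
      by (simp add: scaleR_add_right sum.distrib scaleR_sum_right mult.commute
          if_distrib[where f = "\<lambda>r. _ *\<^sub>R r"] cong: if_cong)
    ultimately show "((\<lambda>x. x $ i *\<^sub>R a x) has_derivative
        (\<lambda>v. \<Sum>j\<in>UNIV. v $ j *\<^sub>R ?E j x)) (at x)" by simp
  next
    fix j show "C_k k (?E j)"
      using C_k_lessD[OF Suc.prems] by (cases "j = i") (auto intro!: C_k_add C_k_zero Suc.IH D)
  qed
qed (auto intro!: continuous_intros)

lemma C_k_compose_affine:
  fixes a :: "real ^ 'n \<Rightarrow> 'b::real_normed_vector" and A :: "real ^ 'm ^ 'n"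
  shows "C_k k a \<Longrightarrow> C_k k (\<lambda>x. a (v + A *v x))"
proof (induction k arbitrary: a)
  case 0
  then show ?case
    by (auto intro!: continuous_on_compose2[of UNIV a UNIV "\<lambda>x. v + A *v x"]
        continuous_on_add continuous_on_const
        linear_continuous_on[OF matrix_vector_mul_bounded_linear])
next
  case (Suc k)
  from Suc.prems obtain D where
    D: "\<And>x. (a has_derivative (\<lambda>v. \<Sum>i\<in>UNIV. v $ i *\<^sub>R D i x)) (at x)" "\<And>i. C_k k (D i)"
    by (elim C_k_SucE) (rule that; assumption)
  let ?E = "\<lambda>j x. \<Sum>i\<in>UNIV. (A $ i $ j) *\<^sub>R D i (v + A *v x)"
  show ?case unfolding C_k_Suc_iff
  proof (intro exI[of _ ?E] conjI allI)
    fix x :: "real ^ 'm"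
    have l: "((\<lambda>x. v + A *v x) has_derivative (\<lambda>h. A *v h)) (at x)"
      by (auto intro!: derivative_eq_intros bounded_linear_imp_has_derivative)
    have "((\<lambda>x. a (v + A *v x)) has_derivative
        (\<lambda>h. \<Sum>i\<in>UNIV. (A *v h) $ i *\<^sub>R D i (v + A *v x))) (at x)"
      by (rule has_derivative_compose[OF l D(1)])
    moreover have "(\<Sum>i\<in>UNIV. (A *v h) $ i *\<^sub>R D i (v + A *v x)) = (\<Sum>j\<in>UNIV. h $ j *\<^sub>R ?E j x)" for h
    proof -
      have "(\<Sum>i\<in>UNIV. (A *v h) $ i *\<^sub>R D i (v + A *v x))
        = (\<Sum>i\<in>UNIV. \<Sum>j\<in>UNIV. (h $ j * A $ i $ j) *\<^sub>R D i (v + A *v x))"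
        by (simp add: matrix_vector_mult_def scaleR_sum_left mult.commute)
      also have "\<dots> = (\<Sum>j\<in>UNIV. \<Sum>i\<in>UNIV. (h $ j * A $ i $ j) *\<^sub>R D i (v + A *v x))"
        by (rule sum.swap)
      finally show ?thesis by (simp add: scaleR_sum_right)
    qed
    ultimately show "((\<lambda>x. a (v + A *v x)) has_derivative (\<lambda>h. \<Sum>j\<in>UNIV. h $ j *\<^sub>R ?E j x)) (at x)"
      by simp
  next
    fix j show "C_k k (?E j)" by (intro C_k_sum C_k_scaleR Suc.IH D)
  qed
qed

definition scale_coord :: "'n \<Rightarrow> real \<Rightarrow> real ^ 'n \<Rightarrow> real ^ 'n" where
  "scale_coord i s u = (\<chi> j. if j = i then s * u $ i else u $ j)"

lemma continuous_on_scale_coord [continuous_intros]: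
  "continuous_on S f \<Longrightarrow> continuous_on S g \<Longrightarrow> continuous_on S (\<lambda>x. scale_coord i (f x) (g x))"
  unfolding scale_coord_def
proof (intro continuous_on_vec_lambda)
  fix j assume "continuous_on S f" "continuous_on S g"
  then show "continuous_on S (\<lambda>x. if j = i then f x * g x $ i else g x $ j)"
    by (cases "j = i") (auto intro!: continuous_intros)
qed

lemma has_derivative_scale_coord:
  "(scale_coord i s has_derivative scale_coord i s) (at x)"
proof -
  have "linear (scale_coord i s)"
    by (rule linearI) (auto simp: scale_coord_def vec_eq_iff algebra_simps)
  then show ?thesis using linear_imp_has_derivative by blast
qed

text \<open>
  Differentiation under the integral sign. The chain rule brings out a factor \<open>s\<close> for
  the derivative along the scaled coordinate \<open>i\<close>, which is why the weight \<open>\<mu>\<close> has to be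
  arbitrary for the induction.
\<close>

lemma C_k_integral_scale_coord:
  fixes a :: "real ^ 'n \<Rightarrow> 'b::euclidean_space"
  assumes "continuous_on {0..1} \<mu>"
  shows "C_k k a \<Longrightarrow> C_k k (\<lambda>u. integral {0..1} (\<lambda>s. \<mu> s *\<^sub>R a (scale_coord i s u)))"
  using assms
proof (induction k arbitrary: a \<mu>)
  case 0
  have "continuous_on (UNIV \<times> cbox 0 1) (\<lambda>(u, s). \<mu> s *\<^sub>R a (scale_coord i s u))"
    unfolding split_beta using 0
    by (auto intro!: continuous_intros continuous_on_compose2[of UNIV a] continuous_on_compose2[of "{0..1}" \<mu>])
  from integral_continuous_on_param[OF this] show ?case by simp
next
  case (Suc k)
  from Suc.prems obtain D where
    D: "\<And>x. (a has_derivative (\<lambda>v. \<Sum>i\<in>UNIV. v $ i *\<^sub>R D i x)) (at x)" "\<And>i. C_k k (D i)"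
    by (elim C_k_SucE) (rule that; assumption)
  define m where "m j s = (if j = i then s * \<mu> s else \<mu> s)" for j and s :: real
  have m: "continuous_on {0..1} (m j)" for j
    using Suc.prems(2) by (cases "j = i") (auto simp: m_def intro!: continuous_intros)
  let ?E = "\<lambda>j u. integral {0..1} (\<lambda>s. m j s *\<^sub>R D j (scale_coord i s u))"
  define B :: "real ^ 'n \<Rightarrow> real \<Rightarrow> (real ^ 'n) \<Rightarrow>\<^sub>L 'b" where
    "B u s = (\<Sum>j\<in>UNIV. blinfun_scaleR_left (m j s *\<^sub>R D j (scale_coord i s u)) o\<^sub>L blinfun_inner_left (axis j 1))" for u s
  have Bv: "B u s v = (\<Sum>j\<in>UNIV. v $ j *\<^sub>R m j s *\<^sub>R D j (scale_coord i s u))" for u s v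
    by (simp add: B_def blinfun.sum_left inner_axis inner_commute)
  have cD: "continuous_on UNIV (D j)" for j using D(2) by (rule C_k_continuous)
  have cB: "continuous_on (UNIV \<times> cbox 0 1) (\<lambda>(u, s). B u s)"
    unfolding split_beta B_def
    by (intro continuous_intros bounded_linear.continuous_on[OF bounded_linear_blinfun_scaleR_left]
        continuous_on_compose2[OF cD] continuous_on_compose2[OF m]) auto
  show ?case unfolding C_k_Suc_iff
  proof (intro exI[of _ ?E] conjI allI)
    fix x :: "real ^ 'n"
    have "((\<lambda>u. integral (cbox 0 1) (\<lambda>s. \<mu> s *\<^sub>R a (scale_coord i s u))) has_derivative
       blinfun_apply (integral (cbox 0 1) (B x))) (at x within UNIV)"
    proof (rule leibniz_rule[OF _ _ cB])
      fix u :: "real ^ 'n" and s :: real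
      have "((\<lambda>u. a (scale_coord i s u)) has_derivative
          (\<lambda>h. \<Sum>j\<in>UNIV. (scale_coord i s h) $ j *\<^sub>R D j (scale_coord i s u))) (at u)"
        by (rule has_derivative_compose[OF has_derivative_scale_coord D(1)])
      then have "((\<lambda>u. \<mu> s *\<^sub>R a (scale_coord i s u)) has_derivative
          (\<lambda>h. \<mu> s *\<^sub>R (\<Sum>j\<in>UNIV. (scale_coord i s h) $ j *\<^sub>R D j (scale_coord i s u)))) (at u)"
        by (rule has_derivative_scaleR_right)
      also have "(\<lambda>h. \<mu> s *\<^sub>R (\<Sum>j\<in>UNIV. (scale_coord i s h) $ j *\<^sub>R D j (scale_coord i s u))) = B u s"
        unfolding Bv scaleR_sum_right
        by (intro ext sum.cong) (auto simp: m_def scale_coord_def mult_ac)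
      finally show "((\<lambda>u. \<mu> s *\<^sub>R a (scale_coord i s u)) has_derivative B u s) (at u within UNIV)" by simp
    next
      have "continuous_on (cbox 0 1) (\<lambda>s. \<mu> s *\<^sub>R a (scale_coord i s u))" for u
        using Suc.prems(2) C_k_continuous[OF Suc.prems(1)]
        by (auto intro!: continuous_intros continuous_on_compose2[of UNIV a])
      then show "(\<lambda>s. \<mu> s *\<^sub>R a (scale_coord i s u)) integrable_on cbox 0 1" for u
        by (rule integrable_continuous)
    qed auto
    moreover have "blinfun_apply (integral (cbox 0 1) (B x)) = (\<lambda>v. \<Sum>j\<in>UNIV. v $ j *\<^sub>R ?E j x)"
    proof
      fix v
      have cBx: "continuous_on (cbox 0 1) (B x)"
        using continuous_on_compose2[OF cB, of "cbox 0 1" "Pair x"]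
        by (force intro: continuous_intros)
      have "blinfun_apply (integral (cbox 0 1) (B x)) v = integral (cbox 0 1) (\<lambda>s. B x s v)"
        using integral_linear[OF integrable_continuous[OF cBx] blinfun.bounded_linear_left[of v]]
        by (simp add: o_def)
      also have "\<dots> = (\<Sum>j\<in>UNIV. integral (cbox 0 1) (\<lambda>s. v $ j *\<^sub>R m j s *\<^sub>R D j (scale_coord i s x)))"
        unfolding Bv
        by (intro integral_sum integrable_continuous continuous_intros
           continuous_on_compose2[OF cD] continuous_on_compose2[OF m]) auto
      finally show "blinfun_apply (integral (cbox 0 1) (B x)) v = (\<Sum>j\<in>UNIV. v $ j *\<^sub>R ?E j x)"
        by (simp del: scaleR_scaleR)
    qed
    ultimately show "((\<lambda>u. integral {0..1} (\<lambda>s. \<mu> s *\<^sub>R a (scale_coord i s u))) has_derivative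
      (\<lambda>v. \<Sum>j\<in>UNIV. v $ j *\<^sub>R ?E j x)) (at x)" by simp
  next
    fix j show "C_k k (?E j)" by (intro Suc.IH D m)
  qed
qed

section \<open>Lattice-periodic functions\<close>

lemma integer_lattice_diff: "x \<in> integer_lattice \<Longrightarrow> y \<in> integer_lattice \<Longrightarrow> x - y \<in> integer_lattice"
  by (auto simp: integer_lattice_def)

lemma integer_lattice_scale: "x \<in> integer_lattice \<Longrightarrow> of_int k *\<^sub>R x \<in> integer_lattice"
  by (auto simp: integer_lattice_def)

lemma integer_lattice_mult_matrix:
  "x \<in> integer_lattice \<Longrightarrow> (\<And>i j. A $ i $ j \<in> \<int>) \<Longrightarrow> A *v x \<in> integer_lattice"
  by (auto simp: integer_lattice_def matrix_vector_mult_def intro!: Ints_sum Ints_mult)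

definition bounded_periodic :: "(real ^ 'n \<Rightarrow> real) \<Rightarrow> bool" where
  "bounded_periodic p \<longleftrightarrow> p \<in> borel_measurable borel \<and> (\<exists>B. \<forall>y. \<bar>p y\<bar> \<le> B) \<and>
    (\<forall>y. \<forall>m\<in>integer_lattice. p (y + m) = p y)"

lemma bounded_periodic_mult:
  assumes "bounded_periodic p" "bounded_periodic q"
  shows "bounded_periodic (\<lambda>y. p y * q y)"
proof -
  from assms obtain A B where "\<forall>y. \<bar>p y\<bar> \<le> A" "\<forall>y. \<bar>q y\<bar> \<le> B"
    unfolding bounded_periodic_def by blast
  then have "\<forall>y. \<bar>p y * q y\<bar> \<le> A * B"
    by (auto simp: abs_mult intro!: mult_mono intro: order_trans[OF abs_ge_zero])
  with assms show ?thesis unfolding bounded_periodic_def by auto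
qed

lemma bounded_periodic_cmult: "bounded_periodic p \<Longrightarrow> bounded_periodic (\<lambda>y. c * p y)"
proof -
  have "bounded_periodic (\<lambda>_ :: real ^ 'n. c)" by (auto simp: bounded_periodic_def)
  then show "bounded_periodic p \<Longrightarrow> ?thesis" by (rule bounded_periodic_mult)
qed

lemma bounded_periodic_diff:
  assumes "bounded_periodic p" "bounded_periodic q"
  shows "bounded_periodic (\<lambda>y. p y - q y)"
proof -
  from assms obtain A B where "\<forall>y. \<bar>p y\<bar> \<le> A" "\<forall>y. \<bar>q y\<bar> \<le> B"
    unfolding bounded_periodic_def by blast
  then have "\<forall>y. \<bar>p y - q y\<bar> \<le> A + B"
    by (auto intro!: order_trans[OF abs_triangle_ineq4] add_mono)
  with assms show ?thesis unfolding bounded_periodic_def by auto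
qed

lemma borel_measurable_coord [measurable]: "(\<lambda>y. y $ i) \<in> borel_measurable (borel :: (real ^ 'n) measure)"
  by (intro borel_measurable_continuous_onI continuous_intros)

lemma borel_measurable_matrix_vector [measurable]:
  "(\<lambda>y. A *v y) \<in> borel_measurable (borel :: (real ^ 'n) measure)"
  by (intro borel_measurable_continuous_onI linear_continuous_on matrix_vector_mul_bounded_linear)

lemma bounded_periodic_matrix:
  fixes A :: "real ^ 'm ^ 'n"
  assumes p: "bounded_periodic p" and A: "\<And>i j. A $ i $ j \<in> \<int>"
  shows "bounded_periodic (\<lambda>y. p (A *v y))"
  using assms unfolding bounded_periodic_def
  by (auto simp: matrix_vector_right_distrib integer_lattice_mult_matrix)

section \<open>Expansions with periodic amplitudes\<close>

text \<open>
  The bound is uniform in \<open>N\<close> and local in the space variable. The value at \<open>N = 0\<close>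
  is left free, since the functions of interest contain \<open>1 / N\<close>.
\<close>

definition uniformly_locally_bounded :: "(int \<Rightarrow> real ^ 'n \<Rightarrow> 'b::real_normed_vector) \<Rightarrow> bool" where
  "uniformly_locally_bounded F \<longleftrightarrow>
     (\<forall>R. \<exists>K. \<forall>N u. N \<noteq> 0 \<longrightarrow> norm u \<le> R \<longrightarrow> norm (F N u) \<le> K)"

lemma uniformly_locally_boundedE:
  assumes "uniformly_locally_bounded F"
  obtains K where "\<forall>N u. N \<noteq> 0 \<longrightarrow> norm u \<le> R \<longrightarrow> norm (F N u) \<le> K"
  using assms unfolding uniformly_locally_bounded_def by blast

text \<open>
  Functions of \<open>(N, u)\<close> which are, up to an error \<open>O(\<bar>N\<bar>\<^sup>-\<^sup>m)\<close> locally uniform in \<open>u\<close>, finite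
  sums of terms \<open>N\<^sup>-\<^sup>j p(N u) a(u)\<close> with \<open>j < m\<close>, a bounded periodic amplitude \<open>p\<close> at scale
  \<open>1 / N\<close> and a profile \<open>a\<close> of class \<open>C\<^sup>m\<^sup>-\<^sup>j\<close>. A profile loses one derivative for
  each power of \<open>1 / N\<close>, which is the budget that Taylor's formula and integration by
  parts need. The inductive form reduces every closure property to the case of a
  single term and the case of a remainder.
\<close>

inductive osc_expandable :: "nat \<Rightarrow> (int \<Rightarrow> real ^ 'n \<Rightarrow> 'b::euclidean_space) \<Rightarrow> bool" where
  osc_term: "bounded_periodic p \<Longrightarrow> C_k m a \<Longrightarrow> osc_expandable m (\<lambda>N u. p (of_int N *\<^sub>R u) *\<^sub>R a u)"
| osc_rem: "(\<And>N. N \<noteq> 0 \<Longrightarrow> F N \<in> borel_measurable borel) \<Longrightarrow> uniformly_locally_bounded F \<Longrightarrow> osc_expandable 0 F"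
| osc_add: "osc_expandable m F \<Longrightarrow> osc_expandable m G \<Longrightarrow> osc_expandable m (\<lambda>N u. F N u + G N u)"
| osc_shift: "osc_expandable m F \<Longrightarrow> osc_expandable (Suc m) (\<lambda>N u. (1 / of_int N) *\<^sub>R F N u)"
| osc_cong: "osc_expandable m F \<Longrightarrow> (\<And>N. N \<noteq> 0 \<Longrightarrow> G N = F N) \<Longrightarrow> osc_expandable m G"

lemma C_k_measurable:
  fixes a :: "real ^ 'n \<Rightarrow> 'b::real_normed_vector"
  shows "C_k m a \<Longrightarrow> a \<in> borel_measurable borel"
  by (intro borel_measurable_continuous_onI C_k_continuous)

lemma C_k_bounded_on_ball:
  fixes a :: "real ^ 'n \<Rightarrow> 'b::real_normed_vector"
  assumes "C_k m a"
  shows "\<exists>K. \<forall>u. norm u \<le> R \<longrightarrow> norm (a u) \<le> K"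
proof -
  have "compact (a ` cball 0 R)"
    using C_k_continuous[OF assms] by (intro compact_continuous_image) (auto elim: continuous_on_subset)
  then have "bounded (a ` cball 0 R)" by (rule compact_imp_bounded)
  then obtain K where "\<forall>x\<in>cball 0 R. norm (a x) \<le> K" by (auto simp: bounded_iff)
  then show ?thesis by (intro exI[of _ K]) auto
qed

lemma osc_measurable: "osc_expandable m F \<Longrightarrow> N \<noteq> 0 \<Longrightarrow> F N \<in> borel_measurable borel"
proof (induction arbitrary: N rule: osc_expandable.induct)
  case (osc_term p m a)
  have [measurable]: "p \<in> borel_measurable borel" "a \<in> borel_measurable borel"
    using osc_term C_k_measurable by (auto simp: bounded_periodic_def)
  show ?case by measurable
qed auto

lemma osc_bounded: "osc_expandable m F \<Longrightarrow> uniformly_locally_bounded F"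
proof (induction rule: osc_expandable.induct)
  case (osc_term p m a)
  from osc_term obtain B where B: "\<forall>y. \<bar>p y\<bar> \<le> B" by (auto simp: bounded_periodic_def)
  show ?case unfolding uniformly_locally_bounded_def
  proof
    fix R
    from C_k_bounded_on_ball[OF osc_term(2)] obtain K where K: "\<forall>u. norm u \<le> R \<longrightarrow> norm (a u) \<le> K"
      by blast
    have "norm (p (of_int N *\<^sub>R u) *\<^sub>R a u) \<le> B * K" if "norm u \<le> R" for N u
      using B K that by (auto intro!: mult_mono intro: order_trans[OF abs_ge_zero])
    then show "\<exists>K. \<forall>N u. N \<noteq> 0 \<longrightarrow> norm u \<le> R \<longrightarrow> norm (p (of_int N *\<^sub>R u) *\<^sub>R a u) \<le> K" by blast
  qed
next
  case (osc_add m F G)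
  show ?case unfolding uniformly_locally_bounded_def
  proof
    fix R
    obtain K where K: "\<forall>N u. N \<noteq> 0 \<longrightarrow> norm u \<le> R \<longrightarrow> norm (F N u) \<le> K"
      by (rule uniformly_locally_boundedE[OF osc_add.IH(1), where R = R])
    obtain L where L: "\<forall>N u. N \<noteq> 0 \<longrightarrow> norm u \<le> R \<longrightarrow> norm (G N u) \<le> L"
      by (rule uniformly_locally_boundedE[OF osc_add.IH(2), where R = R])
    have "\<forall>N u. N \<noteq> 0 \<longrightarrow> norm u \<le> R \<longrightarrow> norm (F N u + G N u) \<le> K + L"
      using K L by (blast intro: norm_triangle_mono)
    then show "\<exists>K. \<forall>N u. N \<noteq> 0 \<longrightarrow> norm u \<le> R \<longrightarrow> norm (F N u + G N u) \<le> K" by blast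
  qed
next
  case (osc_shift m F)
  show ?case unfolding uniformly_locally_bounded_def
  proof
    fix R
    obtain K where K: "\<forall>N u. N \<noteq> 0 \<longrightarrow> norm u \<le> R \<longrightarrow> norm (F N u) \<le> K"
      by (rule uniformly_locally_boundedE[OF osc_shift.IH, where R = R])
    have "norm ((1 / real_of_int N) *\<^sub>R F N u) \<le> K" if "N \<noteq> 0" "norm u \<le> R" for N u
    proof -
      have "norm ((1 / real_of_int N) *\<^sub>R F N u) \<le> 1 * norm (F N u)"
        unfolding norm_scaleR using that by (intro mult_right_mono) (auto simp: divide_simps)
      moreover have "norm (F N u) \<le> K" using K that by blast
      ultimately show ?thesis by linarith
    qed
    then show "\<exists>K. \<forall>N u. N \<noteq> 0 \<longrightarrow> norm u \<le> R \<longrightarrow> norm ((1 / real_of_int N) *\<^sub>R F N u) \<le> K" by blast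
  qed
next
  case (osc_cong m F G)
  then show ?case unfolding uniformly_locally_bounded_def by (simp cong: conj_cong)
qed

lemma osc_zero: "osc_expandable m (\<lambda>N u. 0)"
  using osc_term[of "\<lambda>_. 0" m "\<lambda>_. 0"] by (auto simp: bounded_periodic_def C_k_zero)

lemma osc_sum: "(\<And>i. i \<in> I \<Longrightarrow> osc_expandable m (F i)) \<Longrightarrow> osc_expandable m (\<lambda>N u. \<Sum>i\<in>I. F i N u)"
  by (induction I rule: infinite_finite_induct) (auto intro: osc_zero osc_add)

lemma osc_minus: "osc_expandable m F \<Longrightarrow> osc_expandable m (\<lambda>N u. - F N u)"
proof (induction rule: osc_expandable.induct)
  case (osc_term p m a)
  show ?case
    using osc_expandable.osc_term[OF osc_term(1) C_k_scaleR[OF osc_term(2), of "-1"]] by simp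
next
  case (osc_add m F G)
  show ?case using osc_expandable.osc_add[OF osc_add.IH] by (simp add: algebra_simps)
next
  case (osc_shift m F)
  show ?case using osc_expandable.osc_shift[OF osc_shift.IH] by simp
next
  case (osc_cong m F G)
  show ?case by (rule osc_expandable.osc_cong[OF osc_cong.IH]) (simp add: osc_cong)
qed (auto intro!: osc_rem simp: uniformly_locally_bounded_def)

lemma osc_shift_power: "osc_expandable m F \<Longrightarrow> osc_expandable (j + m) (\<lambda>N u. (1 / of_int N ^ j) *\<^sub>R F N u)"
proof (induction j)
  case (Suc j)
  show ?case using osc_shift[OF Suc.IH[OF Suc.prems]] by simp
qed simp

text \<open>
  An integral matrix maps the lattice into itself, so \<open>y \<mapsto> p (N v + A y) = p (A y)\<close> is again
  periodic. The matrix may be singular: substituting one coordinate for another, or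
  the constant \<open>1\<close> for a coordinate, is such a map.
\<close>

lemma osc_substitute:
  fixes A :: "real ^ 'm ^ 'n" and F :: "int \<Rightarrow> real ^ 'n \<Rightarrow> 'b::euclidean_space"
  assumes "osc_expandable m F" and v: "v \<in> integer_lattice" and A: "\<And>i j. A $ i $ j \<in> \<int>"
  shows "osc_expandable m (\<lambda>N u. F N (v + A *v u))"
  using assms(1)
proof (induction rule: osc_expandable.induct)
  case (osc_term p m a)
  have "p (of_int N *\<^sub>R (v + A *v u)) = p (A *v (of_int N *\<^sub>R u))" for N u
  proof -
    have "p (A *v (of_int N *\<^sub>R u) + of_int N *\<^sub>R v) = p (A *v (of_int N *\<^sub>R u))"
      using osc_term(1) integer_lattice_scale[OF v] unfolding bounded_periodic_def by blast
    then show ?thesis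
      by (simp add: matrix_vector_mult_scaleR scaleR_add_right add.commute)
  qed
  then show ?case
    using osc_expandable.osc_term[OF bounded_periodic_matrix[OF osc_term(1) A] C_k_compose_affine[OF osc_term(2), of v A]]
    by simp
next
  case (osc_rem F)
  show ?case
  proof (rule osc_expandable.osc_rem)
    show "(\<lambda>u. F N (v + A *v u)) \<in> borel_measurable borel" if "N \<noteq> 0" for N
      using osc_rem(1)[OF that] by measurable
    show "uniformly_locally_bounded (\<lambda>N u. F N (v + A *v u))"
      unfolding uniformly_locally_bounded_def
    proof
      fix R
      obtain B where B: "\<And>u. norm (A *v u) \<le> norm u * B" "B > 0"
        using bounded_linear.pos_bounded[OF matrix_vector_mul_bounded_linear[of A]] by blast
      obtain K where K: "\<forall>N u. N \<noteq> 0 \<longrightarrow> norm u \<le> norm v + R * B \<longrightarrow> norm (F N u) \<le> K"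
        by (rule uniformly_locally_boundedE[OF osc_rem(2), where R = "norm v + R * B"])
      have "norm (v + A *v u) \<le> norm v + R * B" if "norm u \<le> R" for u
      proof -
        have "norm (A *v u) \<le> norm u * B" by (rule B)
        also have "\<dots> \<le> R * B" using that B(2) by (intro mult_right_mono) auto
        finally show ?thesis by (intro norm_triangle_le) simp
      qed
      with K show "\<exists>K. \<forall>N u. N \<noteq> 0 \<longrightarrow> norm u \<le> R \<longrightarrow> norm (F N (v + A *v u)) \<le> K" by blast
    qed
  qed
next
  case (osc_add m F G)
  then show ?case by (intro osc_expandable.osc_add)
next
  case (osc_shift m F)
  then show ?case by (intro osc_expandable.osc_shift)
next
  case (osc_cong m F G)
  then show ?case by (intro osc_expandable.osc_cong[OF osc_cong.IH]) simp
qed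

text \<open>
  The expansion has the same coefficients and the same constant for positive and
  negative \<open>N\<close>. This is what removes the odd powers in the end.
\<close>

definition has_expansion :: "nat \<Rightarrow> (int \<Rightarrow> 'b::real_normed_vector) \<Rightarrow> bool" where
  "has_expansion m S \<longleftrightarrow> (\<exists>c K. \<forall>N. N \<noteq> 0 \<longrightarrow>
     norm (S N - (\<Sum>j<m. (1 / of_int N ^ j) *\<^sub>R c j)) \<le> K / \<bar>of_int N\<bar> ^ m)"

lemma has_expansionI:
  "(\<And>N. N \<noteq> 0 \<Longrightarrow> norm (S N - (\<Sum>j<m. (1 / of_int N ^ j) *\<^sub>R c j)) \<le> K / \<bar>of_int N\<bar> ^ m) \<Longrightarrow>
    has_expansion m S"
  unfolding has_expansion_def by (intro exI[of _ c] exI[of _ K]) simp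

lemma has_expansionE:
  assumes "has_expansion m S"
  obtains c K where "\<forall>N. N \<noteq> 0 \<longrightarrow>
    norm (S N - (\<Sum>j<m. (1 / of_int N ^ j) *\<^sub>R c j)) \<le> K / \<bar>of_int N\<bar> ^ m"
  using assms unfolding has_expansion_def by (elim exE)

lemma has_expansion_cong:
  assumes "has_expansion m S" "\<And>N. N \<noteq> 0 \<Longrightarrow> S' N = S N"
  shows "has_expansion m S'"
  using assms unfolding has_expansion_def by simp

lemma has_expansion_const: "has_expansion m (\<lambda>N. b)"
proof (cases m)
  case 0
  show ?thesis unfolding 0 by (rule has_expansionI[where K = "norm b"]) simp
next
  case (Suc m')
  show ?thesis unfolding Suc
    by (rule has_expansionI[where c = "\<lambda>j. if j = 0 then b else 0" and K = 0])
      (simp add: sum.lessThan_Suc_shift del: sum.lessThan_Suc)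
qed

lemma has_expansion_add:
  assumes "has_expansion m S" "has_expansion m S'"
  shows "has_expansion m (\<lambda>N. S N + S' N)"
proof -
  obtain c K where
    c: "\<forall>N. N \<noteq> 0 \<longrightarrow> norm (S N - (\<Sum>j<m. (1 / of_int N ^ j) *\<^sub>R c j)) \<le> K / \<bar>of_int N\<bar> ^ m"
    by (rule has_expansionE[OF assms(1)])
  obtain d L where
    d: "\<forall>N. N \<noteq> 0 \<longrightarrow> norm (S' N - (\<Sum>j<m. (1 / of_int N ^ j) *\<^sub>R d j)) \<le> L / \<bar>of_int N\<bar> ^ m"
    by (rule has_expansionE[OF assms(2)])
  show ?thesis
  proof (rule has_expansionI[where c = "\<lambda>j. c j + d j" and K = "K + L"])
    fix N :: int assume "N \<noteq> 0"
    then show "norm (S N + S' N - (\<Sum>j<m. (1 / of_int N ^ j) *\<^sub>R (c j + d j))) \<le> (K + L) / \<bar>of_int N\<bar> ^ m"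
      using norm_triangle_mono[OF c[rule_format] d[rule_format], of N N]
      by (simp add: scaleR_add_right sum.distrib add_divide_distrib add_diff_add)
  qed
qed

lemma has_expansion_scaleR:
  assumes "has_expansion m S"
  shows "has_expansion m (\<lambda>N. b *\<^sub>R S N)"
proof -
  obtain c K where
    c: "\<forall>N. N \<noteq> 0 \<longrightarrow> norm (S N - (\<Sum>j<m. (1 / of_int N ^ j) *\<^sub>R c j)) \<le> K / \<bar>of_int N\<bar> ^ m"
    by (rule has_expansionE[OF assms])
  show ?thesis
  proof (rule has_expansionI[where c = "\<lambda>j. b *\<^sub>R c j" and K = "\<bar>b\<bar> * K"])
    fix N :: int assume N: "N \<noteq> 0"
    have "b *\<^sub>R S N - (\<Sum>j<m. (1 / of_int N ^ j) *\<^sub>R b *\<^sub>R c j) = b *\<^sub>R (S N - (\<Sum>j<m. (1 / of_int N ^ j) *\<^sub>R c j))"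
      by (simp only: scaleR_diff_right scaleR_sum_right scaleR_left_commute)
    then show "norm (b *\<^sub>R S N - (\<Sum>j<m. (1 / of_int N ^ j) *\<^sub>R b *\<^sub>R c j)) \<le> \<bar>b\<bar> * K / \<bar>of_int N\<bar> ^ m"
      using mult_left_mono[OF c[rule_format, OF N], of "\<bar>b\<bar>"] by simp
  qed
qed

lemma has_expansion_sum:
  "(\<And>i. i \<in> I \<Longrightarrow> has_expansion m (S i)) \<Longrightarrow> has_expansion m (\<lambda>N. \<Sum>i\<in>I. S i N)"
  by (induction I rule: infinite_finite_induct) (auto intro: has_expansion_const has_expansion_add)

lemma has_expansion_shift:
  assumes "has_expansion m S"
  shows "has_expansion (Suc m) (\<lambda>N. (1 / of_int N) *\<^sub>R S N)"
proof -
  obtain c K where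
    c: "\<forall>N. N \<noteq> 0 \<longrightarrow> norm (S N - (\<Sum>j<m. (1 / of_int N ^ j) *\<^sub>R c j)) \<le> K / \<bar>of_int N\<bar> ^ m"
    by (rule has_expansionE[OF assms])
  show ?thesis
  proof (rule has_expansionI[where c = "\<lambda>j. if j = 0 then 0 else c (j - 1)" and K = K])
    fix N :: int assume N: "N \<noteq> 0"
    have "(1 / of_int N) *\<^sub>R S N - (\<Sum>j<Suc m. (1 / of_int N ^ j) *\<^sub>R (if j = 0 then 0 else c (j - 1)))
      = (1 / of_int N) *\<^sub>R (S N - (\<Sum>j<m. (1 / of_int N ^ j) *\<^sub>R c j))"
      unfolding sum.lessThan_Suc_shift by (simp add: scaleR_diff_right scaleR_sum_right)
    also have "norm \<dots> \<le> \<bar>1 / of_int N\<bar> * (K / \<bar>of_int N\<bar> ^ m)"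
      unfolding norm_scaleR using c N by (intro mult_left_mono) auto
    finally show "norm ((1 / of_int N) *\<^sub>R S N - (\<Sum>j<Suc m. (1 / of_int N ^ j) *\<^sub>R (if j = 0 then 0 else c (j - 1))))
       \<le> K / \<bar>of_int N\<bar> ^ Suc m" by simp
  qed
qed

text \<open>
  At the origin the periodic factors \<open>p (N u)\<close> become the constants \<open>p 0\<close>.
\<close>

lemma osc_expansion_at_0: "osc_expandable m F \<Longrightarrow> has_expansion m (\<lambda>N. F N 0)"
proof (induction rule: osc_expandable.induct)
  case (osc_term p m a)
  show ?case by (simp add: has_expansion_const)
next
  case (osc_rem F)
  obtain K where K: "\<forall>N u. N \<noteq> 0 \<longrightarrow> norm u \<le> 0 \<longrightarrow> norm (F N u) \<le> K"
    by (rule uniformly_locally_boundedE[OF osc_rem(2), where R = 0])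
  show ?case by (rule has_expansionI[where K = K]) (simp add: K)
next
  case (osc_cong m F G)
  show ?case by (rule has_expansion_cong[OF osc_cong.IH]) (simp add: osc_cong.hyps)
qed (auto intro: has_expansion_add has_expansion_shift)

section \<open>Integration by parts and periodic primitives on the line\<close>

lemma integrable_lborel_bounded_support:
  fixes h :: "'a::euclidean_space \<Rightarrow> 'b::{banach, second_countable_topology}"
  assumes "h \<in> borel_measurable borel" "\<And>x. norm x \<le> R \<Longrightarrow> norm (h x) \<le> K"
    and "\<And>x. R < norm x \<Longrightarrow> h x = 0"
  shows "integrable lborel h"
proof -
  have "integrable lborel (\<lambda>x. indicator (cball 0 R) x *\<^sub>R h x)"
    using assms(1,2) emeasure_bounded_finite[OF bounded_cball]
    by (intro integrableI_bounded_set_indicator[where B = K]) auto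
  also have "(\<lambda>x. indicator (cball 0 R) x *\<^sub>R h x) = h"
    using assms(3) by (auto simp: indicator_def fun_eq_iff not_le)
  finally show ?thesis .
qed

lemma set_integrable_bounded_Icc:
  fixes h :: "real \<Rightarrow> 'b::{banach, second_countable_topology}"
  assumes "h \<in> borel_measurable borel" "\<And>s. s \<in> {a..b} \<Longrightarrow> norm (h s) \<le> K"
  shows "set_integrable lborel {a..b} h"
  unfolding set_integrable_def using assms emeasure_bounded_finite[of "{a..b}"]
  by (intro integrableI_bounded_set_indicator[where B = K]) auto

lemma norm_LINT_Icc_le:
  fixes h :: "real \<Rightarrow> 'b::{banach, second_countable_topology}"
  assumes "h \<in> borel_measurable borel" "\<And>s. s \<in> {0..1} \<Longrightarrow> norm (h s) \<le> K"
  shows "norm (LINT s:{0..1}|lborel. h s) \<le> K"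
proof -
  have i: "set_integrable lborel {0..1} h" by (rule set_integrable_bounded_Icc[OF assms])
  have "norm (LINT s:{0..1}|lborel. h s) \<le> (LINT s:{0..1}|lborel. norm (h s))"
    by (rule set_integral_norm_bound[OF i])
  also have "\<dots> \<le> (LINT s:{0..1::real}|lborel. K)"
    using assms by (intro set_integral_mono set_integrable_norm i set_integrable_bounded_Icc[where K = "\<bar>K\<bar>"]) auto
  also have "\<dots> = K" by (simp add: set_lebesgue_integral_def)
  finally show ?thesis .
qed

lemma set_integral_Icc_scale:
  fixes h :: "real \<Rightarrow> 'b::{banach, second_countable_topology}"
  assumes [measurable]: "h \<in> borel_measurable borel" and r: "0 \<le> r"
  shows "(LINT s:{0..r}|lborel. h s) = r *\<^sub>R (LINT s:{0..1}|lborel. h (s * r))"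
proof (cases "r = 0")
  case True
  have "(LINT s|lborel. indicator {0..r} s *\<^sub>R h s) = integral\<^sup>L lborel (\<lambda>s :: real. 0)"
    by (intro integral_cong_AE AE_mp[OF AE_lborel_singleton[of "0::real"] AE_I2])
      (measurable, auto simp: True indicator_def)
  then show ?thesis using True by (simp add: set_lebesgue_integral_def)
next
  case False
  have "(LINT s|lborel. indicator {0..r} s *\<^sub>R h s)
    = \<bar>r\<bar> *\<^sub>R (LINT s|lborel. indicator {0..r} (0 + r * s) *\<^sub>R h (0 + r * s))"
    by (rule lborel_integral_real_affine[OF False])
  also have "(\<lambda>s. indicator {0..r} (0 + r * s) *\<^sub>R h (0 + r * s)) = (\<lambda>s. indicator {0..1} s *\<^sub>R h (s * r))"
    using r False by (auto simp: fun_eq_iff indicator_def mult.commute zero_le_mult_iff)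
  finally show ?thesis using r by (simp add: set_lebesgue_integral_def)
qed

text \<open>
  The factor \<open>\<kappa>\<close> is merely bounded and measurable, so that its primitive need not be differentiable
  anywhere in particular. Instead of the product rule, the proof writes
  \<open>\<alpha> 1 - \<alpha> s\<close> as the integral of \<open>\<alpha>'\<close> over \<open>[s, 1]\<close> and exchanges the two integrations.
  The primitive appears as \<open>r\<close> times an integral over \<open>[0, 1]\<close>.
\<close>

lemma integration_by_parts_primitive:
  fixes \<kappa> :: "real \<Rightarrow> real" and \<alpha> \<alpha>' :: "real \<Rightarrow> 'b::euclidean_space"
  assumes [measurable]: "\<kappa> \<in> borel_measurable borel" and B: "\<And>s. \<bar>\<kappa> s\<bar> \<le> B"
    and \<alpha>: "\<And>s. (\<alpha> has_vector_derivative \<alpha>' s) (at s)" and \<alpha>': "continuous_on UNIV \<alpha>'"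
  shows "(LINT s:{0..1}|lborel. \<kappa> s *\<^sub>R \<alpha> s) =
    (LINT s:{0..1}|lborel. \<kappa> s) *\<^sub>R \<alpha> 1
    - (LINT r:{0..1}|lborel. (r * (LINT s:{0..1}|lborel. \<kappa> (s * r))) *\<^sub>R \<alpha>' r)"
proof -
  have m' [measurable]: "\<alpha>' \<in> borel_measurable borel"
    using \<alpha>' by (rule borel_measurable_continuous_onI)
  have c\<alpha>: "continuous_on UNIV \<alpha>"
    using has_vector_derivative_continuous[OF \<alpha>] by (intro continuous_at_imp_continuous_on) auto
  then have m [measurable]: "\<alpha> \<in> borel_measurable borel"
    by (rule borel_measurable_continuous_onI)
  have "compact (\<alpha>' ` {0..1})" "compact (\<alpha> ` {0..1})"
    using \<alpha>' c\<alpha> by (auto intro!: compact_continuous_image elim: continuous_on_subset)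
  then obtain K L where K: "\<And>s. s \<in> {0..1} \<Longrightarrow> norm (\<alpha>' s) \<le> K" and L: "\<And>s. s \<in> {0..1} \<Longrightarrow> norm (\<alpha> s) \<le> L"
    by (fastforce dest!: compact_imp_bounded simp: bounded_iff)
  have K0: "K \<ge> 0" using order_trans[OF norm_ge_zero K[of 0]] by simp
  have B0: "B \<ge> 0" using B[of 0] by linarith
  \<comment> \<open>the double integrand, supported on the triangle \<open>0 \<le> s \<le> r \<le> 1\<close>\<close>
  define H :: "real \<times> real \<Rightarrow> 'b" where
    "H = (\<lambda>(s, r). (indicator {0..1} s * indicator {s..1} r * \<kappa> s) *\<^sub>R \<alpha>' r)"
  have Hm [measurable]: "H \<in> borel_measurable (borel \<Otimes>\<^sub>M borel)"
  proof -
    have "H = (\<lambda>(s, r). ((if 0 \<le> s \<and> s \<le> 1 \<and> s \<le> r \<and> r \<le> 1 then 1 else 0) * \<kappa> s) *\<^sub>R \<alpha>' r)"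
      by (auto simp: H_def indicator_def fun_eq_iff)
    then show ?thesis by (simp only:) measurable
  qed
  have Hi: "integrable (lborel \<Otimes>\<^sub>M lborel) H"
    unfolding lborel_prod
  proof (rule integrable_lborel_bounded_support[where R = 2 and K = "B * K"])
    show "H \<in> borel_measurable borel" using Hm by (simp add: borel_prod)
    fix p :: "real \<times> real"
    obtain s r where p: "p = (s, r)" by (cases p)
    have *: "norm (H p) \<le> B * K \<and> (2 < norm p \<longrightarrow> H p = 0)"
    proof (cases "0 \<le> s \<and> s \<le> 1 \<and> s \<le> r \<and> r \<le> 1")
      case True
      then have "norm (H p) \<le> B * K"
        using B[of s] K[of r] B0 by (auto simp: H_def p intro!: mult_mono)
      moreover have "norm p \<le> norm s + norm r" unfolding p by (rule norm_Pair_le)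
      ultimately show ?thesis using True by auto
    next
      case False
      then have "H p = 0" by (auto simp: H_def p indicator_def)
      then show ?thesis using B0 K0 by simp
    qed
    then show "norm (H p) \<le> B * K" "2 < norm p \<Longrightarrow> H p = 0" by auto
  qed
  have FTC: "(LINT r|lborel. indicator {s..1} r *\<^sub>R \<alpha>' r) = \<alpha> 1 - \<alpha> s" if "s \<le> 1" for s
    using that has_bochner_integral_FTC_Icc[of s 1 \<alpha> \<alpha>'] \<alpha> \<alpha>'
    by (auto dest!: has_bochner_integral_integral_eq
        intro: has_vector_derivative_at_within continuous_on_subset)
  have prim: "(LINT s|lborel. indicator {0..r} s * \<kappa> s) = r * (LINT s:{0..1}|lborel. \<kappa> (s * r))"
    if "0 \<le> r" for r
    using set_integral_Icc_scale[OF assms(1) that] by (simp add: set_lebesgue_integral_def)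
  have s1: "set_integrable lborel {0..1} (\<lambda>s. \<kappa> s *\<^sub>R \<alpha> 1)"
    using B B0 by (intro set_integrable_bounded_Icc[where K = "B * norm (\<alpha> 1)"]) (auto intro!: mult_mono)
  have "set_integrable lborel {0..1} \<kappa>"
    using B by (intro set_integrable_bounded_Icc[where K = B]) auto
  then have s01: "(LINT s:{0..1}|lborel. \<kappa> s *\<^sub>R \<alpha> 1) = (LINT s:{0..1}|lborel. \<kappa> s) *\<^sub>R \<alpha> 1"
    unfolding set_integrable_def set_lebesgue_integral_def scaleR_scaleR[symmetric]
    using integral_scaleR_left[of "\<alpha> 1" lborel "\<lambda>s. indicator {0..1} s *\<^sub>R \<kappa> s"] by simp
  have s2: "set_integrable lborel {0..1} (\<lambda>s. \<kappa> s *\<^sub>R \<alpha> s)"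
    using B B0 L by (intro set_integrable_bounded_Icc[where K = "B * L"]) (auto intro!: mult_mono)
  have "(LINT s:{0..1}|lborel. \<kappa> s) *\<^sub>R \<alpha> 1 - (LINT s:{0..1}|lborel. \<kappa> s *\<^sub>R \<alpha> s)
    = (LINT s:{0..1}|lborel. \<kappa> s *\<^sub>R (\<alpha> 1 - \<alpha> s))"
    using set_integral_diff(2)[OF s1 s2] s01 by (simp add: scaleR_diff_right)
  also have "\<dots> = (LINT s|lborel. LINT r|lborel. H (s, r))"
    unfolding set_lebesgue_integral_def
  proof (intro Bochner_Integration.integral_cong refl)
    fix s :: real
    have "(LINT r|lborel. H (s, r)) = (LINT r|lborel. (indicator {0..1} s * \<kappa> s) *\<^sub>R (indicator {s..1} r *\<^sub>R \<alpha>' r))"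
      by (simp add: H_def mult_ac)
    also have "\<dots> = (indicator {0..1} s * \<kappa> s) *\<^sub>R (LINT r|lborel. indicator {s..1} r *\<^sub>R \<alpha>' r)"
      by (rule integral_scaleR_right)
    also have "\<dots> = (indicator {0..1} s * \<kappa> s) *\<^sub>R (\<alpha> 1 - \<alpha> s)"
      using FTC[of s] by (auto simp: indicator_def)
    finally show "indicator {0..1} s *\<^sub>R \<kappa> s *\<^sub>R (\<alpha> 1 - \<alpha> s) = (LINT r|lborel. H (s, r))" by simp
  qed
  also have "\<dots> = (LINT r|lborel. LINT s|lborel. H (s, r))"
    using lborel_pair.Fubini_integral[of "\<lambda>s r. H (s, r)"] Hi by simp
  also have "\<dots> = (LINT r:{0..1}|lborel. (r * (LINT s:{0..1}|lborel. \<kappa> (s * r))) *\<^sub>R \<alpha>' r)"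
    unfolding set_lebesgue_integral_def[of lborel "{0..1}" "\<lambda>r. (_ r) *\<^sub>R \<alpha>' r"]
  proof (intro Bochner_Integration.integral_cong refl)
    fix r :: real
    have eq: "H (s, r) = (indicator {0..r} s * \<kappa> s) *\<^sub>R indicator {0..1} r *\<^sub>R \<alpha>' r" for s
      by (auto simp: H_def indicator_def)
    have "(LINT s|lborel. H (s, r)) = (LINT s|lborel. indicator {0..r} s * \<kappa> s) *\<^sub>R indicator {0..1} r *\<^sub>R \<alpha>' r"
      unfolding eq by (rule integral_scaleR_left)
       (auto intro!: integrable_lborel_bounded_support[where R = "\<bar>r\<bar>" and K = B] simp: indicator_def B B0)
    then show "(LINT s|lborel. H (s, r)) =
       indicator {0..1} r *\<^sub>R (r * (LINT s:{0..1}|lborel. \<kappa> (s * r))) *\<^sub>R \<alpha>' r"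
      using prim[of r] by (auto simp: indicator_def)
  qed
  finally show ?thesis by (simp add: algebra_simps)
qed

text \<open>
  The left-hand side is the oriented integral of \<open>g\<close> from \<open>0\<close> to \<open>t\<close>. The half-open
  indicators on the right are additive in \<open>t\<close> whatever the sign of \<open>t\<close>.
\<close>

lemma scaled_primitive_eq:
  fixes g :: "real \<Rightarrow> real"
  assumes [measurable]: "g \<in> borel_measurable borel"
  shows "t * (LINT s:{0..1}|lborel. g (s * t)) =
    (LINT s|lborel. (indicator {0<..t} s - indicator {t<..0} s) * g s)"
proof -
  have AE0: "AE s in lborel. s \<noteq> (c::real)" for c by (rule AE_lborel_singleton)
  consider "t = 0" | "t > 0" | "t < 0" by linarith
  then show ?thesis
  proof cases
    case 2
    have "(LINT s|lborel. (indicator {0<..t} s - indicator {t<..0} s) * g s) = (LINT s|lborel. indicator {0..t} s * g s)"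
      using 2 by (intro integral_cong_AE AE_mp[OF AE0[of 0] AE_I2]) (measurable, auto simp: indicator_def)
    also have "\<dots> = \<bar>t\<bar> *\<^sub>R (LINT s|lborel. indicator {0..t} (0 + t * s) * g (0 + t * s))"
      using 2 by (intro lborel_integral_real_affine) auto
    also have "(\<lambda>s. indicator {0..t} (0 + t * s) * g (0 + t * s)) = (\<lambda>s. indicator {0..1} s * g (s * t))"
      using 2 by (auto simp: fun_eq_iff indicator_def mult.commute zero_le_mult_iff)
    finally show ?thesis using 2 by (simp add: set_lebesgue_integral_def)
  next
    case 3
    have "(LINT s|lborel. (indicator {0<..t} s - indicator {t<..0} s) * g s) = (LINT s|lborel. - (indicator {t..0} s * g s))"
      using 3 by (intro integral_cong_AE AE_mp[OF AE0[of t] AE_I2]) (measurable, auto simp: indicator_def)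
    also have "\<dots> = - (LINT s|lborel. indicator {t..0} s * g s)" by simp
    also have "(LINT s|lborel. indicator {t..0} s * g s) = \<bar>t\<bar> *\<^sub>R (LINT s|lborel. indicator {t..0} (0 + t * s) * g (0 + t * s))"
      using 3 by (intro lborel_integral_real_affine) auto
    also have "(\<lambda>s. indicator {t..0} (0 + t * s) * g (0 + t * s)) = (\<lambda>s. indicator {0..1} s * g (s * t))"
      using 3 by (auto simp: fun_eq_iff indicator_def mult.commute mult_le_0_iff)
    finally show ?thesis using 3 by (simp add: set_lebesgue_integral_def)
  qed auto
qed

text \<open>
  The interval \<open>(t, t + 1]\<close> is shifted by an integer into \<open>(r, r + 1]\<close> with \<open>0 \<le> r < 1\<close>; then
  the part beyond \<open>1\<close> is moved back by one period.
\<close>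

lemma integral_period:
  fixes g :: "real \<Rightarrow> real"
  assumes [measurable]: "g \<in> borel_measurable borel" and B: "\<And>s. \<bar>g s\<bar> \<le> B"
    and per: "\<And>s. g (s + 1) = g s"
  shows "(LINT s|lborel. indicator {t<..t + 1} s * g s) = (LINT s:{0..1}|lborel. g s)"
proof -
  have B0: "0 \<le> B" using B[of 0] by linarith
  have int: "integrable lborel (\<lambda>s. indicator {a<..b} s * g s)" for a b
    using B B0 by (intro integrable_lborel_bounded_support[where R = "max \<bar>a\<bar> \<bar>b\<bar>" and K = B])
      (auto simp: indicator_def)
  have shift1: "(LINT s|lborel. indicator {a + 1<..b + 1} s * g s) = (LINT s|lborel. indicator {a<..b} s * g s)" for a b
  proof -
    have "(LINT s|lborel. indicator {a + 1<..b + 1} s * g s)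
      = \<bar>1\<bar> *\<^sub>R (LINT s|lborel. indicator {a + 1<..b + 1} (1 + 1 * s) * g (1 + 1 * s))"
      by (rule lborel_integral_real_affine) simp
    also have "(\<lambda>s. indicator {a + 1<..b + 1} (1 + 1 * s) * g (1 + 1 * s)) = (\<lambda>s. indicator {a<..b} s * g s)"
      using per by (auto simp: fun_eq_iff indicator_def add.commute)
    finally show ?thesis by simp
  qed
  have shiftn: "(LINT s|lborel. indicator {a + real n<..b + real n} s * g s) = (LINT s|lborel. indicator {a<..b} s * g s)" for a b n
  proof (induction n)
    case (Suc n)
    show ?case using shift1[of "a + n" "b + n"] Suc by (simp add: algebra_simps)
  qed simp
  have shift: "(LINT s|lborel. indicator {a + of_int k<..b + of_int k} s * g s) = (LINT s|lborel. indicator {a<..b} s * g s)" for a b k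
  proof (cases "k \<ge> 0")
    case True
    then show ?thesis using shiftn[of a "nat k" b] by simp
  next
    case False
    then show ?thesis using shiftn[of "a + of_int k" "nat (-k)" "b + of_int k"] by simp
  qed
  define r where "r = frac t"
  have r: "0 \<le> r" "r < 1" "t = r + of_int \<lfloor>t\<rfloor>" by (auto simp: r_def frac_def frac_lt_1 frac_ge_0) linarith
  have "(LINT s|lborel. indicator {t<..t + 1} s * g s) = (LINT s|lborel. indicator {r<..r + 1} s * g s)"
    using shift[of r "\<lfloor>t\<rfloor>" "r + 1"] r(3) by (simp add: algebra_simps)
  also have "\<dots> = (LINT s|lborel. indicator {r<..1} s * g s + indicator {0 + 1<..r + 1} s * g s)"
    using r by (intro Bochner_Integration.integral_cong) (auto simp: indicator_def)
  also have "\<dots> = (LINT s|lborel. indicator {r<..1} s * g s) + (LINT s|lborel. indicator {0 + 1<..r + 1} s * g s)"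
    by (rule Bochner_Integration.integral_add[OF int int])
  also have "\<dots> = (LINT s|lborel. indicator {r<..1} s * g s) + (LINT s|lborel. indicator {0<..r} s * g s)"
    using shift1[of 0 r] by simp
  also have "\<dots> = (LINT s|lborel. indicator {r<..1} s * g s + indicator {0<..r} s * g s)"
    by (rule Bochner_Integration.integral_add[OF int int, symmetric])
  also have "\<dots> = (LINT s:{0..1}|lborel. g s)"
    unfolding set_lebesgue_integral_def using r
    by (intro integral_cong_AE AE_mp[OF AE_lborel_singleton[of "0::real"] AE_I2])
      (measurable, auto simp: indicator_def)
  finally show ?thesis .
qed

text \<open>
  A periodic function of mean zero has a periodic primitive, which is then bounded by
  its values on one period.
\<close>

lemma scaled_primitive_periodic:
  fixes g :: "real \<Rightarrow> real"
  assumes [measurable]: "g \<in> borel_measurable borel" and B: "\<And>s. \<bar>g s\<bar> \<le> B"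
    and per: "\<And>s. g (s + 1) = g s" and mean: "(LINT s:{0..1}|lborel. g s) = 0"
  shows "(t + of_int k) * (LINT s:{0..1}|lborel. g (s * (t + of_int k))) = t * (LINT s:{0..1}|lborel. g (s * t))"
    and "\<bar>t * (LINT s:{0..1}|lborel. g (s * t))\<bar> \<le> B"
proof -
  define G where "G t = t * (LINT s:{0..1}|lborel. g (s * t))" for t
  have B0: "0 \<le> B" using B[of 0] by linarith
  have int: "integrable lborel (\<lambda>s. (indicator {0<..t} s - indicator {t<..0} s) * g s)" for t
    using B B0 by (intro integrable_lborel_bounded_support[where R = "\<bar>t\<bar>" and K = B])
      (auto simp: indicator_def)
  have 1: "G (t + 1) = G t" for t
  proof -
    have "G (t + 1) - G t = (LINT s|lborel. (indicator {0<..t+1} s - indicator {t+1<..0} s) * g s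
       - (indicator {0<..t} s - indicator {t<..0} s) * g s)"
      unfolding G_def scaled_primitive_eq[OF assms(1)]
      by (rule Bochner_Integration.integral_diff[OF int int, symmetric])
    also have "\<dots> = (LINT s|lborel. indicator {t<..t + 1} s * g s)"
      by (intro Bochner_Integration.integral_cong) (auto simp: indicator_def)
    also have "\<dots> = 0" using integral_period[OF assms(1-3)] mean by simp
    finally show ?thesis by simp
  qed
  have n: "G (t + real n) = G t" for n t
  proof (induction n)
    case (Suc n)
    then show ?case using 1[of "t + n"] by (simp add: algebra_simps)
  qed simp
  have k: "G (t + of_int k) = G t" for t k
  proof (cases "k \<ge> 0")
    case True
    then show ?thesis using n[of t "nat k"] by simp
  next
    case False
    then show ?thesis using n[of "t + of_int k" "nat (-k)"] by simp
  qed
  then show "(t + of_int k) * (LINT s:{0..1}|lborel. g (s * (t + of_int k))) = t * (LINT s:{0..1}|lborel. g (s * t))"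
    by (simp add: G_def)
  have "G t = G (frac t)" using k[of "frac t" "\<lfloor>t\<rfloor>"] by (simp add: frac_def)
  also have "\<bar>\<dots>\<bar> \<le> 1 * B"
    unfolding G_def abs_mult
    using norm_LINT_Icc_le[of "\<lambda>s. g (s * frac t)" B] B B0 frac_lt_1[of t]
    by (intro mult_mono) (auto simp: less_imp_le)
  finally show "\<bar>t * (LINT s:{0..1}|lborel. g (s * t))\<bar> \<le> B" by (simp add: G_def)
qed

section \<open>Integration along one coordinate\<close>

lemma borel_measurable_scale_coord [measurable]:
  assumes [measurable]: "f \<in> borel_measurable M" "g \<in> borel_measurable M"
  shows "(\<lambda>x. scale_coord i (f x) (g x)) \<in> borel_measurable M"
  by (intro borel_measurable_continuous_Pair[OF assms] continuous_intros)

lemma norm_scale_coord_le: "s \<in> {0..1} \<Longrightarrow> norm (scale_coord i s u) \<le> norm u"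
  by (rule norm_le_componentwise_cart)
    (auto simp: scale_coord_def abs_mult intro: mult_left_le_one_le)

lemma scale_coord_scaleR: "scale_coord i s (c *\<^sub>R u) = c *\<^sub>R scale_coord i s u"
  by (simp add: scale_coord_def vec_eq_iff)

lemma scale_coord_scale_coord: "scale_coord i s (scale_coord i r u) = scale_coord i (s * r) u"
  by (simp add: scale_coord_def vec_eq_iff)

lemma scale_coord_1 [simp]: "scale_coord i 1 u = u"
  by (simp add: scale_coord_def vec_eq_iff)

definition set_coord :: "'n \<Rightarrow> real \<Rightarrow> real ^ 'n \<Rightarrow> real ^ 'n" where
  "set_coord i s u = (\<chi> j. if j = i then s else u $ j)"

lemma continuous_on_set_coord [continuous_intros]:
  "continuous_on S f \<Longrightarrow> continuous_on S g \<Longrightarrow> continuous_on S (\<lambda>x. set_coord i (f x) (g x))"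
  unfolding set_coord_def
proof (intro continuous_on_vec_lambda)
  fix j assume "continuous_on S f" "continuous_on S g"
  then show "continuous_on S (\<lambda>x. if j = i then f x else g x $ j)"
    by (cases "j = i") (auto intro!: continuous_intros)
qed

lemma borel_measurable_set_coord [measurable]:
  assumes [measurable]: "f \<in> borel_measurable M" "g \<in> borel_measurable M"
  shows "(\<lambda>x. set_coord i (f x) (g x)) \<in> borel_measurable M"
  by (intro borel_measurable_continuous_Pair[OF assms] continuous_intros)

lemma scale_coord_eq_set_coord: "scale_coord i s u = set_coord i (s * u $ i) u"
  by (simp add: scale_coord_def set_coord_def)

lemma set_coord_scale_coord [simp]: "set_coord i s (scale_coord i r u) = set_coord i s u"
  by (simp add: set_coord_def scale_coord_def vec_eq_iff)

lemma set_coord_set_coord [simp]: "set_coord i s (set_coord i r u) = set_coord i s u"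
  by (simp add: set_coord_def vec_eq_iff)

lemma set_coord_nth: "set_coord i s u $ j = (if j = i then s else u $ j)"
  by (simp add: set_coord_def)

lemma set_coord_add: "set_coord i (s + t) (u + v) = set_coord i s u + set_coord i t v"
  by (simp add: set_coord_def vec_eq_iff)

lemma integer_lattice_set_coord:
  "m \<in> integer_lattice \<Longrightarrow> s \<in> \<int> \<Longrightarrow> set_coord i s m \<in> integer_lattice"
  by (auto simp: integer_lattice_def set_coord_def)

text \<open>
  The oriented integral of \<open>g\<close> along the \<open>i\<close>-th axis from \<open>0\<close> to \<open>u\<^sub>i\<close>. Rescaling to the fixed
  interval \<open>[0, 1]\<close> covers both signs of \<open>u\<^sub>i\<close> at once and turns smoothness in \<open>u\<close> into
  smoothness of an integral with a parameter.
\<close>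

definition coord_primitive :: "'n \<Rightarrow> (real ^ 'n \<Rightarrow> 'b) \<Rightarrow> real ^ 'n \<Rightarrow> 'b::euclidean_space" where
  "coord_primitive i g u = u $ i *\<^sub>R (LINT s:{0..1}|lborel. g (scale_coord i s u))"

lemma borel_measurable_coord_primitive [measurable]:
  fixes g :: "real ^ 'n \<Rightarrow> 'b::euclidean_space"
  assumes [measurable]: "g \<in> borel_measurable borel"
  shows "coord_primitive i g \<in> borel_measurable borel"
  unfolding coord_primitive_def[abs_def] set_lebesgue_integral_def by measurable

lemma coord_primitive_integrable:
  fixes g :: "real ^ 'n \<Rightarrow> 'b::euclidean_space"
  assumes [measurable]: "g \<in> borel_measurable borel" and "\<And>v. norm v \<le> norm u \<Longrightarrow> norm (g v) \<le> K"
  shows "set_integrable lborel {0..1} (\<lambda>s. g (scale_coord i s u))"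
  using assms norm_scale_coord_le by (intro set_integrable_bounded_Icc[where K = K]) (measurable, blast)

lemma coord_primitive_norm_le:
  assumes [measurable]: "g \<in> borel_measurable borel"
    and K: "\<And>v. norm v \<le> norm u \<Longrightarrow> norm (g v) \<le> K"
  shows "norm (coord_primitive i g u) \<le> norm u * K"
proof -
  have "K \<ge> 0" using order_trans[OF norm_ge_zero K[of u]] by simp
  moreover have "norm (LINT s:{0..1}|lborel. g (scale_coord i s u)) \<le> K"
    using K norm_scale_coord_le by (intro norm_LINT_Icc_le) (measurable, blast)
  moreover have "\<bar>u $ i\<bar> \<le> norm u" by (rule component_le_norm_cart)
  ultimately show ?thesis unfolding coord_primitive_def norm_scaleR by (intro mult_mono) auto
qed

lemma uniformly_locally_bounded_coord_primitive:
  assumes m: "\<And>N. N \<noteq> 0 \<Longrightarrow> F N \<in> borel_measurable borel" and F: "uniformly_locally_bounded F"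
  shows "uniformly_locally_bounded (\<lambda>N. coord_primitive i (F N))"
  unfolding uniformly_locally_bounded_def
proof
  fix R
  obtain K where K: "\<forall>N u. N \<noteq> 0 \<longrightarrow> norm u \<le> R \<longrightarrow> norm (F N u) \<le> K"
    by (rule uniformly_locally_boundedE[OF F, where R = R])
  have "norm (coord_primitive i (F N) u) \<le> R * \<bar>K\<bar>" if "N \<noteq> 0" "norm u \<le> R" for N u
  proof -
    have "norm (coord_primitive i (F N) u) \<le> norm u * K"
      using K that by (intro coord_primitive_norm_le m) auto
    also have "\<dots> \<le> norm u * \<bar>K\<bar>" by (intro mult_left_mono) auto
    also have "\<dots> \<le> R * \<bar>K\<bar>" using that by (intro mult_right_mono) auto
    finally show ?thesis .
  qed
  then show "\<exists>K. \<forall>N u. N \<noteq> 0 \<longrightarrow> norm u \<le> R \<longrightarrow> norm (coord_primitive i (F N) u) \<le> K" by blast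
qed

lemma C_k_coord_primitive:
  fixes a :: "real ^ 'n \<Rightarrow> 'b::euclidean_space"
  assumes a: "C_k k a"
  shows "C_k k (coord_primitive i a)"
proof -
  have "(LINT s:{0..1}|lborel. a (scale_coord i s u)) = integral {0..1} (\<lambda>s. 1 *\<^sub>R a (scale_coord i s u))" for u
  proof -
    obtain K where "\<forall>v. norm v \<le> norm u \<longrightarrow> norm (a v) \<le> K"
      using C_k_bounded_on_ball[OF a] by blast
    then show ?thesis
      using set_borel_integral_eq_integral(2)[OF coord_primitive_integrable[OF C_k_measurable[OF a]], of u K i]
      by simp
  qed
  then show ?thesis
    unfolding coord_primitive_def[abs_def]
    using C_k_coord_mult[OF C_k_integral_scale_coord[OF continuous_on_const[of _ 1] a, of i]] by simp
qed

definition axis_mean :: "'n \<Rightarrow> (real ^ 'n \<Rightarrow> real) \<Rightarrow> real ^ 'n \<Rightarrow> real" where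
  "axis_mean i p y = (LINT s:{0..1}|lborel. p (set_coord i s y))"

lemma axis_mean_scale_coord [simp]: "axis_mean i p (scale_coord i s y) = axis_mean i p y"
  by (simp add: axis_mean_def)

lemma axis_mean_set_coord [simp]: "axis_mean i p (set_coord i s y) = axis_mean i p y"
  by (simp add: axis_mean_def)

lemma bounded_periodic_set_coord:
  assumes "bounded_periodic p" "m \<in> integer_lattice"
  shows "p (set_coord i s (y + m)) = p (set_coord i s y)"
proof -
  have "set_coord i s (y + m) = set_coord i s y + set_coord i 0 m"
    using set_coord_add[where i = i and s = s and t = 0 and u = y and v = m] by simp
  then show ?thesis
    using assms integer_lattice_set_coord[OF assms(2), of 0 i] unfolding bounded_periodic_def by auto
qed

lemma bounded_periodic_axis_mean:
  assumes p: "bounded_periodic p"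
  shows "bounded_periodic (axis_mean i p)"
proof -
  from p obtain B where [measurable]: "p \<in> borel_measurable borel" and B: "\<forall>y. \<bar>p y\<bar> \<le> B"
    by (auto simp: bounded_periodic_def)
  have "axis_mean i p \<in> borel_measurable borel"
    unfolding axis_mean_def[abs_def] set_lebesgue_integral_def by measurable
  moreover have "\<bar>axis_mean i p y\<bar> \<le> B" for y
    unfolding axis_mean_def using norm_LINT_Icc_le[of "\<lambda>s. p (set_coord i s y)" B] B by simp
  moreover have "axis_mean i p (y + m) = axis_mean i p y" if "m \<in> integer_lattice" for y m
    unfolding axis_mean_def bounded_periodic_set_coord[OF p that] ..
  ultimately show ?thesis unfolding bounded_periodic_def by blast
qed

lemma bounded_periodic_coord_primitive:
  assumes p: "bounded_periodic p" and mean: "\<And>y. axis_mean i p y = 0"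
  shows "bounded_periodic (coord_primitive i p)"
proof -
  from p obtain B where [measurable]: "p \<in> borel_measurable borel" and B: "\<forall>y. \<bar>p y\<bar> \<le> B"
    by (auto simp: bounded_periodic_def)
  define g where "g y s = p (set_coord i s y)" for y s
  have eq: "coord_primitive i p y = y $ i * (LINT s:{0..1}|lborel. g y (s * y $ i))" for y
    by (simp add: coord_primitive_def g_def scale_coord_eq_set_coord)
  have g: "g y \<in> borel_measurable borel" "\<And>s. \<bar>g y s\<bar> \<le> B" "(LINT s:{0..1}|lborel. g y s) = 0"
    for y using B mean[of y] unfolding g_def axis_mean_def by auto
  have per: "g y (s + 1) = g y s" for y s
  proof -
    have "set_coord i (s + 1) y = set_coord i s y + set_coord i 1 0"
      using set_coord_add[where i = i and s = s and t = 1 and u = y and v = 0] by simp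
    moreover have "set_coord i 1 0 \<in> integer_lattice"
      by (intro integer_lattice_set_coord) (auto simp: integer_lattice_def)
    ultimately show ?thesis using p unfolding bounded_periodic_def g_def by auto
  qed
  have "coord_primitive i p (y + m) = coord_primitive i p y" if m: "m \<in> integer_lattice" for y m
  proof -
    obtain k where k: "m $ i = of_int k" using m by (auto simp: integer_lattice_def elim: Ints_cases)
    have "g (y + m) = g y" unfolding g_def bounded_periodic_set_coord[OF p m] ..
    then show ?thesis
      unfolding eq using scaled_primitive_periodic(1)[OF g(1)[of y] g(2) per g(3), of "y $ i" k] k by simp
  qed
  moreover have "\<bar>coord_primitive i p y\<bar> \<le> B" for y
    unfolding eq by (rule scaled_primitive_periodic(2)[OF g(1,2) per g(3)])
  ultimately show ?thesis unfolding bounded_periodic_def by (auto intro: borel_measurable_coord_primitive)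
qed

lemma coord_primitive_add:
  assumes "g \<in> borel_measurable borel" "h \<in> borel_measurable borel"
    and "\<And>v. norm v \<le> norm u \<Longrightarrow> norm (g v) \<le> K" "\<And>v. norm v \<le> norm u \<Longrightarrow> norm (h v) \<le> L"
  shows "coord_primitive i (\<lambda>v. g v + h v) u = coord_primitive i g u + coord_primitive i h u"
  unfolding coord_primitive_def
  using set_integral_add(2)[OF coord_primitive_integrable[OF assms(1,3), where i = i]
      coord_primitive_integrable[OF assms(2,4), where i = i]]
  by (simp add: scaleR_add_right)

lemma coord_primitive_scaleR:
  "coord_primitive i (\<lambda>v. c *\<^sub>R g v) u = c *\<^sub>R coord_primitive i g u"
  by (cases "c = 0") (auto simp: coord_primitive_def set_lebesgue_integral_def mult_ac
      simp flip: integral_scaleR_right)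

text \<open>
  The basic step of the expansion. The amplitude \<open>p\<close> is split into its mean along the
  \<open>i\<close>-th axis, which passes through the integral, and an oscillating part. The latter
  has a periodic primitive \<open>q\<close> along the axis, and integration by parts gains a factor
  \<open>1 / c\<close> at the price of one derivative of \<open>a\<close>. The boundary term at \<open>0\<close> vanishes because
  \<open>q\<close> does so on the hyperplane \<open>u\<^sub>i = 0\<close>.
\<close>

lemma coord_primitive_periodic_times_smooth:
  fixes a :: "real ^ 'n \<Rightarrow> 'b::euclidean_space"
  assumes p: "bounded_periodic p"
    and D: "\<And>x. (a has_derivative (\<lambda>v. \<Sum>i\<in>UNIV. v $ i *\<^sub>R D i x)) (at x)"
    and Dc: "continuous_on UNIV (D i)" and c: "c \<noteq> 0"
  defines "q \<equiv> coord_primitive i (\<lambda>y. p y - axis_mean i p y)"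
  shows "coord_primitive i (\<lambda>u. p (c *\<^sub>R u) *\<^sub>R a u) u =
    axis_mean i p (c *\<^sub>R u) *\<^sub>R coord_primitive i a u +
    (1 / c) *\<^sub>R (q (c *\<^sub>R u) *\<^sub>R a u - coord_primitive i (\<lambda>u. q (c *\<^sub>R u) *\<^sub>R D i u) u)"
proof -
  from p obtain B where [measurable]: "p \<in> borel_measurable borel" and B: "\<And>y. \<bar>p y\<bar> \<le> B"
    by (auto simp: bounded_periodic_def)
  have B0: "0 \<le> B" using B[of 0] by linarith
  define y where "y = c *\<^sub>R u"
  define P0 where "P0 = axis_mean i p y"
  define \<kappa> where "\<kappa> s = p (scale_coord i s y) - P0" for s
  define \<alpha> where "\<alpha> s = a (scale_coord i s u)" for s
  define \<alpha>' where "\<alpha>' s = u $ i *\<^sub>R D i (scale_coord i s u)" for s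
  have ac: "continuous_on UNIV a"
    using D has_derivative_continuous by (intro continuous_at_imp_continuous_on) blast
  have \<alpha>c: "continuous_on UNIV \<alpha>"
    unfolding \<alpha>_def by (intro continuous_on_compose2[OF ac] continuous_intros) auto
  have [measurable]: "\<alpha> \<in> borel_measurable borel" by (rule borel_measurable_continuous_onI[OF \<alpha>c])
  have \<kappa>m: "\<kappa> \<in> borel_measurable borel" unfolding \<kappa>_def by measurable
  have \<alpha>'c: "continuous_on UNIV \<alpha>'"
    unfolding \<alpha>'_def by (intro continuous_intros continuous_on_compose2[OF Dc]) auto
  have \<alpha>d: "(\<alpha> has_vector_derivative \<alpha>' s) (at s)" for s
  proof -
    have "scale_coord i s u = set_coord i 0 u + (s * u $ i) *\<^sub>R axis i 1" for s
      by (auto simp: scale_coord_def set_coord_def vec_eq_iff axis_def)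
    then have eq: "(\<lambda>s. scale_coord i s u) = (\<lambda>s. set_coord i 0 u + (s * u $ i) *\<^sub>R axis i 1)" by (rule ext)
    have "((\<lambda>s. scale_coord i s u) has_derivative (\<lambda>h. (h * u $ i) *\<^sub>R axis i 1)) (at s)"
      unfolding eq by (auto intro!: derivative_eq_intros)
    from has_derivative_compose[OF this D]
    have "(\<alpha> has_derivative (\<lambda>h. \<Sum>j\<in>UNIV. ((h * u $ i) *\<^sub>R axis i 1 :: real ^ 'n) $ j *\<^sub>R D j (scale_coord i s u))) (at s)"
      by (simp add: \<alpha>_def[abs_def])
    moreover have "(\<Sum>j\<in>UNIV. ((h * u $ i) *\<^sub>R axis i 1 :: real ^ 'n) $ j *\<^sub>R D j (scale_coord i s u)) = h *\<^sub>R \<alpha>' s" for h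
      by (simp add: axis_def \<alpha>'_def if_distrib[where f = "\<lambda>r. _ * r"] if_distrib[where f = "\<lambda>r. r *\<^sub>R _"] cong: if_cong)
    ultimately show ?thesis by (simp add: has_vector_derivative_def)
  qed
  have P0B: "\<bar>P0\<bar> \<le> B"
    unfolding P0_def axis_mean_def using norm_LINT_Icc_le[of "\<lambda>s. p (set_coord i s y)" B] B by simp
  have \<kappa>B: "\<bar>\<kappa> s\<bar> \<le> 2 * B" for s
    unfolding \<kappa>_def using B[of "scale_coord i s y"] P0B by linarith
  have "compact (\<alpha> ` {0..1})"
    by (rule compact_continuous_image[OF continuous_on_subset[OF \<alpha>c]]) auto
  then have "bounded (\<alpha> ` {0..1})" by (rule compact_imp_bounded)
  then obtain L where L: "\<And>s. s \<in> {0..1} \<Longrightarrow> norm (\<alpha> s) \<le> L" unfolding bounded_iff by blast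
  have i1: "set_integrable lborel {0..1} (\<lambda>s. P0 *\<^sub>R \<alpha> s)"
    using L by (intro set_integrable_bounded_Icc[where K = "\<bar>P0\<bar> * L"]) (auto intro!: mult_left_mono)
  have i2: "set_integrable lborel {0..1} (\<lambda>s. \<kappa> s *\<^sub>R \<alpha> s)"
    using L \<kappa>B B0 \<kappa>m by (intro set_integrable_bounded_Icc[where K = "2 * B * L"]) (auto intro!: mult_mono)
  have q1: "q (scale_coord i r y) = c * u $ i * (r * (LINT s:{0..1}|lborel. \<kappa> (s * r)))" for r
    by (simp add: q_def coord_primitive_def \<kappa>_def P0_def scale_coord_scale_coord y_def)
      (simp add: scale_coord_def mult_ac)
  have "coord_primitive i (\<lambda>u. p (c *\<^sub>R u) *\<^sub>R a u) u = u $ i *\<^sub>R (LINT s:{0..1}|lborel. P0 *\<^sub>R \<alpha> s + \<kappa> s *\<^sub>R \<alpha> s)"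
    by (simp add: coord_primitive_def \<alpha>_def \<kappa>_def y_def scale_coord_scaleR algebra_simps)
  also have "\<dots> = u $ i *\<^sub>R (P0 *\<^sub>R (LINT s:{0..1}|lborel. \<alpha> s) + (LINT s:{0..1}|lborel. \<kappa> s *\<^sub>R \<alpha> s))"
    using set_integral_add(2)[OF i1 i2] by simp
  also have "\<dots> = P0 *\<^sub>R coord_primitive i a u + u $ i *\<^sub>R (LINT s:{0..1}|lborel. \<kappa> s *\<^sub>R \<alpha> s)"
    by (simp add: coord_primitive_def \<alpha>_def scaleR_add_right mult.commute)
  also have "u $ i *\<^sub>R (LINT s:{0..1}|lborel. \<kappa> s *\<^sub>R \<alpha> s) =
     (u $ i * (LINT s:{0..1}|lborel. \<kappa> s)) *\<^sub>R \<alpha> 1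
     - u $ i *\<^sub>R (LINT r:{0..1}|lborel. (r * (LINT s:{0..1}|lborel. \<kappa> (s * r))) *\<^sub>R \<alpha>' r)"
    using integration_by_parts_primitive[OF \<kappa>m \<kappa>B \<alpha>d \<alpha>'c] by (simp add: scaleR_diff_right)
  also have "(u $ i * (LINT s:{0..1}|lborel. \<kappa> s)) = (1 / c) * q y"
    using q1[of 1] c by simp
  also have "(\<lambda>r. (r * (LINT s:{0..1}|lborel. \<kappa> (s * r))) *\<^sub>R \<alpha>' r)
     = (\<lambda>r. (1 / c) *\<^sub>R (q (c *\<^sub>R scale_coord i r u) *\<^sub>R D i (scale_coord i r u)))"
    using c by (simp add: \<alpha>'_def q1 flip: scale_coord_scaleR y_def) (simp add: mult_ac)
  also have "u $ i *\<^sub>R (LINT r:{0..1}|lborel. (1 / c) *\<^sub>R (q (c *\<^sub>R scale_coord i r u) *\<^sub>R D i (scale_coord i r u)))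
     = (1 / c) *\<^sub>R coord_primitive i (\<lambda>u. q (c *\<^sub>R u) *\<^sub>R D i u) u"
    unfolding coord_primitive_scaleR[symmetric] by (simp add: coord_primitive_def)
  finally show ?thesis
    by (simp add: P0_def y_def \<alpha>_def scaleR_diff_right)
qed

text \<open>
  Induction on the number \<open>m\<close> of available derivatives: the last term of the preceding
  lemma has the same form with one derivative less and the factor \<open>1 / N\<close>.
\<close>

lemma osc_coord_primitive_term:
  fixes a :: "real ^ 'n \<Rightarrow> 'b::euclidean_space"
  assumes "bounded_periodic p" "C_k m a"
  shows "osc_expandable m (\<lambda>N. coord_primitive i (\<lambda>u. p (of_int N *\<^sub>R u) *\<^sub>R a u))"
  using assms
proof (induction m arbitrary: p a)
  case 0
  show ?case
  proof (rule osc_rem)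
    note o = osc_term[OF 0]
    show "coord_primitive i (\<lambda>u. p (of_int N *\<^sub>R u) *\<^sub>R a u) \<in> borel_measurable borel" if "N \<noteq> 0" for N
      using osc_measurable[OF o that] by (rule borel_measurable_coord_primitive)
    show "uniformly_locally_bounded (\<lambda>N. coord_primitive i (\<lambda>u. p (of_int N *\<^sub>R u) *\<^sub>R a u))"
      using osc_measurable[OF o] osc_bounded[OF o] by (rule uniformly_locally_bounded_coord_primitive)
  qed
next
  case (Suc m)
  from Suc.prems(2) obtain D where
    D: "\<And>x. (a has_derivative (\<lambda>v. \<Sum>i\<in>UNIV. v $ i *\<^sub>R D i x)) (at x)" "\<And>i. C_k m (D i)"
    by (elim C_k_SucE) (rule that; assumption)
  define q where "q = coord_primitive i (\<lambda>y. p y - axis_mean i p y)"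
  from Suc.prems(1) obtain B where [measurable]: "p \<in> borel_measurable borel" and B: "\<And>y. \<bar>p y\<bar> \<le> B"
    by (auto simp: bounded_periodic_def)
  have mean: "axis_mean i (\<lambda>y. p y - axis_mean i p y) y = 0" for y
  proof -
    have 1: "set_integrable lborel {0..1} (\<lambda>s. p (set_coord i s y))"
      using B by (intro set_integrable_bounded_Icc[where K = B]) auto
    have 2: "set_integrable lborel {0..1::real} (\<lambda>s. axis_mean i p y)"
      by (intro set_integrable_bounded_Icc[where K = "\<bar>axis_mean i p y\<bar>"]) auto
    have "axis_mean i (\<lambda>y. p y - axis_mean i p y) y =
       (LINT s:{0..1}|lborel. p (set_coord i s y)) - (LINT s:{0..1::real}|lborel. axis_mean i p y)"
      using set_integral_diff(2)[OF 1 2] by (simp add: axis_mean_def[of i "\<lambda>y. p y - axis_mean i p y"])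
    then show ?thesis by (simp add: axis_mean_def set_lebesgue_integral_def)
  qed
  have q: "bounded_periodic q" unfolding q_def
    by (intro bounded_periodic_coord_primitive bounded_periodic_diff bounded_periodic_axis_mean Suc.prems mean)
  have "osc_expandable (Suc m) (\<lambda>N u. axis_mean i p (of_int N *\<^sub>R u) *\<^sub>R coord_primitive i a u +
     (1 / of_int N) *\<^sub>R (q (of_int N *\<^sub>R u) *\<^sub>R a u + - coord_primitive i (\<lambda>u. q (of_int N *\<^sub>R u) *\<^sub>R D i u) u))"
    by (intro osc_add osc_shift osc_term osc_minus Suc.IH bounded_periodic_axis_mean
        C_k_coord_primitive Suc.prems q D C_k_lessD[OF Suc.prems(2)])
  then show ?case
  proof (rule osc_cong)
    fix N :: int assume "N \<noteq> 0"
    then show "coord_primitive i (\<lambda>u. p (of_int N *\<^sub>R u) *\<^sub>R a u) =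
      (\<lambda>u. axis_mean i p (of_int N *\<^sub>R u) *\<^sub>R coord_primitive i a u +
      (1 / of_int N) *\<^sub>R (q (of_int N *\<^sub>R u) *\<^sub>R a u + - coord_primitive i (\<lambda>u. q (of_int N *\<^sub>R u) *\<^sub>R D i u) u))"
      using coord_primitive_periodic_times_smooth[OF Suc.prems(1) D(1) C_k_continuous[OF D(2)], of "of_int N" i]
      unfolding q_def by (simp add: fun_eq_iff)
  qed
qed

lemma osc_coord_primitive:
  fixes F :: "int \<Rightarrow> real ^ 'n \<Rightarrow> 'b::euclidean_space"
  assumes "osc_expandable m F"
  shows "osc_expandable m (\<lambda>N. coord_primitive i (F N))"
  using assms
proof (induction rule: osc_expandable.induct)
  case (osc_term p m a)
  then show ?case by (rule osc_coord_primitive_term)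
next
  case (osc_rem F)
  then show ?case
    by (intro osc_expandable.osc_rem borel_measurable_coord_primitive uniformly_locally_bounded_coord_primitive) auto
next
  case (osc_add m F G)
  show ?case
  proof (rule osc_expandable.osc_cong[OF osc_expandable.osc_add[OF osc_add.IH]], rule ext)
    fix N :: int and u :: "real ^ 'n" assume N: "N \<noteq> 0"
    obtain K where K: "\<forall>N v. N \<noteq> 0 \<longrightarrow> norm v \<le> norm u \<longrightarrow> norm (F N v) \<le> K"
      by (rule uniformly_locally_boundedE[OF osc_bounded[OF osc_add.hyps(1)], where R = "norm u"])
    obtain L where L: "\<forall>N v. N \<noteq> 0 \<longrightarrow> norm v \<le> norm u \<longrightarrow> norm (G N v) \<le> L"
      by (rule uniformly_locally_boundedE[OF osc_bounded[OF osc_add.hyps(2)], where R = "norm u"])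
    show "coord_primitive i (\<lambda>u. F N u + G N u) u = coord_primitive i (F N) u + coord_primitive i (G N) u"
      using K L N by (intro coord_primitive_add[where K = K and L = L] osc_measurable[OF osc_add.hyps(1)]
          osc_measurable[OF osc_add.hyps(2)]) auto
  qed
next
  case (osc_shift m F)
  show ?case using osc_expandable.osc_shift[OF osc_shift.IH] unfolding coord_primitive_scaleR[abs_def] .
next
  case (osc_cong m F G)
  show ?case by (rule osc_expandable.osc_cong[OF osc_cong.IH]) (simp add: osc_cong.hyps)
qed

section \<open>Taylor expansion with a periodic displacement\<close>

lemma norm_diff_le_of_derivative_bound:
  fixes \<phi> :: "real \<Rightarrow> 'b::real_normed_vector"
  assumes d: "\<And>s. (\<phi> has_vector_derivative \<phi>' s) (at s)"
    and B: "\<And>s. \<bar>s\<bar> \<le> \<bar>\<delta>\<bar> \<Longrightarrow> norm (\<phi>' s) \<le> B"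
  shows "norm (\<phi> \<delta> - \<phi> 0) \<le> B * \<bar>\<delta>\<bar>"
proof -
  have "norm (\<phi> \<delta> - \<phi> 0) \<le> B * norm (\<delta> - 0)"
  proof (rule differentiable_bound[where S = "cball 0 \<bar>\<delta>\<bar>" and f' = "\<lambda>s h. h *\<^sub>R \<phi>' s"])
    show "(\<phi> has_derivative (\<lambda>h. h *\<^sub>R \<phi>' s)) (at s within cball 0 \<bar>\<delta>\<bar>)" for s
      using d by (auto simp: has_vector_derivative_def intro: has_derivative_at_withinI)
    show "onorm (\<lambda>h. h *\<^sub>R \<phi>' s) \<le> B" if "s \<in> cball 0 \<bar>\<delta>\<bar>" for s
      using B[of s] that onorm_scaleR_left[OF bounded_linear_ident, of "\<phi>' s"] by (simp add: onorm_id)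
  qed auto
  then show ?thesis by simp
qed

text \<open>
  \<open>T\<^sub>j x v\<close> plays the role of the \<open>j\<close>-th Taylor term of \<open>a\<close> at \<open>x\<close>, a polynomial in \<open>v\<close> whose
  coefficients are derivatives of \<open>a\<close> of order \<open>j\<close>. Rather than through multi-indices,
  this structure is recorded by the one consequence that is used: inserting a
  periodic displacement \<open>v = \<theta> (N x)\<close> gives an expandable function
  (\<open>expandable_terms\<close>).
\<close>

definition taylor_approximation :: "nat \<Rightarrow> (real ^ 'n \<Rightarrow> 'b::euclidean_space) \<Rightarrow> (nat \<Rightarrow> real ^ 'n \<Rightarrow> real ^ 'n \<Rightarrow> 'b) \<Rightarrow> bool"
  where
  "taylor_approximation m a T \<longleftrightarrow>
    (\<forall>R. \<exists>K. \<forall>x v \<delta>. norm x \<le> R \<longrightarrow> norm v \<le> R \<longrightarrow> \<bar>\<delta>\<bar> \<le> 1 \<longrightarrow>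
      norm (a (x + \<delta> *\<^sub>R v) - (\<Sum>j<m. \<delta> ^ j *\<^sub>R T j x v)) \<le> K * \<bar>\<delta>\<bar> ^ m)"

definition expandable_terms :: "nat \<Rightarrow> (nat \<Rightarrow> real ^ 'n \<Rightarrow> real ^ 'n \<Rightarrow> 'b::euclidean_space) \<Rightarrow> bool"
  where
  "expandable_terms m T \<longleftrightarrow>
    (\<forall>j<m. \<forall>q \<theta>. bounded_periodic q \<longrightarrow> (\<forall>i. bounded_periodic (\<lambda>y. \<theta> y $ i)) \<longrightarrow>
      osc_expandable (m - j) (\<lambda>N x. q (of_int N *\<^sub>R x) *\<^sub>R T j x (\<theta> (of_int N *\<^sub>R x))))"

text \<open>
  The terms of order \<open>j + 1\<close> arise by integrating those of order \<open>j\<close> of the partial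
  derivatives, so that the error bound follows by induction from the mean value
  inequality in \<open>\<delta>\<close>.
\<close>

lemma ex_taylor_terms:
  fixes a :: "real ^ 'n \<Rightarrow> 'b::euclidean_space"
  assumes "C_k m a"
  shows "\<exists>T. taylor_approximation m a T \<and> expandable_terms m T"
  using assms
proof (induction m arbitrary: a)
  case 0
  show ?case
    unfolding taylor_approximation_def
  proof (intro exI[of _ "\<lambda>_ _ _. 0"] conjI allI)
    fix R
    obtain K where K: "\<forall>u. norm u \<le> R + R \<longrightarrow> norm (a u) \<le> K"
      using C_k_bounded_on_ball[OF 0] by blast
    have "norm (a (x + \<delta> *\<^sub>R v)) \<le> K" if "norm x \<le> R" "norm v \<le> R" "\<bar>\<delta>\<bar> \<le> 1" for x v and \<delta> :: real
    proof -
      have "norm (\<delta> *\<^sub>R v) \<le> 1 * norm v" unfolding norm_scaleR using that by (intro mult_right_mono) auto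
      then have "norm (x + \<delta> *\<^sub>R v) \<le> R + R" using that by (intro norm_triangle_mono) auto
      then show ?thesis using K by blast
    qed
    then show "\<exists>K. \<forall>x v \<delta>. norm x \<le> R \<longrightarrow> norm v \<le> R \<longrightarrow> \<bar>\<delta>\<bar> \<le> 1 \<longrightarrow>
      norm (a (x + \<delta> *\<^sub>R v) - (\<Sum>j<0. \<delta> ^ j *\<^sub>R 0)) \<le> K * \<bar>\<delta>\<bar> ^ 0" by (intro exI[of _ K]) simp
  qed (simp add: expandable_terms_def)
next
  case (Suc m)
  from Suc.prems obtain D where
    D: "\<And>x. (a has_derivative (\<lambda>v. \<Sum>i\<in>UNIV. v $ i *\<^sub>R D i x)) (at x)" and Dk: "\<And>i. C_k m (D i)"
    by (elim C_k_SucE) (rule that; assumption)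
  have "\<forall>i. \<exists>T. taylor_approximation m (D i) T \<and> expandable_terms m T"
    using Suc.IH[OF Dk] by blast
  from choice[OF this] obtain T where
    T1: "\<And>i. taylor_approximation m (D i) (T i)" and T2: "\<And>i. expandable_terms m (T i)" by blast
  \<comment> \<open>the Taylor terms of \<open>a\<close>, by integrating those of its partial derivatives\<close>
  define S where "S j x v = (case j of 0 \<Rightarrow> a x |
    Suc j \<Rightarrow> (1 / real (Suc j)) *\<^sub>R (\<Sum>i\<in>UNIV. v $ i *\<^sub>R T i j x v))" for j x v
  have S0: "S 0 x v = a x" and SS: "S (Suc j) x v = (1 / real (Suc j)) *\<^sub>R (\<Sum>i\<in>UNIV. v $ i *\<^sub>R T i j x v)"
    for j x v by (auto simp: S_def)
  show ?case
    unfolding taylor_approximation_def expandable_terms_def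
  proof (intro exI[of _ S] conjI allI impI)
    fix R
    from T1 have "\<forall>i. \<exists>K. \<forall>x v \<delta>. norm x \<le> R \<longrightarrow> norm v \<le> R \<longrightarrow> \<bar>\<delta>\<bar> \<le> 1 \<longrightarrow>
      norm (D i (x + \<delta> *\<^sub>R v) - (\<Sum>j<m. \<delta> ^ j *\<^sub>R T i j x v)) \<le> K * \<bar>\<delta>\<bar> ^ m"
      unfolding taylor_approximation_def by blast
    from choice[OF this] obtain K where K: "\<And>i x v \<delta>. norm x \<le> R \<Longrightarrow> norm v \<le> R \<Longrightarrow> \<bar>\<delta>\<bar> \<le> 1 \<Longrightarrow>
      norm (D i (x + \<delta> *\<^sub>R v) - (\<Sum>j<m. \<delta> ^ j *\<^sub>R T i j x v)) \<le> K i * \<bar>\<delta>\<bar> ^ m" by blast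
    define L where "L = (\<Sum>i\<in>UNIV. R * \<bar>K i\<bar>)"
    have "norm (a (x + \<delta> *\<^sub>R v) - (\<Sum>j<Suc m. \<delta> ^ j *\<^sub>R S j x v)) \<le> L * \<bar>\<delta>\<bar> ^ Suc m"
      if xv: "norm x \<le> R" "norm v \<le> R" and \<delta>: "\<bar>\<delta>\<bar> \<le> 1" for x v \<delta>
    proof -
      define \<phi> where "\<phi> s = a (x + s *\<^sub>R v) - (\<Sum>j<Suc m. s ^ j *\<^sub>R S j x v)" for s
      define \<phi>' where "\<phi>' s = (\<Sum>i\<in>UNIV. v $ i *\<^sub>R (D i (x + s *\<^sub>R v) - (\<Sum>j<m. s ^ j *\<^sub>R T i j x v)))" for s
      have d: "(\<phi> has_vector_derivative \<phi>' s) (at s)" for s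
      proof -
        have "((\<lambda>s. x + s *\<^sub>R v) has_derivative (\<lambda>h. h *\<^sub>R v)) (at s)"
          by (auto intro!: derivative_eq_intros)
        from has_derivative_compose[OF this D]
        have "((\<lambda>s. a (x + s *\<^sub>R v)) has_derivative (\<lambda>h. \<Sum>i\<in>UNIV. (h *\<^sub>R v) $ i *\<^sub>R D i (x + s *\<^sub>R v))) (at s)" .
        also have "(\<lambda>h. \<Sum>i\<in>UNIV. (h *\<^sub>R v) $ i *\<^sub>R D i (x + s *\<^sub>R v)) = (\<lambda>h. h *\<^sub>R (\<Sum>i\<in>UNIV. v $ i *\<^sub>R D i (x + s *\<^sub>R v)))"
          by (simp add: scaleR_sum_right)
        finally have 1: "((\<lambda>s. a (x + s *\<^sub>R v)) has_vector_derivative (\<Sum>i\<in>UNIV. v $ i *\<^sub>R D i (x + s *\<^sub>R v))) (at s)"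
          by (simp add: has_vector_derivative_def)
        have 2: "((\<lambda>s. s ^ Suc j *\<^sub>R S (Suc j) x v) has_vector_derivative s ^ j *\<^sub>R (\<Sum>i\<in>UNIV. v $ i *\<^sub>R T i j x v)) (at s)" for j
        proof -
          have "((\<lambda>s. s ^ Suc j) has_real_derivative real (Suc j) * s ^ j) (at s)"
            using DERIV_pow[of "Suc j" s] by simp
          then have "((\<lambda>s. s ^ Suc j) has_vector_derivative real (Suc j) * s ^ j) (at s)"
            by (rule has_real_derivative_iff_has_vector_derivative[THEN iffD1])
          from has_vector_derivative_scaleR[OF _ has_vector_derivative_const, of "\<lambda>s. s ^ Suc j" _ _ _ "S (Suc j) x v"]
          have "((\<lambda>s. s ^ Suc j *\<^sub>R S (Suc j) x v) has_vector_derivative (real (Suc j) * s ^ j) *\<^sub>R S (Suc j) x v) (at s)"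
            using \<open>((\<lambda>s. s ^ Suc j) has_real_derivative real (Suc j) * s ^ j) (at s)\<close> by fastforce
          then show ?thesis by (simp add: SS del: of_nat_Suc)
        qed
        have "(\<phi> has_vector_derivative (\<Sum>i\<in>UNIV. v $ i *\<^sub>R D i (x + s *\<^sub>R v))
            - (\<Sum>j<m. s ^ j *\<^sub>R (\<Sum>i\<in>UNIV. v $ i *\<^sub>R T i j x v))) (at s)"
          unfolding \<phi>_def[abs_def] sum.lessThan_Suc_shift
          using has_vector_derivative_diff[OF 1 has_vector_derivative_add[OF has_vector_derivative_const[of "S 0 x v"]
              has_vector_derivative_sum[where I = "{..<m}", OF 2]]] by simp
        also have "(\<Sum>i\<in>UNIV. v $ i *\<^sub>R D i (x + s *\<^sub>R v)) - (\<Sum>j<m. s ^ j *\<^sub>R (\<Sum>i\<in>UNIV. v $ i *\<^sub>R T i j x v)) = \<phi>' s"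
        proof -
          have "(\<Sum>j<m. s ^ j *\<^sub>R (\<Sum>i\<in>UNIV. v $ i *\<^sub>R T i j x v)) = (\<Sum>i\<in>UNIV. \<Sum>j<m. s ^ j *\<^sub>R v $ i *\<^sub>R T i j x v)"
            unfolding scaleR_sum_right by (rule sum.swap)
          then show ?thesis
            by (simp add: \<phi>'_def scaleR_diff_right sum_subtractf scaleR_sum_right mult.commute)
        qed
        finally show ?thesis .
      qed
      have b: "norm (\<phi>' s) \<le> L * \<bar>\<delta>\<bar> ^ m" if "\<bar>s\<bar> \<le> \<bar>\<delta>\<bar>" for s
      proof -
        have "norm (\<phi>' s) \<le> (\<Sum>i\<in>UNIV. R * (\<bar>K i\<bar> * \<bar>\<delta>\<bar> ^ m))"
          unfolding \<phi>'_def
        proof (rule sum_norm_le)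
          fix i :: 'n
          have "\<bar>v $ i\<bar> \<le> R" using component_le_norm_cart[of v i] xv by linarith
          moreover have "norm (D i (x + s *\<^sub>R v) - (\<Sum>j<m. s ^ j *\<^sub>R T i j x v)) \<le> \<bar>K i\<bar> * \<bar>\<delta>\<bar> ^ m"
          proof -
            have "norm (D i (x + s *\<^sub>R v) - (\<Sum>j<m. s ^ j *\<^sub>R T i j x v)) \<le> K i * \<bar>s\<bar> ^ m"
              using that \<delta> by (intro K xv) auto
            also have "\<dots> \<le> \<bar>K i\<bar> * \<bar>\<delta>\<bar> ^ m" using that by (intro mult_mono power_mono) auto
            finally show ?thesis .
          qed
          ultimately show "norm (v $ i *\<^sub>R (D i (x + s *\<^sub>R v) - (\<Sum>j<m. s ^ j *\<^sub>R T i j x v))) \<le> R * (\<bar>K i\<bar> * \<bar>\<delta>\<bar> ^ m)"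
            unfolding norm_scaleR by (intro mult_mono) auto
        qed
        then show ?thesis by (simp add: L_def sum_distrib_right mult.assoc)
      qed
      have "\<phi> 0 = 0" by (simp add: \<phi>_def sum.lessThan_Suc_shift S0 del: sum.lessThan_Suc)
      then show ?thesis
        using norm_diff_le_of_derivative_bound[OF d b] by (simp add: \<phi>_def mult_ac)
    qed
    then show "\<exists>K. \<forall>x v \<delta>. norm x \<le> R \<longrightarrow> norm v \<le> R \<longrightarrow> \<bar>\<delta>\<bar> \<le> 1 \<longrightarrow>
      norm (a (x + \<delta> *\<^sub>R v) - (\<Sum>j<Suc m. \<delta> ^ j *\<^sub>R S j x v)) \<le> K * \<bar>\<delta>\<bar> ^ Suc m" by blast
  next
    fix j :: nat and q :: "real ^ 'n \<Rightarrow> real" and \<theta> :: "real ^ 'n \<Rightarrow> real ^ 'n"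
    assume j: "j < Suc m" and q: "bounded_periodic q" and \<theta>: "\<forall>i. bounded_periodic (\<lambda>y. \<theta> y $ i)"
    show "osc_expandable (Suc m - j) (\<lambda>N x. q (of_int N *\<^sub>R x) *\<^sub>R S j x (\<theta> (of_int N *\<^sub>R x)))"
    proof (cases j)
      case 0
      then show ?thesis using osc_term[OF q Suc.prems] by (simp add: S0)
    next
      case (Suc j')
      have "osc_expandable (m - j') (\<lambda>N x. \<Sum>i\<in>UNIV. (1 / real (Suc j') * (q (of_int N *\<^sub>R x) * \<theta> (of_int N *\<^sub>R x) $ i)) *\<^sub>R
         T i j' x (\<theta> (of_int N *\<^sub>R x)))"
        using j Suc \<theta>
        by (intro osc_sum T2[unfolded expandable_terms_def, rule_format,
              where q = "\<lambda>y. 1 / real (Suc j') * (q y * \<theta> y $ _)"]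
            bounded_periodic_cmult bounded_periodic_mult q) auto
      then show ?thesis by (simp add: Suc SS scaleR_sum_right mult_ac del: of_nat_Suc)
    qed
  qed
qed

text \<open>
  Taylor's formula with step \<open>\<delta> = 1 / N\<close>. The remainder multiplied by \<open>N\<^sup>m\<close> is the bounded
  function \<open>H\<close>.
\<close>

lemma osc_taylor:
  fixes a :: "real ^ 'n \<Rightarrow> 'b::euclidean_space"
  assumes a: "C_k m a" and q: "bounded_periodic q" and \<theta>: "\<And>i. bounded_periodic (\<lambda>y. \<theta> y $ i)"
  shows "osc_expandable m (\<lambda>N x. q (of_int N *\<^sub>R x) *\<^sub>R a (x + (1 / of_int N) *\<^sub>R \<theta> (of_int N *\<^sub>R x)))"
proof -
  obtain T where T1: "taylor_approximation m a T" and T2: "expandable_terms m T"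
    using ex_taylor_terms[OF a] by blast
  define F where "F N x = q (of_int N *\<^sub>R x) *\<^sub>R a (x + (1 / of_int N) *\<^sub>R \<theta> (of_int N *\<^sub>R x))" for N x
  define G where "G N x = (\<Sum>j<m. (1 / of_int N ^ j) *\<^sub>R (q (of_int N *\<^sub>R x) *\<^sub>R T j x (\<theta> (of_int N *\<^sub>R x))))" for N x
  define H where "H N x = (of_int N ^ m) *\<^sub>R (F N x - G N x)" for N :: int and x
  have G: "osc_expandable m G"
    unfolding G_def[abs_def]
  proof (rule osc_sum)
    fix j assume "j \<in> {..<m}"
    then have "osc_expandable (j + (m - j)) (\<lambda>N x. (1 / of_int N ^ j) *\<^sub>R (q (of_int N *\<^sub>R x) *\<^sub>R T j x (\<theta> (of_int N *\<^sub>R x))))"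
      using T2 q \<theta> unfolding expandable_terms_def by (intro osc_shift_power) auto
    then show "osc_expandable m (\<lambda>N x. (1 / of_int N ^ j) *\<^sub>R (q (of_int N *\<^sub>R x) *\<^sub>R T j x (\<theta> (of_int N *\<^sub>R x))))"
      using \<open>j \<in> {..<m}\<close> by simp
  qed
  from q obtain Bq where qm [measurable]: "q \<in> borel_measurable borel" and Bq: "\<And>y. \<bar>q y\<bar> \<le> Bq"
    by (auto simp: bounded_periodic_def)
  have \<theta>m [measurable]: "\<theta> \<in> borel_measurable borel"
    using \<theta> by (subst borel_measurable_euclidean_space)
      (auto simp: bounded_periodic_def Basis_vec_def inner_axis)
  have am [measurable]: "a \<in> borel_measurable borel" by (rule C_k_measurable[OF a])
  have "\<forall>i. \<exists>B. \<forall>y. \<bar>\<theta> y $ i\<bar> \<le> B" using \<theta> by (auto simp: bounded_periodic_def)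
  from choice[OF this] obtain B where B: "\<And>i y. \<bar>\<theta> y $ i\<bar> \<le> B i" by blast
  define M where "M = (\<Sum>i\<in>UNIV. B i)"
  have M: "norm (\<theta> y) \<le> M" for y
    unfolding M_def using norm_le_l1_cart[of "\<theta> y"] by (rule order_trans) (intro sum_mono B)
  have H: "osc_expandable 0 H"
  proof (rule osc_rem)
    show "H N \<in> borel_measurable borel" if "N \<noteq> 0" for N
      unfolding H_def[abs_def] F_def using osc_measurable[OF G that] by measurable
    show "uniformly_locally_bounded H"
      unfolding uniformly_locally_bounded_def
    proof
      fix R
      define R' where "R' = max R M"
      obtain K where K: "\<And>x v \<delta>. norm x \<le> R' \<Longrightarrow> norm v \<le> R' \<Longrightarrow> \<bar>\<delta>\<bar> \<le> 1 \<Longrightarrow>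
        norm (a (x + \<delta> *\<^sub>R v) - (\<Sum>j<m. \<delta> ^ j *\<^sub>R T j x v)) \<le> K * \<bar>\<delta>\<bar> ^ m"
        using T1 unfolding taylor_approximation_def by blast
      have "norm (H N x) \<le> Bq * K" if N: "N \<noteq> 0" and x: "norm x \<le> R" for N x
      proof -
        let ?\<delta> = "1 / real_of_int N" and ?y = "real_of_int N *\<^sub>R x"
        have \<delta>: "\<bar>?\<delta>\<bar> \<le> 1" using N by (auto simp: divide_simps)
        have eq: "H N x = (of_int N ^ m * q ?y) *\<^sub>R (a (x + ?\<delta> *\<^sub>R \<theta> ?y) - (\<Sum>j<m. ?\<delta> ^ j *\<^sub>R T j x (\<theta> ?y)))"
          by (simp add: H_def F_def G_def scaleR_diff_right scaleR_sum_right power_one_over mult_ac)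
        have k: "norm (a (x + ?\<delta> *\<^sub>R \<theta> ?y) - (\<Sum>j<m. ?\<delta> ^ j *\<^sub>R T j x (\<theta> ?y))) \<le> K * \<bar>?\<delta>\<bar> ^ m"
          using x M[of ?y] \<delta> by (intro K) (auto simp: R'_def)
        have "norm (H N x) \<le> (\<bar>of_int N\<bar> ^ m * Bq) * (K * \<bar>?\<delta>\<bar> ^ m)"
          unfolding eq norm_scaleR real_norm_def abs_mult power_abs
          using k Bq[of ?y] order_trans[OF abs_ge_zero Bq[of 0]] by (intro mult_mono mult_nonneg_nonneg) auto
        also have "\<dots> = Bq * K" using N by (simp add: power_one_over)
        finally show ?thesis .
      qed
      then show "\<exists>K. \<forall>N u. N \<noteq> 0 \<longrightarrow> norm u \<le> R \<longrightarrow> norm (H N u) \<le> K" by blast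
    qed
  qed
  have "osc_expandable m (\<lambda>N x. G N x + (1 / of_int N ^ m) *\<^sub>R H N x)"
    using osc_add[OF G osc_shift_power[OF H, of m, simplified]] by simp
  then have "osc_expandable m F"
    by (rule osc_cong) (auto simp: H_def fun_eq_iff)
  then show ?thesis unfolding F_def[abs_def] .
qed

section \<open>Integration over the ordered simplex\<close>

text \<open>
  A class of integrands for which integrability, exchange of integrations and
  changes of variables hold without further conditions.
\<close>

definition bounded_supported :: "('a::euclidean_space \<Rightarrow> 'b::euclidean_space) \<Rightarrow> bool" where
  "bounded_supported F \<longleftrightarrow> F \<in> borel_measurable borel \<and>
    (\<exists>K R. \<forall>x. norm (F x) \<le> K \<and> (R < norm x \<longrightarrow> F x = 0))"

lemma bounded_supportedI:
  assumes "F \<in> borel_measurable borel" "\<And>x. norm (F x) \<le> K" "\<And>x. F x \<noteq> 0 \<Longrightarrow> norm x \<le> R"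
  shows "bounded_supported F"
  using assms unfolding bounded_supported_def by (metis not_less)

lemma bounded_supportedE:
  assumes "bounded_supported F"
  obtains K R where "0 \<le> K" "0 \<le> R" "\<And>x. norm (F x) \<le> K" "\<And>x. F x \<noteq> 0 \<Longrightarrow> norm x \<le> R"
proof -
  from assms obtain K R where K: "\<And>x. norm (F x) \<le> K" and R: "\<And>x. R < norm x \<Longrightarrow> F x = 0"
    unfolding bounded_supported_def by blast
  have "0 \<le> K" using order_trans[OF norm_ge_zero K] .
  moreover have "norm x \<le> \<bar>R\<bar>" if "F x \<noteq> 0" for x using R[of x] that by fastforce
  ultimately show ?thesis using K that[of K "\<bar>R\<bar>"] by auto
qed

lemma bounded_supported_measurable: "bounded_supported F \<Longrightarrow> F \<in> borel_measurable borel"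
  by (simp add: bounded_supported_def)

lemma bounded_supported_integrable: "bounded_supported F \<Longrightarrow> integrable lborel F"
proof -
  assume F: "bounded_supported F"
  obtain K R where "0 \<le> K" "0 \<le> R" "\<And>x. norm (F x) \<le> K" "\<And>x. F x \<noteq> 0 \<Longrightarrow> norm x \<le> R"
    by (rule bounded_supportedE[OF F]) (rule that; assumption)
  with F show ?thesis
    by (intro integrable_lborel_bounded_support[where K = K and R = R])
      (auto simp: bounded_supported_measurable not_le[symmetric])
qed

lemma Fubini_bounded_supported:
  fixes H :: "'a::euclidean_space \<times> 'c::euclidean_space \<Rightarrow> 'b::euclidean_space"
  assumes "bounded_supported H"
  shows "(LINT y|lborel. LINT x|lborel. H (x, y)) = (LINT x|lborel. LINT y|lborel. H (x, y))"
  using lborel_pair.Fubini_integral[of "\<lambda>x y. H (x, y)"] bounded_supported_integrable[OF assms]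
  by (simp add: lborel_prod)

lemma integral_translate:
  fixes F :: "'a::euclidean_space \<Rightarrow> 'b::euclidean_space"
  assumes [measurable]: "F \<in> borel_measurable borel"
  shows "(LINT x|lborel. F (c + x)) = (LINT x|lborel. F x)"
proof -
  have "(LINT x|lborel. F x) = (LINT x|distr lborel borel ((+) c). F x)" by (simp add: lborel_distr_plus)
  also have "\<dots> = (LINT x|lborel. F (c + x))" by (rule integral_distr) auto
  finally show ?thesis by simp
qed

text \<open>
  Fubini's theorem for one coordinate without leaving the space: the coordinate that has
  been integrated out is replaced by a dummy running through \<open>[0, 1]\<close>. In the proof the
  inner integral runs over the translates \<open>u + r e\<^sub>i\<close>; after exchanging the integrals, a
  translation by \<open>- r e\<^sub>i\<close> moves \<open>r\<close> into the indicator, whose integral over \<open>r\<close> is \<open>1\<close>.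
\<close>

lemma integral_integrate_out_coord:
  fixes F :: "real ^ 'n \<Rightarrow> 'b::euclidean_space"
  assumes F: "bounded_supported F"
  shows "(LINT u|lborel. F u) =
    (LINT u|lborel. indicator {u. 0 \<le> u $ i \<and> u $ i \<le> 1} u *\<^sub>R (LINT s|lborel. F (set_coord i s u)))"
proof -
  note [measurable] = bounded_supported_measurable[OF F]
  obtain K R where KR: "0 \<le> K" "0 \<le> R" "\<And>x. norm (F x) \<le> K" "\<And>x. F x \<noteq> 0 \<Longrightarrow> norm x \<le> R"
    by (rule bounded_supportedE[OF F]) (rule that; assumption)
  let ?e = "axis i 1 :: real ^ 'n"
  define H where "H = (\<lambda>(r, u). (if 0 \<le> u $ i \<and> u $ i \<le> 1 then 1 else 0 :: real) *\<^sub>R F (r *\<^sub>R ?e + u))"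
  define H' where "H' = (\<lambda>(r, u). (if 0 \<le> u $ i - r \<and> u $ i - r \<le> 1 then 1 else 0 :: real) *\<^sub>R F u)"
  have H: "bounded_supported H"
  proof (rule bounded_supportedI[where K = K and R = "(R + 1) + (R + (R + 1))"])
    have "H \<in> borel_measurable (borel \<Otimes>\<^sub>M borel)" unfolding H_def by measurable
    then show "H \<in> borel_measurable borel" by (simp add: borel_prod)
    show "norm (H x) \<le> K" for x using KR by (auto simp: H_def split: prod.split)
    fix p assume p: "H p \<noteq> 0"
    obtain r u where ru: "p = (r, u)" by (cases p)
    from p have u: "0 \<le> u $ i" "u $ i \<le> 1" and n: "norm (r *\<^sub>R ?e + u) \<le> R"
      using KR(4) by (auto simp: H_def ru split: if_splits)
    have "\<bar>r + u $ i\<bar> \<le> R"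
      using component_le_norm_cart[of "r *\<^sub>R ?e + u" i] n by (simp add: axis_def)
    then have r: "\<bar>r\<bar> \<le> R + 1" using u by linarith
    have "norm u \<le> norm (r *\<^sub>R ?e + u) + norm (r *\<^sub>R ?e)"
      using norm_triangle_ineq4[of "r *\<^sub>R ?e + u" "r *\<^sub>R ?e"] by simp
    then have "norm u \<le> R + (R + 1)" using n r by simp
    moreover have "norm p \<le> norm r + norm u" unfolding ru by (rule norm_Pair_le)
    ultimately show "norm p \<le> (R + 1) + (R + (R + 1))" using r by simp
  qed
  have H': "bounded_supported H'"
  proof (rule bounded_supportedI[where K = K and R = "(R + 1) + R"])
    have "H' \<in> borel_measurable (borel \<Otimes>\<^sub>M borel)" unfolding H'_def by measurable
    then show "H' \<in> borel_measurable borel" by (simp add: borel_prod)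
    show "norm (H' x) \<le> K" for x using KR by (auto simp: H'_def split: prod.split)
    fix p assume p: "H' p \<noteq> 0"
    obtain r u where ru: "p = (r, u)" by (cases p)
    from p have u: "0 \<le> u $ i - r" "u $ i - r \<le> 1" and n: "norm u \<le> R"
      using KR(4) by (auto simp: H'_def ru split: if_splits)
    then have "\<bar>r\<bar> \<le> R + 1" using component_le_norm_cart[of u i] by linarith
    moreover have "norm p \<le> norm r + norm u" unfolding ru by (rule norm_Pair_le)
    ultimately show "norm p \<le> (R + 1) + R" using n by simp
  qed
  have "(LINT u|lborel. indicator {u. 0 \<le> u $ i \<and> u $ i \<le> 1} u *\<^sub>R (LINT s|lborel. F (set_coord i s u)))
    = (LINT u|lborel. LINT r|lborel. H (r, u))"
  proof (rule Bochner_Integration.integral_cong[OF refl])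
    fix u :: "real ^ 'n"
    have "(LINT s|lborel. F (set_coord i s u)) = (LINT r|lborel. F (set_coord i (u $ i + 1 * r) u))"
      using lborel_integral_real_affine[of 1 "\<lambda>s. F (set_coord i s u)" "u $ i"] by simp
    also have "(\<lambda>r. set_coord i (u $ i + 1 * r) u) = (\<lambda>r. r *\<^sub>R ?e + u)"
      by (auto simp: fun_eq_iff vec_eq_iff set_coord_def axis_def)
    then have "(LINT r|lborel. F (set_coord i (u $ i + 1 * r) u)) = (LINT r|lborel. F (r *\<^sub>R ?e + u))"
      by (metis (no_types, lifting))
    finally show "indicator {u. 0 \<le> u $ i \<and> u $ i \<le> 1} u *\<^sub>R (LINT s|lborel. F (set_coord i s u))
      = (LINT r|lborel. H (r, u))"
      by (auto simp: H_def indicator_def)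
  qed
  also have "\<dots> = (LINT r|lborel. LINT u|lborel. H (r, u))"
    by (rule Fubini_bounded_supported[OF H])
  also have "\<dots> = (LINT r|lborel. LINT u|lborel. H' (r, u))"
  proof (rule Bochner_Integration.integral_cong[OF refl])
    fix r :: real
    have "(\<lambda>u. (if 0 \<le> u $ i - r \<and> u $ i - r \<le> 1 then 1 else 0 :: real) *\<^sub>R F u) \<in> borel_measurable borel"
      by measurable
    then have "(\<lambda>u. H' (r, u)) \<in> borel_measurable borel" by (simp add: H'_def)
    from integral_translate[OF this, of "r *\<^sub>R ?e"]
    have "(LINT u|lborel. H' (r, r *\<^sub>R ?e + u)) = (LINT u|lborel. H' (r, u))" .
    moreover have "H' (r, r *\<^sub>R ?e + u) = H (r, u)" for u
      by (simp add: H_def H'_def axis_def)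
    ultimately show "(LINT u|lborel. H (r, u)) = (LINT u|lborel. H' (r, u))" by simp
  qed
  also have "\<dots> = (LINT u|lborel. LINT r|lborel. H' (r, u))"
    by (rule Fubini_bounded_supported[OF H', symmetric])
  also have "\<dots> = (LINT u|lborel. F u)"
  proof (rule Bochner_Integration.integral_cong[OF refl])
    fix u
    have "(\<lambda>r. H' (r, u)) = (\<lambda>r. indicator {u $ i - 1..u $ i} r *\<^sub>R F u)"
      by (auto simp: H'_def fun_eq_iff indicator_def)
    then show "(LINT r|lborel. H' (r, u)) = F u" by simp
  qed
  finally show ?thesis by simp
qed

text \<open>
  The coordinates are enumerated by \<open>e\<close>. For \<open>r = 0\<close> this is the ordered simplex
  \<open>0 \<le> u\<^sub>e\<^sub>0 \<le> \<dots> \<le> u\<^sub>e\<^sub>(\<^sub>d\<^sub>-\<^sub>1\<^sub>) \<le> 1\<close>; increasing \<open>r\<close> frees the first \<open>r\<close> coordinates, until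
  the unit cube is reached.
\<close>

definition chain_region :: "(nat \<Rightarrow> 'n) \<Rightarrow> nat \<Rightarrow> (real ^ 'n) set" where
  "chain_region e r = {u. (\<forall>i. 0 \<le> u $ i \<and> u $ i \<le> 1) \<and>
     (\<forall>k. r \<le> k \<longrightarrow> Suc k < CARD('n) \<longrightarrow> u $ e k \<le> u $ e (Suc k))}"

definition next_coord :: "(nat \<Rightarrow> 'n) \<Rightarrow> nat \<Rightarrow> real ^ 'n \<Rightarrow> real" where
  "next_coord e r u = (if Suc r < CARD('n) then u $ e (Suc r) else 1)"

text \<open>
  Integration of the coordinate \<open>e r\<close> from \<open>0\<close> up to the next coordinate of the chain, or up
  to \<open>1\<close> for the last one.
\<close>

definition chain_step :: "(nat \<Rightarrow> 'n) \<Rightarrow> nat \<Rightarrow> (real ^ 'n \<Rightarrow> 'b) \<Rightarrow> real ^ 'n \<Rightarrow> 'b::euclidean_space" where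
  "chain_step e r g u = coord_primitive (e r) g (set_coord (e r) (next_coord e r u) u)"

lemma chain_region_measurable [measurable]: "chain_region e r \<in> sets borel"
  unfolding chain_region_def by measurable

lemma chain_region_norm_le: "u \<in> chain_region e r \<Longrightarrow> norm (u :: real ^ 'n) \<le> CARD('n)"
proof -
  assume "u \<in> chain_region e r"
  then have "(\<Sum>i\<in>UNIV. \<bar>u $ i\<bar>) \<le> (\<Sum>i\<in>(UNIV :: 'n set). 1)"
    by (intro sum_mono) (auto simp: chain_region_def)
  then show ?thesis using norm_le_l1_cart[of u] by simp
qed

lemma bounded_supported_chain_region:
  fixes g :: "real ^ 'n \<Rightarrow> 'b::euclidean_space"
  assumes [measurable]: "g \<in> borel_measurable borel"
    and g: "\<And>u. norm u \<le> CARD('n) \<Longrightarrow> norm (g u) \<le> K"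
  shows "bounded_supported (\<lambda>u. indicator (chain_region e r) u *\<^sub>R g u)"
proof (rule bounded_supportedI[where K = K and R = "CARD('n)"])
  have "0 \<le> K" using order_trans[OF norm_ge_zero g[of 0]] by simp
  then show "norm (indicator (chain_region e r) u *\<^sub>R g u) \<le> K" for u
    using g chain_region_norm_le[of u] by (auto simp: indicator_def)
qed (auto simp: indicator_def intro: chain_region_norm_le split: if_splits)

lemma ex_coord_enumeration:
  obtains e :: "nat \<Rightarrow> 'n::finite" where "bij_betw e {..<CARD('n)} UNIV"
  using ex_bij_betw_nat_finite[of "UNIV :: 'n set"] by (auto simp: atLeast0LessThan)

lemma integral_chain_step:
  fixes g :: "real ^ 'n \<Rightarrow> 'b::euclidean_space"
  assumes e: "bij_betw e {..<CARD('n)} UNIV" and r: "r < CARD('n)"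
    and gm [measurable]: "g \<in> borel_measurable borel"
    and g: "\<And>u. norm u \<le> CARD('n) \<Longrightarrow> norm (g u) \<le> K"
  shows "(LINT u:chain_region e r|lborel. g u) = (LINT u:chain_region e (Suc r)|lborel. chain_step e r g u)"
proof -
  let ?i = "e r"
  have inj: "k < CARD('n) \<Longrightarrow> r < k \<Longrightarrow> e k \<noteq> ?i" for k
    using e r unfolding bij_betw_def inj_on_def by blast
  \<comment> \<open>the fibre of the region over \<open>u\<close> in direction \<open>e r\<close> is an interval\<close>
  have mem: "set_coord ?i s u \<in> chain_region e r \<longleftrightarrow> u \<in> chain_region e (Suc r) \<and> 0 \<le> s \<and> s \<le> next_coord e r u"
    if u: "0 \<le> u $ ?i" "u $ ?i \<le> 1" for u s
  proof
    assume L: "set_coord ?i s u \<in> chain_region e r"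
    then have b: "\<And>j. 0 \<le> set_coord ?i s u $ j \<and> set_coord ?i s u $ j \<le> 1"
      and c: "\<And>k. r \<le> k \<Longrightarrow> Suc k < CARD('n) \<Longrightarrow> set_coord ?i s u $ e k \<le> set_coord ?i s u $ e (Suc k)"
      by (auto simp: chain_region_def)
    have "0 \<le> s" "s \<le> 1" using b[of ?i] by (auto simp: set_coord_nth)
    moreover have "0 \<le> u $ j \<and> u $ j \<le> 1" for j using b[of j] u by (cases "j = ?i") (auto simp: set_coord_nth)
    moreover have "u $ e k \<le> u $ e (Suc k)" if "Suc r \<le> k" "Suc k < CARD('n)" for k
      using c[of k] that inj[of k] inj[of "Suc k"] by (auto simp: set_coord_nth)
    moreover have "s \<le> u $ e (Suc r)" if "Suc r < CARD('n)"
      using c[of r] that inj[of "Suc r"] by (auto simp: set_coord_nth)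
    ultimately show "u \<in> chain_region e (Suc r) \<and> 0 \<le> s \<and> s \<le> next_coord e r u"
      by (auto simp: chain_region_def next_coord_def)
  next
    assume R: "u \<in> chain_region e (Suc r) \<and> 0 \<le> s \<and> s \<le> next_coord e r u"
    then have b: "\<And>j. 0 \<le> u $ j \<and> u $ j \<le> 1"
      and c: "\<And>k. Suc r \<le> k \<Longrightarrow> Suc k < CARD('n) \<Longrightarrow> u $ e k \<le> u $ e (Suc k)"
      by (auto simp: chain_region_def)
    have "s \<le> 1" using R b[of "e (Suc r)"] by (auto simp: next_coord_def split: if_splits)
    then have "0 \<le> set_coord ?i s u $ j \<and> set_coord ?i s u $ j \<le> 1" for j
      using R b[of j] by (auto simp: set_coord_nth)
    moreover have "set_coord ?i s u $ e k \<le> set_coord ?i s u $ e (Suc k)" if k: "r \<le> k" "Suc k < CARD('n)" for k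
    proof (cases "k = r")
      case True
      then show ?thesis using R k inj[of "Suc r"] by (auto simp: set_coord_nth next_coord_def)
    next
      case False
      then show ?thesis using c[of k] k inj[of k] inj[of "Suc k"] by (auto simp: set_coord_nth)
    qed
    ultimately show "set_coord ?i s u \<in> chain_region e r" by (simp add: chain_region_def)
  qed
  have "(LINT u:chain_region e r|lborel. g u) =
    (LINT u|lborel. indicator {u. 0 \<le> u $ ?i \<and> u $ ?i \<le> 1} u *\<^sub>R
      (LINT s|lborel. indicator (chain_region e r) (set_coord ?i s u) *\<^sub>R g (set_coord ?i s u)))"
    unfolding set_lebesgue_integral_def
    by (rule integral_integrate_out_coord[OF bounded_supported_chain_region[OF gm g]])
  also have "\<dots> = (LINT u:chain_region e (Suc r)|lborel. chain_step e r g u)"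
    unfolding set_lebesgue_integral_def
  proof (rule Bochner_Integration.integral_cong[OF refl])
    fix u :: "real ^ 'n"
    show "indicator {u. 0 \<le> u $ ?i \<and> u $ ?i \<le> 1} u *\<^sub>R
      (LINT s|lborel. indicator (chain_region e r) (set_coord ?i s u) *\<^sub>R g (set_coord ?i s u))
      = indicator (chain_region e (Suc r)) u *\<^sub>R chain_step e r g u"
    proof (cases "0 \<le> u $ ?i \<and> u $ ?i \<le> 1")
      case False
      then have "u \<notin> chain_region e (Suc r)" by (auto simp: chain_region_def)
      with False show ?thesis by (auto simp: indicator_def)
    next
      case True
      show ?thesis
      proof (cases "u \<in> chain_region e (Suc r)")
        case False
        then have "set_coord ?i s u \<notin> chain_region e r" for s using mem True by blast
        with False show ?thesis by simp
      next
        case u: True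
        define t where "t = next_coord e r u"
        have t: "0 \<le> t" using u by (auto simp: t_def next_coord_def chain_region_def)
        have "indicator (chain_region e r) (set_coord ?i s u) = (indicator {0..t} s :: real)" for s
          using mem[of u s] True u by (auto simp: t_def indicator_def)
        then have "(LINT s|lborel. indicator (chain_region e r) (set_coord ?i s u) *\<^sub>R g (set_coord ?i s u))
          = (LINT s:{0..t}|lborel. g (set_coord ?i s u))"
          by (simp add: set_lebesgue_integral_def)
        also have "\<dots> = t *\<^sub>R (LINT s:{0..1}|lborel. g (set_coord ?i (s * t) u))"
          by (rule set_integral_Icc_scale[OF _ t]) measurable
        also have "\<dots> = chain_step e r g u"
          by (simp add: chain_step_def coord_primitive_def scale_coord_eq_set_coord set_coord_nth flip: t_def)
        finally show ?thesis using True u by simp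
      qed
    qed
  qed
  finally show ?thesis .
qed

lemma osc_chain_step:
  fixes F :: "int \<Rightarrow> real ^ 'n \<Rightarrow> 'b::euclidean_space"
  assumes "osc_expandable m F"
  shows "osc_expandable m (\<lambda>N. chain_step e r (F N))"
proof -
  \<comment> \<open>the substitution \<open>u\<^sub>e\<^sub>r := next_coord e r u\<close> as an integral affine map\<close>
  define v :: "real ^ 'n" where "v = (\<chi> j. if j = e r \<and> \<not> Suc r < CARD('n) then 1 else 0)"
  define A :: "real ^ 'n ^ 'n" where
    "A = (\<chi> j l. if j = e r then (if Suc r < CARD('n) \<and> l = e (Suc r) then 1 else 0) else if j = l then 1 else 0)"
  have "set_coord (e r) (next_coord e r u) u = v + A *v u" for u
  proof (subst vec_eq_iff, intro allI)
    fix j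
    show "set_coord (e r) (next_coord e r u) u $ j = (v + A *v u) $ j"
      by (auto simp: set_coord_nth next_coord_def v_def A_def matrix_vector_mult_def
          if_distrib[where f = "\<lambda>x. x * _"] cong: if_cong)
  qed
  then have "chain_step e r (F N) = (\<lambda>u. coord_primitive (e r) (F N) (v + A *v u))" for N
    by (simp add: chain_step_def fun_eq_iff)
  moreover have "osc_expandable m (\<lambda>N u. coord_primitive (e r) (F N) (v + A *v u))"
    by (rule osc_substitute[OF osc_coord_primitive[OF assms]])
      (auto simp: v_def A_def integer_lattice_def)
  ultimately show ?thesis by simp
qed

primrec iterated_integral :: "(nat \<Rightarrow> 'n) \<Rightarrow> nat \<Rightarrow> (real ^ 'n \<Rightarrow> 'b) \<Rightarrow> real ^ 'n \<Rightarrow> 'b::euclidean_space" where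
  "iterated_integral e 0 g = g"
| "iterated_integral e (Suc r) g = chain_step e r (iterated_integral e r g)"

lemma osc_iterated_integral: "osc_expandable m F \<Longrightarrow> osc_expandable m (\<lambda>N. iterated_integral e r (F N))"
  by (induction r) (auto intro: osc_chain_step)

text \<open>
  A coordinate that has been integrated out no longer matters. After all \<open>d\<close> steps the
  result is a constant.
\<close>

lemma iterated_integral_cong:
  fixes u u' :: "real ^ 'n"
  assumes e: "bij_betw e {..<CARD('n)} UNIV"
  shows "r \<le> CARD('n) \<Longrightarrow> (\<And>k. r \<le> k \<Longrightarrow> k < CARD('n) \<Longrightarrow> u $ e k = u' $ e k) \<Longrightarrow>
    iterated_integral e r g u = iterated_integral e r g u'"
proof (induction r arbitrary: u u')
  case 0
  have "u $ i = u' $ i" for i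
    using e 0(2) unfolding bij_betw_def by (metis UNIV_I imageE lessThan_iff zero_le)
  then have "u = u'" by (simp add: vec_eq_iff)
  then show ?case by simp
next
  case (Suc r)
  define w where "w = set_coord (e r) (next_coord e r u) u"
  define w' where "w' = set_coord (e r) (next_coord e r u') u'"
  have n: "next_coord e r u = next_coord e r u'" using Suc.prems(2)[of "Suc r"] by (auto simp: next_coord_def)
  have ww: "w $ e k = w' $ e k" if "r \<le> k" "k < CARD('n)" for k
    using Suc.prems(2)[of k] that n by (cases "k = r") (auto simp: w_def w'_def set_coord_nth)
  have "iterated_integral e r g (scale_coord (e r) s w) = iterated_integral e r g (scale_coord (e r) s w')" for s
    using Suc.prems(1) ww by (intro Suc.IH) (auto simp: scale_coord_def)
  moreover have "w $ e r = w' $ e r" using ww[of r] Suc.prems(1) by simp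
  ultimately show ?case
    by (simp add: chain_step_def coord_primitive_def flip: w_def w'_def)
qed

text \<open>
  The integral over the ordered simplex equals an iterated integral, which stays in the
  class of expandable functions and is a constant function of \<open>u\<close>; its value at the
  origin is expanded in powers of \<open>1 / N\<close>.
\<close>

lemma integral_ordered_simplex_expansion:
  fixes F :: "int \<Rightarrow> real ^ 'n \<Rightarrow> 'b::euclidean_space"
  assumes F: "osc_expandable m F" and e: "bij_betw e {..<CARD('n)} UNIV"
  shows "has_expansion m (\<lambda>N. LINT u:chain_region e 0|lborel. F N u)"
proof (rule has_expansion_cong[OF osc_expansion_at_0[OF osc_iterated_integral[OF F, of e "CARD('n)"]]])
  show "(LINT u:chain_region e 0|lborel. F N u) = iterated_integral e (CARD('n)) (F N) 0" if N: "N \<noteq> 0" for N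
  proof -
    have "(LINT u:chain_region e 0|lborel. F N u) = (LINT u:chain_region e r|lborel. iterated_integral e r (F N) u)"
      if "r \<le> CARD('n)" for r using that
    proof (induction r)
      case (Suc r)
      note o = osc_iterated_integral[OF F, of e r]
      obtain K where K: "\<forall>N u. N \<noteq> 0 \<longrightarrow> norm u \<le> CARD('n) \<longrightarrow> norm (iterated_integral e r (F N) u) \<le> K"
        by (rule uniformly_locally_boundedE[OF osc_bounded[OF o], where R = "CARD('n)"])
      show ?case
        using Suc integral_chain_step[OF e _ osc_measurable[OF o N], of r K] K N by simp
    qed simp
    from this[of "CARD('n)"]
    have "(LINT u:chain_region e 0|lborel. F N u) =
      (LINT u:chain_region e (CARD('n))|lborel. iterated_integral e (CARD('n)) (F N) u)" by simp
    also have "\<dots> = (LINT u:chain_region e (CARD('n))|lborel. iterated_integral e (CARD('n)) (F N) 0)"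
      unfolding set_lebesgue_integral_def
      by (intro Bochner_Integration.integral_cong refl arg_cong2[where f = scaleR] iterated_integral_cong[OF e]) auto
    also have "chain_region e (CARD('n)) = cbox 0 (\<chi> i. 1)"
      by (auto simp: chain_region_def mem_box_cart)
    also have "(LINT u : (cbox 0 (\<chi> i. 1) :: (real ^ 'n) set)|lborel. iterated_integral e (CARD('n)) (F N) 0)
      = iterated_integral e (CARD('n)) (F N) 0"
    proof -
      have 1: "measure lborel (cbox 0 (\<chi> i. 1) :: (real ^ 'n) set) = 1"
        by (subst content_cbox_cart) (auto simp: interval_eq_empty_cart)
      have "integrable lborel (indicator (cbox 0 (\<chi> i. 1) :: (real ^ 'n) set) :: real ^ 'n \<Rightarrow> real)"
        using emeasure_bounded_finite[OF bounded_cbox] by (intro integrable_real_indicator) auto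
      then show ?thesis
        unfolding set_lebesgue_integral_def using 1 by (subst integral_scaleR_left) auto
    qed
    finally show ?thesis .
  qed
qed

section \<open>Affine changes of variables\<close>

text \<open>
  The uniqueness of translation-invariant integration, for the functional
  \<open>F \<mapsto> \<integral> F (A u) du\<close>. Testing against a fixed bump \<open>g\<close>, the double integral of
  \<open>g (y - A u) F (A u)\<close> is evaluated in both orders, each time after a translation of
  the inner variable. The matrix \<open>B\<close> provides the translation by \<open>B y\<close> in \<open>u\<close>.
\<close>

lemma integral_linear_change:
  fixes A B :: "real ^ 'n ^ 'n"
  assumes AB: "A ** B = mat 1" "B ** A = mat 1"
  shows "\<exists>c. \<forall>F :: real ^ 'n \<Rightarrow> 'b::euclidean_space. bounded_supported F \<longrightarrow>
    (LINT u|lborel. F (A *v u)) = c *\<^sub>R (LINT x|lborel. F x)"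
proof -
  define g :: "real ^ 'n \<Rightarrow> real" where "g = indicator (cball 0 1)"
  define V where "V = (LINT y|lborel. g y)"
  have g: "bounded_supported g"
    unfolding g_def by (intro bounded_supportedI[where K = 1 and R = 1] borel_measurable_indicator)
      (auto simp: indicator_def split: if_splits)
  note [measurable] = bounded_supported_measurable[OF g]
  have "V > 0"
    using content_cball_pos[of 1 "0 :: real ^ 'n"] by (simp add: V_def g_def)
  obtain b where b: "\<And>x. norm (B *v x) \<le> norm x * b" "b > 0"
    using bounded_linear.pos_bounded[OF matrix_vector_mul_bounded_linear[of B]] by blast
  have BA: "B *v (A *v u) = u" "A *v (B *v u) = u" for u using AB by (simp_all add: matrix_vector_mul_assoc)
  have nb: "norm u \<le> norm (A *v u) * b" for u using b(1)[of "A *v u"] by (simp add: BA)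
  define C where "C = (LINT u|lborel. g (- (A *v u)))"
  show ?thesis
  proof (intro exI[of _ "C / V"] allI impI)
    fix F :: "real ^ 'n \<Rightarrow> 'b" assume F: "bounded_supported F"
    note [measurable] = bounded_supported_measurable[OF F]
    obtain K R where KR: "0 \<le> K" "0 \<le> R" "\<And>x. norm (F x) \<le> K" "\<And>x. F x \<noteq> 0 \<Longrightarrow> norm x \<le> R"
      by (rule bounded_supportedE[OF F]) (rule that; assumption)
    define H where "H = (\<lambda>(u, y). g (y - A *v u) *\<^sub>R F (A *v u))"
    define H' where "H' = (\<lambda>(u, y). g (- (A *v u)) *\<^sub>R F (A *v u + y))"
    have gle: "\<bar>g x\<bar> \<le> 1" "g x \<noteq> 0 \<Longrightarrow> norm x \<le> 1" for x by (auto simp: g_def indicator_def split: if_splits)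
    have H: "bounded_supported H"
    proof (rule bounded_supportedI[where K = K and R = "R * b + (R + 1)"])
      have "H \<in> borel_measurable (borel \<Otimes>\<^sub>M borel)" unfolding H_def by measurable
      then show "H \<in> borel_measurable borel" by (simp add: borel_prod)
      show "norm (H x) \<le> K" for x using KR mult_mono[OF gle(1) KR(3)] by (auto simp: H_def split: prod.split)
      fix p assume p: "H p \<noteq> 0"
      obtain u y where uy: "p = (u, y)" by (cases p)
      from p have n: "norm (A *v u) \<le> R" "norm (y - A *v u) \<le> 1"
        using KR(4) gle(2) by (auto simp: H_def uy)
      have "norm u \<le> R * b" using nb[of u] n(1) b(2) mult_right_mono[of _ R b] by (meson less_imp_le order_trans)
      moreover have "norm y \<le> R + 1" using norm_triangle_ineq[of "y - A *v u" "A *v u"] n by simp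
      moreover have "norm p \<le> norm u + norm y" unfolding uy by (rule norm_Pair_le)
      ultimately show "norm p \<le> R * b + (R + 1)" by simp
    qed
    have H': "bounded_supported H'"
    proof (rule bounded_supportedI[where K = K and R = "1 * b + (R + 1)"])
      have "H' \<in> borel_measurable (borel \<Otimes>\<^sub>M borel)" unfolding H'_def by measurable
      then show "H' \<in> borel_measurable borel" by (simp add: borel_prod)
      show "norm (H' x) \<le> K" for x using KR mult_mono[OF gle(1) KR(3)] by (auto simp: H'_def split: prod.split)
      fix p assume p: "H' p \<noteq> 0"
      obtain u y where uy: "p = (u, y)" by (cases p)
      from p have n: "norm (A *v u + y) \<le> R" "norm (A *v u) \<le> 1"
        using KR(4) gle(2)[of "- (A *v u)"] by (auto simp: H'_def uy)
      have "norm u \<le> 1 * b" using nb[of u] n(2) b(2) mult_right_mono[of _ 1 b] by (meson less_imp_le order_trans)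
      moreover have "norm y \<le> R + 1" using norm_triangle_ineq4[of "A *v u + y" "A *v u"] n by simp
      moreover have "norm p \<le> norm u + norm y" unfolding uy by (rule norm_Pair_le)
      ultimately show "norm p \<le> 1 * b + (R + 1)" by simp
    qed
    have "V *\<^sub>R (LINT u|lborel. F (A *v u)) = (LINT u|lborel. V *\<^sub>R F (A *v u))" by simp
    also have "\<dots> = (LINT u|lborel. LINT y|lborel. H (u, y))"
    proof (rule Bochner_Integration.integral_cong[OF refl])
      fix u
      have "(LINT y|lborel. H (u, y)) = (LINT y|lborel. g (- (A *v u) + y) *\<^sub>R F (A *v u))" by (simp add: H_def)
      also have "\<dots> = (LINT y|lborel. g y *\<^sub>R F (A *v u))"
        by (rule integral_translate[of "\<lambda>y. g y *\<^sub>R F (A *v u)"]) measurable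
      also have "\<dots> = V *\<^sub>R F (A *v u)"
        unfolding V_def by (rule integral_scaleR_left) (rule bounded_supported_integrable[OF g])
      finally show "V *\<^sub>R F (A *v u) = (LINT y|lborel. H (u, y))" by simp
    qed
    also have "\<dots> = (LINT y|lborel. LINT u|lborel. H (u, y))"
      by (rule Fubini_bounded_supported[OF H, symmetric])
    also have "\<dots> = (LINT y|lborel. LINT u|lborel. H' (u, y))"
    proof (rule Bochner_Integration.integral_cong[OF refl])
      fix y
      have "(\<lambda>u. g (y - A *v u) *\<^sub>R F (A *v u)) \<in> borel_measurable borel" by measurable
      then have "(\<lambda>u. H (u, y)) \<in> borel_measurable borel" by (simp add: H_def)
      from integral_translate[OF this, of "B *v y"]
      have "(LINT u|lborel. H (B *v y + u, y)) = (LINT u|lborel. H (u, y))" .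
      moreover have "H (B *v y + u, y) = H' (u, y)" for u
        by (simp add: H_def H'_def matrix_vector_right_distrib BA add.commute)
      ultimately show "(LINT u|lborel. H (u, y)) = (LINT u|lborel. H' (u, y))" by simp
    qed
    also have "\<dots> = (LINT u|lborel. LINT y|lborel. H' (u, y))"
      by (rule Fubini_bounded_supported[OF H'])
    also have "\<dots> = (LINT u|lborel. g (- (A *v u)) *\<^sub>R (LINT x|lborel. F x))"
      using integral_translate[of F] by (simp add: H'_def)
    also have "\<dots> = C *\<^sub>R (LINT x|lborel. F x)"
      unfolding C_def
    proof (rule integral_scaleR_left, rule bounded_supported_integrable,
        rule bounded_supportedI[where K = 1 and R = "1 * b"])
      fix u assume "g (- (A *v u)) \<noteq> 0"
      then have "norm (A *v u) \<le> 1" using gle(2)[of "- (A *v u)"] by simp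
      then show "norm u \<le> 1 * b" using nb[of u] b(2) mult_right_mono[of _ 1 b] by (meson less_imp_le order_trans)
    qed (use gle in auto)
    finally have *: "V *\<^sub>R (LINT u|lborel. F (A *v u)) = C *\<^sub>R (LINT x|lborel. F x)" .
    have "(LINT u|lborel. F (A *v u)) = (1 / V) *\<^sub>R (V *\<^sub>R (LINT u|lborel. F (A *v u)))" using \<open>V > 0\<close> by simp
    then show "(LINT u|lborel. F (A *v u)) = (C / V) *\<^sub>R (LINT x|lborel. F x)" unfolding * by simp
  qed
qed

lemma integral_affine_change:
  fixes A :: "real ^ 'n ^ 'n"
  assumes A: "invertible A"
  shows "\<exists>c. \<forall>G :: real ^ 'n \<Rightarrow> 'b::euclidean_space. bounded_supported G \<longrightarrow>
    (LINT x|lborel. G x) = c *\<^sub>R (LINT u|lborel. G (v + A *v u))"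
proof -
  from A obtain B where AB: "A ** B = mat 1" "B ** A = mat 1" by (auto simp: invertible_def)
  from integral_linear_change[OF AB(2,1)] obtain c where
    c: "\<And>F :: real ^ 'n \<Rightarrow> 'b. bounded_supported F \<Longrightarrow> (LINT u|lborel. F (B *v u)) = c *\<^sub>R (LINT x|lborel. F x)"
    by blast
  obtain b where b: "\<And>x. norm (B *v x) \<le> norm x * b" "b > 0"
    using bounded_linear.pos_bounded[OF matrix_vector_mul_bounded_linear[of B]] by blast
  have BA: "B *v (A *v u) = u" "A *v (B *v u) = u" for u using AB by (simp_all add: matrix_vector_mul_assoc)
  show ?thesis
  proof (intro exI[of _ c] allI impI)
    fix G :: "real ^ 'n \<Rightarrow> 'b" assume G: "bounded_supported G"
    note [measurable] = bounded_supported_measurable[OF G]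
    obtain K R where KR: "0 \<le> K" "0 \<le> R" "\<And>x. norm (G x) \<le> K" "\<And>x. G x \<noteq> 0 \<Longrightarrow> norm x \<le> R"
      by (rule bounded_supportedE[OF G]) (rule that; assumption)
    have "bounded_supported (\<lambda>u. G (v + A *v u))"
    proof (rule bounded_supportedI[where K = K and R = "(R + norm v) * b"])
      fix u assume "G (v + A *v u) \<noteq> 0"
      then have "norm (v + A *v u) \<le> R" by (rule KR)
      then have "norm (A *v u) \<le> R + norm v" using norm_triangle_ineq4[of "v + A *v u" v] by simp
      then show "norm u \<le> (R + norm v) * b"
        using b(1)[of "A *v u"] b(2) mult_right_mono[of "norm (A *v u)" "R + norm v" b] unfolding BA by linarith
    qed (use KR in auto)
    from c[OF this] show "(LINT x|lborel. G x) = c *\<^sub>R (LINT u|lborel. G (v + A *v u))"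
      using integral_translate[of G v] by (simp add: BA)
  qed
qed

section \<open>Lattice simplices as affine images\<close>

lemma abel_summation:
  fixes c :: "nat \<Rightarrow> 'a::real_vector"
  shows "(\<Sum>r\<le>d. (U r - (case r of 0 \<Rightarrow> 0 | Suc k \<Rightarrow> U k)) *\<^sub>R c r) =
    U d *\<^sub>R c d + (\<Sum>r<d. U r *\<^sub>R (c r - c (Suc r)))"
proof (induction d)
  case (Suc d)
  show ?case by (simp only: sum.atMost_Suc sum.lessThan_Suc Suc.IH) (simp add: algebra_simps)
qed simp

lemma convex_hull_enumerated:
  fixes c :: "nat \<Rightarrow> 'a::real_vector"
  assumes c: "bij_betw c {..d} C"
  shows "convex hull C = {x. \<exists>l. (\<forall>r\<le>d. 0 \<le> l r) \<and> sum l {..d} = 1 \<and> x = (\<Sum>r\<le>d. l r *\<^sub>R c r)}"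
proof -
  have fin: "finite C" using bij_betw_finite[OF c] by blast
  show ?thesis
    unfolding convex_hull_finite[OF fin]
  proof (intro Collect_cong iffI)
    fix x assume "\<exists>u. (\<forall>x\<in>C. 0 \<le> u x) \<and> sum u C = 1 \<and> (\<Sum>x\<in>C. u x *\<^sub>R x) = x"
    then obtain u where u: "\<forall>x\<in>C. 0 \<le> u x" "sum u C = 1" "(\<Sum>x\<in>C. u x *\<^sub>R x) = x"
      by (elim exE conjE) (rule that; assumption)
    have "\<forall>r\<le>d. 0 \<le> u (c r)" using u(1) bij_betwE[OF c] by simp
    moreover have "(\<Sum>r\<le>d. u (c r)) = 1" using sum.reindex_bij_betw[OF c, of u] u(2) by simp
    moreover have "(\<Sum>r\<le>d. u (c r) *\<^sub>R c r) = x"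
      using sum.reindex_bij_betw[OF c, of "\<lambda>x. u x *\<^sub>R x"] u(3) by simp
    ultimately show "\<exists>l. (\<forall>r\<le>d. 0 \<le> l r) \<and> sum l {..d} = 1 \<and> x = (\<Sum>r\<le>d. l r *\<^sub>R c r)"
      by (intro exI[of _ "\<lambda>r. u (c r)"]) simp
  next
    fix x assume "\<exists>l. (\<forall>r\<le>d. 0 \<le> l r) \<and> sum l {..d} = 1 \<and> x = (\<Sum>r\<le>d. l r *\<^sub>R c r)"
    then obtain l where l: "\<forall>r\<le>d. 0 \<le> l r" "sum l {..d} = 1" "x = (\<Sum>r\<le>d. l r *\<^sub>R c r)"
      by (elim exE conjE) (rule that; assumption)
    define u where "u y = l (the_inv_into {..d} c y)" for y
    have uc: "u (c r) = l r" if "r \<le> d" for r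
      using that c by (simp add: u_def the_inv_into_f_f bij_betw_def)
    have "0 \<le> u y" if y: "y \<in> C" for y
    proof -
      obtain r where "r \<in> {..d}" "y = c r" using y bij_betw_imp_surj_on[OF c] by blast
      then show ?thesis using l(1) uc by simp
    qed
    moreover have "sum u C = 1"
      using sum.reindex_bij_betw[OF c, of u] l(2) uc by simp
    moreover have "(\<Sum>x\<in>C. u x *\<^sub>R x) = x"
      using sum.reindex_bij_betw[OF c, of "\<lambda>x. u x *\<^sub>R x"] l(3) uc by simp
    ultimately show "\<exists>u. (\<forall>x\<in>C. 0 \<le> u x) \<and> sum u C = 1 \<and> (\<Sum>x\<in>C. u x *\<^sub>R x) = x" by blast
  qed
qed

text \<open>
  The coordinates of the ordered simplex are the partial sums of the barycentric
  coordinates; the columns of \<open>A\<close> are the differences of consecutive vertices.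
\<close>

lemma simplex_eq_affine_image_chain_region:
  fixes c :: "nat \<Rightarrow> real ^ 'n" and e :: "nat \<Rightarrow> 'n"
  assumes e: "bij_betw e {..<CARD('n)} UNIV" and c: "bij_betw c {..CARD('n)} C"
  defines "A \<equiv> \<chi> i j. (c (the_inv_into {..<CARD('n)} e j) - c (Suc (the_inv_into {..<CARD('n)} e j))) $ i"
  shows "convex hull C = (\<lambda>u. c (CARD('n)) + A *v u) ` chain_region e 0"
proof -
  let ?d = "CARD('n)"
  let ?ei = "the_inv_into {..<?d} e"
  have ei: "?ei (e r) = r" if "r < ?d" for r
    using that e by (simp add: the_inv_into_f_f bij_betw_def)
  have eie: "e (?ei j) = j" "?ei j < ?d" for j
    using e f_the_inv_into_f[of e "{..<?d}" j] the_inv_into_into[of e "{..<?d}" j "{..<?d}"] by (auto simp: bij_betw_def)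
  have Au: "A *v u = (\<Sum>r<?d. u $ e r *\<^sub>R (c r - c (Suc r)))" for u
  proof -
    have "A *v u = (\<Sum>j\<in>UNIV. u $ j *\<^sub>R (c (?ei j) - c (Suc (?ei j))))"
      by (simp add: vec_eq_iff matrix_vector_mult_def A_def mult.commute)
    also have "\<dots> = (\<Sum>r<?d. u $ e r *\<^sub>R (c (?ei (e r)) - c (Suc (?ei (e r)))))"
      by (rule sum.reindex_bij_betw[OF e, symmetric])
    finally show ?thesis using ei by simp
  qed
  show ?thesis
  proof (intro set_eqI iffI)
    fix x assume "x \<in> convex hull C"
    then obtain l where l0: "\<forall>r\<le>?d. 0 \<le> l r" and l: "sum l {..?d} = 1" "x = (\<Sum>r\<le>?d. l r *\<^sub>R c r)"
      unfolding convex_hull_enumerated[OF c] mem_Collect_eq by (elim exE conjE) (rule that; assumption)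
    have l0: "0 \<le> l r" if "r \<le> ?d" for r using l0 that by blast
    define U where "U r = sum l {..r}" for r
    define u where "u = (\<chi> i. U (?ei i))"
    have ue: "u $ e r = U r" if "r < ?d" for r using ei[OF that] by (simp add: u_def)
    have "l r = U r - (case r of 0 \<Rightarrow> 0 | Suc k \<Rightarrow> U k)" for r by (cases r) (auto simp: U_def)
    then have "x = U ?d *\<^sub>R c ?d + (\<Sum>r<?d. U r *\<^sub>R (c r - c (Suc r)))"
      using l(2) abel_summation[of U c ?d] by simp
    then have "x = c ?d + A *v u" using ue l(1) by (simp add: Au U_def)
    moreover have "u \<in> chain_region e 0"
    proof -
      have "0 \<le> U r \<and> U r \<le> 1" if "r < ?d" for r
      proof
        show "0 \<le> U r" unfolding U_def using that by (intro sum_nonneg l0) auto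
        have "U r \<le> sum l {..?d}" unfolding U_def using that by (intro sum_mono2 l0) auto
        then show "U r \<le> 1" using l by simp
      qed
      then have "0 \<le> u $ i \<and> u $ i \<le> 1" for i using eie(2)[of i] by (simp add: u_def)
      moreover have "u $ e k \<le> u $ e (Suc k)" if "Suc k < ?d" for k
        using that ue[of k] ue[of "Suc k"] l0[of "Suc k"] by (simp add: U_def)
      ultimately show ?thesis by (simp add: chain_region_def)
    qed
    ultimately show "x \<in> (\<lambda>u. c ?d + A *v u) ` chain_region e 0" by blast
  next
    fix x assume "x \<in> (\<lambda>u. c ?d + A *v u) ` chain_region e 0"
    then obtain u where u: "\<And>i. 0 \<le> u $ i \<and> u $ i \<le> 1" "\<And>k. Suc k < ?d \<Longrightarrow> u $ e k \<le> u $ e (Suc k)"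
      and x: "x = c ?d + A *v u" by (auto simp: chain_region_def)
    \<comment> \<open>the barycentric coordinates are the gaps between consecutive \<open>U r\<close>, with \<open>U d = 1\<close>\<close>
    define U where "U r = (if r < ?d then u $ e r else 1)" for r
    define l where "l r = U r - (case r of 0 \<Rightarrow> 0 | Suc k \<Rightarrow> U k)" for r
    have "0 \<le> l r" if "r \<le> ?d" for r
      using that u by (cases r) (auto simp: l_def U_def)
    moreover have "sum l {..r} = U r" for r
      by (induction r) (auto simp: l_def)
    then have "sum l {..?d} = 1" by (simp add: U_def)
    moreover have "x = (\<Sum>r\<le>?d. l r *\<^sub>R c r)"
      unfolding x Au l_def abel_summation by (simp add: U_def)
    ultimately show "x \<in> convex hull C" unfolding convex_hull_enumerated[OF c] by blast
  qed
qed

text \<open>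
  The matrix is invertible since its range contains a translate of a set of full
  affine dimension.
\<close>

lemma integer_simplex_parametrization:
  fixes T :: "(real ^ 'n) set" and e :: "nat \<Rightarrow> 'n"
  assumes T: "int CARD('n) simplex T" and e: "bij_betw e {..<CARD('n)} UNIV"
    and V: "\<forall>x. {x} face_of T \<longrightarrow> x \<in> integer_lattice"
  obtains v :: "real ^ 'n" and A where "v \<in> integer_lattice" "\<And>i j. A $ i $ j \<in> \<int>" "invertible A"
    "T = (\<lambda>u. v + A *v u) ` chain_region e 0"
proof -
  from T obtain C where C: "finite C" "\<not> affine_dependent C" "int (card C) = int CARD('n) + 1"
    and TC: "T = convex hull C" unfolding simplex by blast
  have CL: "x \<in> integer_lattice" if "x \<in> C" for x
  proof (rule V[rule_format])
    have "x extreme_point_of T"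
      using extreme_point_of_convex_hull_affine_independent[OF C(2)] that by (simp add: TC)
    then show "{x} face_of T" by (simp add: face_of_singleton)
  qed
  obtain c0 where "bij_betw c0 {0..<card C} C" using ex_bij_betw_nat_finite[OF C(1)] by blast
  moreover have "{0..<card C} = {..CARD('n)}" using C(3) by auto
  ultimately have c: "bij_betw c0 {..CARD('n)} C" by simp
  define A :: "real ^ 'n ^ 'n" where
    "A = (\<chi> i j. (c0 (the_inv_into {..<CARD('n)} e j) - c0 (Suc (the_inv_into {..<CARD('n)} e j))) $ i)"
  have cL: "c0 r \<in> integer_lattice" if "r \<le> CARD('n)" for r
    using CL bij_betwE[OF c] that by auto
  have img: "T = (\<lambda>u. c0 (CARD('n)) + A *v u) ` chain_region e 0"
    unfolding TC A_def by (rule simplex_eq_affine_image_chain_region[OF e c])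
  have ei: "the_inv_into {..<CARD('n)} e j < CARD('n)" for j
    using e the_inv_into_into[of e "{..<CARD('n)}" j "{..<CARD('n)}"] by (auto simp: bij_betw_def)
  have "A $ i $ j \<in> \<int>" for i j
    using integer_lattice_diff[OF cL cL, of "the_inv_into {..<CARD('n)} e j" "Suc (the_inv_into {..<CARD('n)} e j)"] ei[of j]
    by (simp add: A_def integer_lattice_def)
  moreover have "invertible A"
  proof -
    have "T \<subseteq> (+) (c0 (CARD('n))) ` range ((*v) A)" unfolding img by auto
    then have "aff_dim T \<le> aff_dim ((+) (c0 (CARD('n))) ` range ((*v) A))" by (rule aff_dim_subset)
    also have "\<dots> = aff_dim (range ((*v) A))" by (rule aff_dim_translation_eq)
    also have sub: "subspace (range ((*v) A))"
      by (intro linear_subspace_image matrix_vector_mul_linear subspace_UNIV)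
    then have "aff_dim (range ((*v) A)) = int (dim (range ((*v) A)))" by (rule aff_dim_subspace)
    finally have "CARD('n) \<le> dim (range ((*v) A))" using aff_dim_simplex[OF T] by simp
    moreover have "dim (range ((*v) A)) \<le> DIM(real ^ 'n)" by (rule dim_subset_UNIV)
    ultimately have "dim (range ((*v) A)) = DIM(real ^ 'n)" by simp
    then have "span (range ((*v) A)) = UNIV" by (simp only: dim_eq_full)
    then have "surj ((*v) A)" using sub by (metis span_eq_iff)
    then show ?thesis
      using matrix_right_invertible_surjective[of A] invertible_right_inverse[of A] by blast
  qed
  ultimately show ?thesis using that cL[of "CARD('n)"] img by blast
qed

section \<open>Dilated lattice polytopes near lattice points\<close>

lemma det_integer:
  fixes A :: "real ^ 'n ^ 'n"
  shows "(\<And>i j. A $ i $ j \<in> \<int>) \<Longrightarrow> det A \<in> \<int>"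
  unfolding det_def by (intro Ints_sum Ints_mult Ints_prod) auto

text \<open>
  Within distance \<open>\<epsilon>\<close> of any lattice point \<open>n\<close>, the dilate \<open>N P\<close> coincides with a cone with apex
  \<open>n\<close>. The point is that the same \<open>\<epsilon>\<close> serves for all \<open>N\<close> and \<open>n\<close>.
\<close>

definition lattice_conic :: "real \<Rightarrow> (real ^ 'n) set \<Rightarrow> bool" where
  "lattice_conic \<epsilon> P \<longleftrightarrow> (\<forall>N > 0. \<forall>n\<in>integer_lattice. \<forall>y t. norm y \<le> \<epsilon> \<longrightarrow> 0 < t \<longrightarrow> t \<le> 1 \<longrightarrow>
     ((n + y) /\<^sub>R real N \<in> P \<longleftrightarrow> (n + t *\<^sub>R y) /\<^sub>R real N \<in> P))"

lemma lattice_conic_mono: "lattice_conic \<epsilon> P \<Longrightarrow> \<delta> \<le> \<epsilon> \<Longrightarrow> lattice_conic \<delta> P"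
  unfolding lattice_conic_def by (meson order_trans)

text \<open>
  Numbers \<open>\<alpha>\<close> in \<open>(1 / Q) \<int>\<close> are either zero or at least \<open>1 / Q\<close> in absolute value, so a
  perturbation by less than \<open>1 / Q\<close> can change the sign of \<open>\<alpha>\<close> only if \<open>\<alpha> = 0\<close>. In that case
  the sign is that of \<open>\<beta>\<close>, which the factor \<open>t > 0\<close> preserves.
\<close>

lemma sign_stable:
  assumes "Q * \<alpha> \<in> \<int>" "\<bar>Q * \<beta>\<bar> < 1" "0 < t" "t \<le> (1::real)" "0 < Q"
  shows "0 \<le> \<alpha> + \<beta> \<longleftrightarrow> 0 \<le> \<alpha> + t * \<beta>"
proof -
  obtain k where k: "Q * \<alpha> = of_int k" using assms(1) by (elim Ints_cases)
  have tb: "\<bar>Q * (t * \<beta>)\<bar> < 1"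
  proof -
    have "\<bar>Q * (t * \<beta>)\<bar> = t * \<bar>Q * \<beta>\<bar>" using assms(3) by (simp add: abs_mult)
    also have "\<dots> \<le> 1 * \<bar>Q * \<beta>\<bar>" using assms(4) by (intro mult_right_mono) auto
    finally show ?thesis using assms(2) by simp
  qed
  have iff: "0 \<le> \<alpha> + b \<longleftrightarrow> 0 \<le> of_int k + Q * b" for b
    using assms(5) by (simp add: k[symmetric] distrib_left[symmetric] zero_le_mult_iff)
  consider "k \<ge> 1" | "k \<le> -1" | "k = 0" by linarith
  then show ?thesis
  proof cases
    case 1
    then have "real_of_int k \<ge> 1" by simp
    then show ?thesis using assms(2) tb unfolding iff by linarith
  next
    case 2
    then have "real_of_int k \<le> -1" by simp
    then show ?thesis using assms(2) tb unfolding iff by linarith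
  next
    case 3
    then show ?thesis using assms unfolding iff by (simp add: zero_le_mult_iff)
  qed
qed

text \<open>
  By Cramer's rule the inverse of \<open>A\<close> maps lattice points to points with coordinates in
  \<open>(1 / Q) \<int>\<close>, where \<open>Q = \<bar>det A\<bar>\<close>. In these coordinates the dilated simplex is given by
  inequalities \<open>0 \<le> \<alpha> + \<beta>\<close> with \<open>\<alpha>\<close> in \<open>(1 / Q) \<int>\<close> and \<open>\<beta>\<close> linear in the displacement from
  the lattice point, to which the stability of signs applies.
\<close>

lemma lattice_conic_affine_image:
  fixes A :: "real ^ 'n ^ 'n"
  assumes v: "v \<in> integer_lattice" and A: "\<And>i j. A $ i $ j \<in> \<int>" and inv: "invertible A"
  shows "\<exists>\<epsilon>>0. lattice_conic \<epsilon> ((\<lambda>u. v + A *v u) ` chain_region e 0)"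
proof -
  from inv obtain B where AB: "A ** B = mat 1" "B ** A = mat 1" by (auto simp: invertible_def)
  have BA: "B *v (A *v u) = u" "A *v (B *v u) = u" for u using AB by (simp_all add: matrix_vector_mul_assoc)
  obtain b where b: "\<And>x. norm (B *v x) \<le> norm x * b" "b > 0"
    using bounded_linear.pos_bounded[OF matrix_vector_mul_bounded_linear[of B]] by blast
  define Q where "Q = \<bar>det A\<bar>"
  have d: "det A \<noteq> 0" using inv invertible_det_nz by blast
  then have Q: "0 < Q" "Q \<in> \<int>" using det_integer[OF A] by (auto simp: Q_def Ints_abs)
  have QB: "Q * (B *v n) $ k \<in> \<int>" if n: "n \<in> integer_lattice" for n k
  proof -
    have "(B *v n) $ k * det A = det (\<chi> i j. if j = k then (A *v (B *v n)) $ i else A $ i $ j)"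
      by (rule cramer_lemma[symmetric])
    also have "\<dots> \<in> \<int>" using n A by (intro det_integer) (auto simp: BA integer_lattice_def)
    finally have *: "(B *v n) $ k * det A \<in> \<int>" .
    show ?thesis
    proof (cases "det A \<ge> 0")
      case True
      then show ?thesis using * by (simp add: Q_def mult.commute)
    next
      case False
      then have "Q * (B *v n) $ k = - ((B *v n) $ k * det A)" by (simp add: Q_def mult.commute)
      then show ?thesis using * by simp
    qed
  qed
  \<comment> \<open>then every coordinate of \<open>B *v y\<close>, and every difference of two of them, is smaller than \<open>1 / Q\<close>\<close>
  define \<epsilon> where "\<epsilon> = 1 / (4 * Q * b)"
  have \<epsilon>: "\<epsilon> > 0" using Q b by (simp add: \<epsilon>_def)
  have mem: "x \<in> (\<lambda>u. v + A *v u) ` chain_region e 0 \<longleftrightarrow> B *v (x - v) \<in> chain_region e 0" for x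
  proof
    assume "B *v (x - v) \<in> chain_region e 0"
    then show "x \<in> (\<lambda>u. v + A *v u) ` chain_region e 0"
      by (rule rev_image_eqI) (simp add: BA)
  qed (auto simp: BA)
  have "lattice_conic \<epsilon> ((\<lambda>u. v + A *v u) ` chain_region e 0)"
    unfolding lattice_conic_def
  proof (intro allI ballI impI)
    fix N :: nat and n y :: "real ^ 'n" and t :: real
    assume N: "N > 0" and n: "n \<in> integer_lattice" and y: "norm y \<le> \<epsilon>" and t: "0 < t" "t \<le> 1"
    define \<alpha> where "\<alpha> = B *v (n - real N *\<^sub>R v)"
    define \<beta> where "\<beta> = B *v y"
    have mem': "(n + z) /\<^sub>R real N \<in> (\<lambda>u. v + A *v u) ` chain_region e 0 \<longleftrightarrow>
       (\<forall>i. 0 \<le> \<alpha> $ i + (B *v z) $ i \<and> 0 \<le> (real N - \<alpha> $ i) + - (B *v z) $ i) \<and>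
       (\<forall>k. Suc k < CARD('n) \<longrightarrow> 0 \<le> (\<alpha> $ e (Suc k) - \<alpha> $ e k) + ((B *v z) $ e (Suc k) - (B *v z) $ e k))" for z
    proof -
      have "(n + z) /\<^sub>R real N - v = (1 / real N) *\<^sub>R ((n - real N *\<^sub>R v) + z)"
        using N by (simp add: algebra_simps divide_inverse)
      then have eq: "B *v ((n + z) /\<^sub>R real N - v) = (1 / real N) *\<^sub>R (\<alpha> + B *v z)"
        by (simp only: matrix_vector_mult_scaleR matrix_vector_right_distrib \<alpha>_def)
      have r: "0 \<le> 1 / real N * a \<longleftrightarrow> 0 \<le> a" "1 / real N * a \<le> 1 \<longleftrightarrow> 0 \<le> real N - a"
        "1 / real N * a \<le> 1 / real N * a' \<longleftrightarrow> 0 \<le> a' - a" for a a'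
        using N by (auto simp: zero_le_mult_iff divide_simps)
      show ?thesis unfolding mem eq
        unfolding chain_region_def mem_Collect_eq vector_scaleR_component real_scaleR_def r
          vector_add_component by (simp add: diff_diff_eq add_diff_add)
    qed
    have \<alpha>: "Q * \<alpha> $ i \<in> \<int>" for i
      unfolding \<alpha>_def by (rule QB) (use integer_lattice_diff[OF n integer_lattice_scale[OF v, of "int N"]] in simp)
    have \<beta>4: "\<bar>Q * \<beta> $ i\<bar> \<le> 1 / 4" for i
    proof -
      have "\<bar>\<beta> $ i\<bar> \<le> norm y * b" using component_le_norm_cart[of \<beta> i] b(1)[of y] by (simp add: \<beta>_def)
      also have "\<dots> \<le> \<epsilon> * b" using y b by (intro mult_right_mono) auto
      finally have "Q * \<bar>\<beta> $ i\<bar> \<le> Q * (\<epsilon> * b)" using Q by (intro mult_left_mono) auto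
      also have "\<dots> = 1 / 4" using Q b by (simp add: \<epsilon>_def)
      finally show ?thesis using Q by (simp add: abs_mult)
    qed
    have \<beta>: "\<bar>Q * \<beta> $ i\<bar> < 1" "\<bar>Q * (\<beta> $ i - \<beta> $ j)\<bar> < 1" for i j
      using \<beta>4[of i] \<beta>4[of j] unfolding right_diff_distrib by linarith+
    have "B *v (t *\<^sub>R y) = t *\<^sub>R \<beta>" by (simp add: \<beta>_def matrix_vector_mult_scaleR)
    then have bt: "(B *v (t *\<^sub>R y)) $ i = t * \<beta> $ i" for i by simp
    have s1: "0 \<le> \<alpha> $ i + \<beta> $ i \<longleftrightarrow> 0 \<le> \<alpha> $ i + t * \<beta> $ i" for i
      by (rule sign_stable[OF \<alpha> \<beta>(1) t Q(1)])
    have s2: "0 \<le> (real N - \<alpha> $ i) + - \<beta> $ i \<longleftrightarrow> 0 \<le> (real N - \<alpha> $ i) + t * (- \<beta> $ i)" for i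
      using \<alpha> \<beta>(1) Q(2) by (intro sign_stable[OF _ _ t Q(1)]) (auto simp: right_diff_distrib)
    have s3: "0 \<le> (\<alpha> $ i - \<alpha> $ j) + (\<beta> $ i - \<beta> $ j) \<longleftrightarrow> 0 \<le> (\<alpha> $ i - \<alpha> $ j) + t * (\<beta> $ i - \<beta> $ j)" for i j
      using \<alpha> by (intro sign_stable[OF _ \<beta>(2) t Q(1)]) (auto simp: right_diff_distrib)
    show "(n + y) /\<^sub>R real N \<in> (\<lambda>u. v + A *v u) ` chain_region e 0 \<longleftrightarrow>
       (n + t *\<^sub>R y) /\<^sub>R real N \<in> (\<lambda>u. v + A *v u) ` chain_region e 0"
      unfolding mem' bt \<beta>_def[symmetric] right_diff_distrib[symmetric] mult_minus_right[symmetric]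
      by (simp only: s1 s2 s3)
  qed
  with \<epsilon> show ?thesis by blast
qed

lemma lattice_conic_Union:
  assumes "finite \<T>" "\<And>T. T \<in> \<T> \<Longrightarrow> \<exists>\<epsilon>>0. lattice_conic \<epsilon> T"
  shows "\<exists>\<epsilon>>0. lattice_conic \<epsilon> (\<Union>\<T>)"
  using assms
proof (induction \<T> rule: finite_induct)
  case empty
  then show ?case by (intro exI[of _ 1]) (simp add: lattice_conic_def)
next
  case (insert T \<T>)
  obtain \<epsilon> \<delta> where "\<epsilon> > 0" "lattice_conic \<epsilon> T" "\<delta> > 0" "lattice_conic \<delta> (\<Union>\<T>)"
    using insert by (metis insert_iff)
  then have "lattice_conic (min \<epsilon> \<delta>) T" "lattice_conic (min \<epsilon> \<delta>) (\<Union>\<T>)" "min \<epsilon> \<delta> > 0"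
    by (auto intro: lattice_conic_mono)
  then show ?case by (intro exI[of _ "min \<epsilon> \<delta>"]) (auto simp: lattice_conic_def)
qed

section \<open>Complexes as unions of simplices of full dimension\<close>

lemma negligible_low_aff_dim:
  fixes S :: "'a::euclidean_space set"
  assumes "convex S" "aff_dim S < DIM('a)"
  shows "negligible S"
  using assms aff_dim_nonempty_interior[of S] negligible_convex_interior[of S] by fastforce

definition full_simplices :: "(real ^ 'n) set set \<Rightarrow> (real ^ 'n) set set" where
  "full_simplices \<C> = {T \<in> \<C>. int CARD('n) simplex T}"

lemma full_simplicesD:
  fixes \<C> :: "(real ^ 'n) set set"
  assumes C: "simplicial_complex \<C>"
  shows "finite (full_simplices \<C>)"
    and "T \<in> full_simplices \<C> \<Longrightarrow> int CARD('n) simplex T"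
    and "T \<in> full_simplices \<C> \<Longrightarrow> complex_vertices \<C> \<subseteq> integer_lattice \<Longrightarrow>
      \<forall>x. {x} face_of T \<longrightarrow> x \<in> integer_lattice"
proof -
  show "finite (full_simplices \<C>)" "T \<in> full_simplices \<C> \<Longrightarrow> int CARD('n) simplex T"
    using C by (auto simp: simplicial_complex_def full_simplices_def)
  assume T: "T \<in> full_simplices \<C>" and V: "complex_vertices \<C> \<subseteq> integer_lattice"
  show "\<forall>x. {x} face_of T \<longrightarrow> x \<in> integer_lattice"
  proof (intro allI impI)
    fix x assume "{x} face_of T"
    then have "{x} \<in> \<C>" using C T unfolding simplicial_complex_def full_simplices_def by blast
    then show "x \<in> integer_lattice" using V by (auto simp: complex_vertices_def)
  qed
qed

lemma Union_full_simplices: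
  fixes \<C> :: "(real ^ 'n) set set"
  assumes C: "homogeneous_complex CARD('n) \<C>"
  shows "\<Union>\<C> = \<Union>(full_simplices \<C>)"
proof
  show "\<Union>\<C> \<subseteq> \<Union>(full_simplices \<C>)"
  proof
    fix x assume "x \<in> \<Union>\<C>"
    then obtain S where S: "S \<in> \<C>" "x \<in> S" by blast
    then obtain n where n: "n simplex S"
      using C unfolding homogeneous_complex_def simplicial_complex_def by blast
    have "n \<le> int CARD('n)" using aff_dim_simplex[OF n] aff_dim_le_DIM[of S] by simp
    show "x \<in> \<Union>(full_simplices \<C>)"
    proof (cases "n = int CARD('n)")
      case True
      then show ?thesis using S n by (auto simp: full_simplices_def)
    next
      case False
      then have "n < int CARD('n)" using \<open>n \<le> int CARD('n)\<close> by simp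
      then obtain T where "T \<in> \<C>" "int CARD('n) simplex T" "S face_of T"
        using C S(1) n unfolding homogeneous_complex_def by blast
      then show ?thesis using S face_of_imp_subset by (fastforce simp: full_simplices_def)
    qed
  qed
qed (auto simp: full_simplices_def)

text \<open>
  Two different simplices of full dimension meet in a common face, which is a proper
  face of at least one of them and hence has smaller dimension.
\<close>

lemma negligible_Int_full_simplices:
  fixes \<C> :: "(real ^ 'n) set set"
  assumes C: "simplicial_complex \<C>" and ST: "S \<in> full_simplices \<C>" "T \<in> full_simplices \<C>" "S \<noteq> T"
  shows "negligible (S \<inter> T)"
proof -
  have s: "int CARD('n) simplex S" "int CARD('n) simplex T" "S \<in> \<C>" "T \<in> \<C>" using ST by (auto simp: full_simplices_def)
  have f: "(S \<inter> T) face_of S" "(S \<inter> T) face_of T"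
    using C s(3,4) unfolding simplicial_complex_def by (blast, metis Int_commute)
  have cv: "convex S" "convex T" using s convex_simplex by auto
  have "aff_dim (S \<inter> T) < int CARD('n)"
  proof (cases "S \<inter> T = S")
    case False
    then show ?thesis using face_of_aff_dim_lt[OF cv(1) f(1)] aff_dim_simplex[OF s(1)] by simp
  next
    case True
    then have "S \<inter> T \<noteq> T" using ST(3) by blast
    then show ?thesis using face_of_aff_dim_lt[OF cv(2) f(2)] aff_dim_simplex[OF s(2)] by simp
  qed
  then show ?thesis by (intro negligible_low_aff_dim convex_Int cv) simp
qed

lemma integral_Union_almost_disjoint:
  fixes G :: "'a::euclidean_space \<Rightarrow> 'b::euclidean_space"
  assumes fin: "finite \<T>" and cl: "\<And>T. T \<in> \<T> \<Longrightarrow> closed T"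
    and neg: "\<And>S T. S \<in> \<T> \<Longrightarrow> T \<in> \<T> \<Longrightarrow> S \<noteq> T \<Longrightarrow> negligible (S \<inter> T)"
    and int: "\<And>T. T \<in> \<T> \<Longrightarrow> set_integrable lborel T G" and [measurable]: "G \<in> borel_measurable borel"
  shows "(LINT x:\<Union>\<T>|lborel. G x) = (\<Sum>T\<in>\<T>. LINT x:T|lborel. G x)"
proof -
  have [measurable]: "T \<in> sets borel" if "T \<in> \<T>" for T using cl[OF that] by simp
  have Um [measurable]: "\<Union>\<T> \<in> sets borel" using fin cl by (intro sets.finite_Union) auto
  define Z where "Z = \<Union>((\<lambda>(S, T). S \<inter> T) ` {(S, T). S \<in> \<T> \<and> T \<in> \<T> \<and> S \<noteq> T})"
  have f: "finite {(S, T). S \<in> \<T> \<and> T \<in> \<T> \<and> S \<noteq> T}"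
    by (rule finite_subset[of _ "\<T> \<times> \<T>"]) (use fin in auto)
  have "negligible Z" unfolding Z_def using f neg by (intro negligible_Union) auto
  moreover have "closed Z" unfolding Z_def using f cl by (intro closed_Union) auto
  ultimately have "Z \<in> null_sets lborel"
    by (simp add: negligible_iff_null_sets null_sets_completion_iff)
  then have AE: "AE x in lborel. x \<notin> Z" by (rule AE_not_in)
  have ind: "indicat_real (\<Union>\<T>) x = (\<Sum>T\<in>\<T>. indicat_real T x)" if "x \<notin> Z" for x
  proof (cases "\<exists>S\<in>\<T>. x \<in> S")
    case True
    then obtain S where S: "S \<in> \<T>" "x \<in> S" by blast
    then have "x \<notin> T" if "T \<in> \<T> - {S}" for T using that \<open>x \<notin> Z\<close> by (auto simp: Z_def)
    then have "(\<Sum>T\<in>\<T>. indicat_real T x) = indicat_real S x"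
      using fin S(1) by (subst sum.remove[of _ S]) auto
    moreover have "x \<in> \<Union>\<T>" using S by blast
    ultimately show ?thesis using S(2) by simp
  qed auto
  have "(LINT x:\<Union>\<T>|lborel. G x) = (LINT x|lborel. (\<Sum>T\<in>\<T>. indicat_real T x *\<^sub>R G x))"
    unfolding set_lebesgue_integral_def
    by (intro integral_cong_AE AE_mp[OF AE AE_I2] borel_measurable_sum borel_measurable_scaleR)
      (auto simp: ind scaleR_sum_left)
  also have "\<dots> = (\<Sum>T\<in>\<T>. LINT x:T|lborel. G x)"
    unfolding set_lebesgue_integral_def using int by (intro Bochner_Integration.integral_sum) (auto simp: set_integrable_def)
  finally show ?thesis .
qed

section \<open>Displacement to the nearest lattice point\<close>

text \<open>
  The displacement from \<open>y\<close> to a nearest lattice point. Ties in the rounding occur only at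
  distance at least \<open>1/2\<close> from the lattice, hence outside the support of
  \<open>near_lattice \<epsilon>\<close> when \<open>\<epsilon> < 1/2\<close>; there the displacement is odd as a function of \<open>y\<close>.
\<close>

definition lattice_offset :: "real ^ 'n \<Rightarrow> real ^ 'n" where
  "lattice_offset y = (\<chi> i. of_int (round (y $ i)) - y $ i)"

definition near_lattice :: "real \<Rightarrow> real ^ 'n \<Rightarrow> real" where
  "near_lattice \<epsilon> y = (if norm (lattice_offset y) \<le> \<epsilon> then 1 else 0)"

lemma lattice_offset_lattice: "y + lattice_offset y \<in> integer_lattice"
  by (simp add: integer_lattice_def lattice_offset_def)

lemma lattice_offset_unique:
  assumes n: "n \<in> integer_lattice" and d: "norm (y - n) < 1 / 2"
  shows "lattice_offset y = n - y"
proof (subst vec_eq_iff, intro allI)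
  fix i
  obtain k where k: "n $ i = of_int k" using n by (auto simp: integer_lattice_def elim: Ints_cases)
  have "\<bar>y $ i - of_int k\<bar> < 1 / 2" using component_le_norm_cart[of "y - n" i] d k by simp
  then have "round (y $ i) = k" by (rule round_unique')
  then show "lattice_offset y $ i = (n - y) $ i" by (simp add: lattice_offset_def k)
qed

lemma lattice_offset_periodic:
  assumes m: "m \<in> integer_lattice"
  shows "lattice_offset (y + m) = lattice_offset y"
proof (subst vec_eq_iff, intro allI)
  fix i
  obtain k where k: "m $ i = of_int k" using m by (auto simp: integer_lattice_def elim: Ints_cases)
  have "round (y $ i + of_int k) = round (y $ i) + k"
    unfolding round_def by (metis add.commute add.left_commute floor_add_int)
  then show "lattice_offset (y + m) $ i = lattice_offset y $ i" by (simp add: lattice_offset_def k)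
qed

lemma lattice_offset_nth_measurable [measurable]:
  "(\<lambda>y :: real ^ 'n. lattice_offset y $ i) \<in> borel_measurable borel"
proof -
  show ?thesis unfolding lattice_offset_def round_def vec_lambda_beta by measurable
qed

lemma lattice_offset_measurable [measurable]:
  "(lattice_offset :: real ^ 'n \<Rightarrow> real ^ 'n) \<in> borel_measurable borel"
  by (subst borel_measurable_euclidean_space) (auto simp: Basis_vec_def inner_axis)

lemma bounded_periodic_lattice_offset: "bounded_periodic (\<lambda>y. lattice_offset y $ i)"
proof -
  have "\<bar>lattice_offset y $ i\<bar> \<le> 1 / 2" for y
    using of_int_round_abs_le[of "y $ i"] by (simp add: lattice_offset_def)
  then have "\<exists>B. \<forall>y. \<bar>lattice_offset y $ i\<bar> \<le> B" by blast
  then show ?thesis unfolding bounded_periodic_def by (simp add: lattice_offset_periodic)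
qed

lemma bounded_periodic_near_lattice: "bounded_periodic (near_lattice \<epsilon>)"
proof -
  have "near_lattice \<epsilon> \<in> borel_measurable borel" unfolding near_lattice_def[abs_def] by measurable
  then show ?thesis unfolding bounded_periodic_def
    by (auto simp: near_lattice_def lattice_offset_periodic intro!: exI[of _ 1])
qed

lemma near_lattice_iff:
  assumes "\<epsilon> < 1 / 2" "n \<in> integer_lattice"
  shows "norm (y - n) \<le> \<epsilon> \<longleftrightarrow> norm (lattice_offset y) \<le> \<epsilon> \<and> n = y + lattice_offset y"
proof
  assume "norm (y - n) \<le> \<epsilon>"
  then show "norm (lattice_offset y) \<le> \<epsilon> \<and> n = y + lattice_offset y"
    using lattice_offset_unique[OF assms(2), of y] assms(1) by (simp add: norm_minus_commute)
qed auto

lemma lattice_offset_minus: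
  assumes "\<epsilon> < 1 / 2" "norm (lattice_offset y) \<le> \<epsilon>"
  shows "lattice_offset (- y) = - lattice_offset y"
proof -
  have "- (y + lattice_offset y) \<in> integer_lattice"
    using lattice_offset_lattice[of y] by (auto simp: integer_lattice_def simp flip: minus_add_distrib)
  from lattice_offset_unique[OF this, of "- y"] show ?thesis using assms by simp
qed

lemma near_lattice_minus:
  fixes y :: "real ^ 'n"
  assumes "\<epsilon> < 1 / 2"
  shows "near_lattice \<epsilon> (- y) = near_lattice \<epsilon> y"
proof -
  have *: "norm (lattice_offset (- y)) \<le> \<epsilon>" if "norm (lattice_offset y) \<le> \<epsilon>" for y :: "real ^ 'n"
    unfolding lattice_offset_minus[OF assms that] using that by simp
  have "norm (lattice_offset (- y)) \<le> \<epsilon> \<longleftrightarrow> norm (lattice_offset y) \<le> \<epsilon>"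
    using *[of y] *[of "- y"] by auto
  then show ?thesis by (simp only: near_lattice_def)
qed

lemma finite_integer_lattice_ball: "finite {n \<in> integer_lattice. norm (n :: real ^ 'n) \<le> M}"
proof -
  let ?S = "real_of_int ` {- \<lceil>M\<rceil>..\<lceil>M\<rceil>}"
  have "{n \<in> integer_lattice. norm (n :: real ^ 'n) \<le> M} \<subseteq> (\<lambda>f. \<chi> i. f i) ` (PiE UNIV (\<lambda>_. ?S))"
  proof
    fix n :: "real ^ 'n" assume n: "n \<in> {n \<in> integer_lattice. norm n \<le> M}"
    have "n $ i \<in> ?S" for i
    proof -
      obtain k where k: "n $ i = of_int k" using n by (auto simp: integer_lattice_def elim: Ints_cases)
      have "\<bar>of_int k\<bar> \<le> M" using component_le_norm_cart[of n i] n k by auto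
      then have "k \<in> {- \<lceil>M\<rceil>..\<lceil>M\<rceil>}" by (auto simp: abs_le_iff) linarith+
      then show ?thesis unfolding k by blast
    qed
    then show "n \<in> (\<lambda>f. \<chi> i. f i) ` (PiE UNIV (\<lambda>_. ?S))"
      by (intro image_eqI[of _ _ "\<lambda>i. n $ i"]) (auto simp: vec_eq_iff)
  qed
  then show ?thesis by (rule finite_subset) (auto intro!: finite_imageI finite_PiE)
qed

section \<open>Solid angles at lattice points\<close>

lemma integral_scaling:
  fixes F :: "'a::euclidean_space \<Rightarrow> 'b::euclidean_space"
  assumes [measurable]: "F \<in> borel_measurable borel" and c: "c \<noteq> 0"
  shows "(LINT x|lborel. F x) = \<bar>c\<bar> ^ DIM('a) *\<^sub>R (LINT y|lborel. F (t + c *\<^sub>R y))"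
  by (subst lborel_affine[OF c, of t]) (simp add: integral_density integral_distr)

lemma solid_angle_eventually:
  fixes P :: "'a::euclidean_space set"
  assumes ev: "\<forall>\<^sub>F \<delta> in at_right 0. \<forall>y. norm y \<le> 1 \<longrightarrow> indicat_real P (x - \<delta> *\<^sub>R y) = \<phi> y"
  shows "solid_angle P x = 1 / measure lborel (cball (0::'a) 1) * (LINT y:cball 0 1|lborel. \<phi> y)"
  unfolding solid_angle_def
proof (rule tendsto_Lim[OF _ tendsto_eventually])
  show "\<forall>\<^sub>F \<delta> in at_right 0. 1 / measure lborel (cball (0::'a) 1) * (LINT y:cball 0 1|lborel. indicat_real P (x - \<delta> *\<^sub>R y)) =
     1 / measure lborel (cball (0::'a) 1) * (LINT y:cball 0 1|lborel. \<phi> y)"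
    using ev
  proof eventually_elim
    case (elim \<delta>)
    have "(LINT y:cball 0 1|lborel. indicat_real P (x - \<delta> *\<^sub>R y)) = (LINT y:cball 0 1|lborel. \<phi> y)"
      using elim unfolding set_lebesgue_integral_def
      by (intro Bochner_Integration.integral_cong) (auto simp: indicator_def)
    then show ?case by simp
  qed
qed simp

text \<open>
  By conicity the average over small balls does not depend on their radius as long
  as it is at most \<open>\<epsilon> / N\<close>, so that the limit is attained at the radius \<open>\<epsilon> / N\<close>.
\<close>

lemma solid_angle_lattice_point:
  fixes P :: "(real ^ 'n) set"
  assumes P: "lattice_conic \<epsilon> P" and \<epsilon>: "\<epsilon> > 0" and N: "N > 0" and n: "n \<in> integer_lattice"
  shows "solid_angle P (n /\<^sub>R real N) = 1 / measure lborel (cball (0 :: real ^ 'n) 1) *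
    (LINT y:cball 0 1|lborel. indicat_real P ((n - \<epsilon> *\<^sub>R y) /\<^sub>R real N))"
proof (rule solid_angle_eventually)
  have "\<forall>\<^sub>F \<delta> in at_right 0. \<delta> \<in> {0<..<\<epsilon> / real N}"
    using \<epsilon> N by (intro eventually_at_right_real) simp
  then show "\<forall>\<^sub>F \<delta> in at_right 0. \<forall>y. norm y \<le> 1 \<longrightarrow>
    indicat_real P (n /\<^sub>R real N - \<delta> *\<^sub>R y) = indicat_real P ((n - \<epsilon> *\<^sub>R y) /\<^sub>R real N)"
  proof eventually_elim
    case (elim \<delta>)
    show ?case
    proof (intro allI impI)
      fix y :: "real ^ 'n" assume y: "norm y \<le> 1"
      \<comment> \<open>the ratio of the radii \<open>\<delta>\<close> and \<open>\<epsilon> / N\<close>\<close>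
    define t where "t = real N * \<delta> / \<epsilon>"
      have t: "0 < t" "t \<le> 1" using elim \<epsilon> N by (auto simp: t_def field_simps)
      have ny: "norm (- (\<epsilon> *\<^sub>R y)) \<le> \<epsilon>" using y \<epsilon> by simp
      have "n /\<^sub>R real N - \<delta> *\<^sub>R y = (n + t *\<^sub>R - (\<epsilon> *\<^sub>R y)) /\<^sub>R real N"
        using \<epsilon> N by (simp add: t_def scaleR_diff_right)
      moreover have "(n + - (\<epsilon> *\<^sub>R y)) /\<^sub>R real N \<in> P \<longleftrightarrow> (n + t *\<^sub>R - (\<epsilon> *\<^sub>R y)) /\<^sub>R real N \<in> P"
        using P N n ny t unfolding lattice_conic_def by blast
      ultimately show "indicat_real P (n /\<^sub>R real N - \<delta> *\<^sub>R y) = indicat_real P ((n - \<epsilon> *\<^sub>R y) /\<^sub>R real N)"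
        by (simp add: indicator_def)
    qed
  qed
qed

lemma solid_angle_locally_constant:
  fixes P :: "'a::euclidean_space set"
  assumes r: "r > 0" and c: "\<And>y. y \<in> ball x r \<Longrightarrow> indicat_real P y = c"
  shows "solid_angle P x = c"
proof -
  have "\<forall>\<^sub>F \<delta> in at_right 0. 0 < \<delta> \<and> \<delta> < r"
    using r by (auto simp: eventually_at_right_field)
  then have "\<forall>\<^sub>F \<delta> in at_right 0. \<forall>y. norm y \<le> 1 \<longrightarrow> indicat_real P (x - \<delta> *\<^sub>R y) = c"
  proof eventually_elim
    case (elim \<delta>)
    have "x - \<delta> *\<^sub>R y \<in> ball x r" if "norm y \<le> 1" for y
    proof -
      have \<delta>: "0 < \<delta>" "\<delta> < r" using elim by auto
      have "\<delta> * norm y \<le> \<delta>" using mult_left_mono[OF that, of \<delta>] \<delta> by simp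
      then have "\<delta> * norm y < r" using \<delta>(2) by (rule le_less_trans)
      then show ?thesis using \<delta> by (simp add: dist_norm)
    qed
    then show ?case using c by blast
  qed
  from solid_angle_eventually[OF this]
  show ?thesis using content_cball_pos[of 1 "0 :: 'a"] by (simp add: set_lebesgue_integral_def)
qed

lemma solid_angle_interior:
  fixes P :: "'a::euclidean_space set"
  assumes "x \<in> interior P"
  shows "solid_angle P x = 1"
proof -
  obtain r where r: "r > 0" "ball x r \<subseteq> P" using assms by (auto simp: mem_interior)
  then have "indicat_real P y = 1" if "y \<in> ball x r" for y using that by auto
  with r(1) show ?thesis by (rule solid_angle_locally_constant)
qed

lemma solid_angle_outside:
  fixes P :: "'a::euclidean_space set"
  assumes P: "closed P" and x: "x \<notin> P"
  shows "solid_angle P x = 0"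
proof -
  have "open (- P)" "x \<in> - P" using P x by auto
  then obtain r where r: "r > 0" "ball x r \<subseteq> - P" by (meson open_contains_ball)
  then have "indicat_real P y = 0" if "y \<in> ball x r" for y using that by auto
  with r(1) show ?thesis by (rule solid_angle_locally_constant)
qed

lemma solid_angle_lattice_point_le_1:
  fixes P :: "(real ^ 'n) set"
  assumes P: "lattice_conic \<epsilon> P" and \<epsilon>: "\<epsilon> > 0" and N: "N > 0" and n: "n \<in> integer_lattice"
    and [measurable]: "P \<in> sets borel"
  shows "\<bar>solid_angle P (n /\<^sub>R real N)\<bar> \<le> 1"
proof -
  let ?B = "cball (0 :: real ^ 'n) 1"
  have W: "measure lborel ?B > 0" by (rule content_cball_pos) simp
  have fin: "emeasure lborel ?B < \<infinity>" by (rule emeasure_bounded_finite) simp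
  let ?g = "\<lambda>y. indicat_real P ((n - \<epsilon> *\<^sub>R y) /\<^sub>R real N)"
  have i: "set_integrable lborel ?B h" if "h \<in> borel_measurable borel" "\<And>y. \<bar>h y\<bar> \<le> 1" for h :: "real ^ 'n \<Rightarrow> real"
    unfolding set_integrable_def using fin that
    by (intro integrableI_bounded_set_indicator[where B = 1]) auto
  have "(\<lambda>y. (n - \<epsilon> *\<^sub>R y) /\<^sub>R real N) \<in> borel_measurable borel"
    by (intro borel_measurable_continuous_onI continuous_intros)
  from measurable_compose[OF this borel_measurable_indicator, of P]
  have "?g \<in> borel_measurable borel" by simp
  then have gi: "set_integrable lborel ?B ?g" by (rule i) (simp add: indicator_def)
  have "norm (LINT y:?B|lborel. ?g y) \<le> (LINT y:?B|lborel. norm (?g y))"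
    by (rule set_integral_norm_bound[OF gi])
  also have "\<dots> \<le> (LINT y:?B|lborel. 1)"
    by (rule set_integral_mono[OF set_integrable_norm[OF gi] i]) (auto simp: indicator_def)
  also have "\<dots> = measure lborel ?B" by (simp add: set_lebesgue_integral_def)
  finally show ?thesis
    unfolding solid_angle_lattice_point[OF P \<epsilon> N n] using W by (simp add: abs_mult)
qed

section \<open>The lattice sum as an integral\<close>

definition mollified_integrand :: "real \<Rightarrow> (real ^ 'n \<Rightarrow> 'b) \<Rightarrow> int \<Rightarrow> real ^ 'n \<Rightarrow> 'b::euclidean_space" where
  "mollified_integrand \<epsilon> f N x =
    near_lattice \<epsilon> (of_int N *\<^sub>R x) *\<^sub>R f (x + (1 / of_int N) *\<^sub>R lattice_offset (of_int N *\<^sub>R x))"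

text \<open>
  The formula for the lattice sum as an integral over \<open>P\<close>. For positive \<open>N\<close> it yields the lattice
  sum if \<open>P\<close> is conic within distance \<open>\<epsilon> < 1/2\<close> of the lattice points, but it makes sense for
  every nonzero integer \<open>N\<close>. The factor in front is the reciprocal volume of the ball of
  radius \<open>\<epsilon>\<close>.
\<close>

definition mollified_sum :: "real \<Rightarrow> (real ^ 'n \<Rightarrow> 'b) \<Rightarrow> (real ^ 'n) set \<Rightarrow> int \<Rightarrow> 'b::euclidean_space" where
  "mollified_sum \<epsilon> f P N = (1 / (measure lborel (cball (0 :: real ^ 'n) 1) * \<epsilon> ^ CARD('n))) *\<^sub>R
    (LINT x:P|lborel. mollified_integrand \<epsilon> f N x)"

text \<open>
  At distance less than \<open>1/2\<close> from the lattice, \<open>lattice_offset (- y) / (- N) = lattice_offset y / N\<close>.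
\<close>

lemma mollified_sum_minus:
  assumes "\<epsilon> < 1 / 2"
  shows "mollified_sum \<epsilon> f P (- N) = mollified_sum \<epsilon> f P N"
proof -
  have "mollified_integrand \<epsilon> f (- N) x = mollified_integrand \<epsilon> f N x" for x
  proof -
    define y where "y = real_of_int N *\<^sub>R x"
    have y: "real_of_int (- N) *\<^sub>R x = - y" by (simp add: y_def)
    show ?thesis
    proof (cases "norm (lattice_offset y) \<le> \<epsilon>")
      case True
      show ?thesis
        unfolding mollified_integrand_def y y_def[symmetric]
          near_lattice_minus[OF assms] lattice_offset_minus[OF assms True] by simp
    next
      case False
      then have "near_lattice \<epsilon> y = 0" by (simp add: near_lattice_def)
      then show ?thesis
        unfolding mollified_integrand_def y y_def[symmetric] near_lattice_minus[OF assms] by simp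
    qed
  qed
  then have eq: "mollified_integrand \<epsilon> f (- N) = mollified_integrand \<epsilon> f N" by (rule ext)
  show ?thesis unfolding mollified_sum_def eq ..
qed

lemma lattice_sum_eq_finite_sum:
  fixes f :: "real ^ 'n \<Rightarrow> 'b::{real_normed_field, euclidean_space}" and P :: "(real ^ 'n) set"
  assumes cl: "closed P" and R: "\<forall>x\<in>P. norm x \<le> R" and N: "N > 0"
  shows "lattice_sum N f P = (1 / real N ^ CARD('n)) *\<^sub>R
    (\<Sum>n\<in>{n \<in> integer_lattice. norm n \<le> real N * (R + 1)}. solid_angle P (n /\<^sub>R real N) *\<^sub>R f (n /\<^sub>R real N))"
proof -
  let ?L = "{n \<in> integer_lattice. norm (n :: real ^ 'n) \<le> real N * (R + 1)}"
  have "(\<Sum>\<^sub>\<infinity>n\<in>integer_lattice. solid_angle P (n /\<^sub>R real N) *\<^sub>R f (n /\<^sub>R real N))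
    = (\<Sum>\<^sub>\<infinity>n\<in>?L. solid_angle P (n /\<^sub>R real N) *\<^sub>R f (n /\<^sub>R real N))"
  proof (rule infsum_cong_neutral)
    fix n assume "n \<in> integer_lattice - ?L"
    then have "real N * (R + 1) < norm n" by auto
    then have "R + 1 < norm n / real N" using N by (simp add: pos_less_divide_eq mult.commute)
    then have "R + 1 < norm (n /\<^sub>R real N)" by (simp add: divide_inverse mult.commute)
    then have "\<not> norm (n /\<^sub>R real N) \<le> R" by linarith
    then have "n /\<^sub>R real N \<notin> P" using R by blast
    then show "solid_angle P (n /\<^sub>R real N) *\<^sub>R f (n /\<^sub>R real N) = 0"
      using solid_angle_outside[OF cl] by simp
  qed auto
  also have "\<dots> = (\<Sum>n\<in>?L. solid_angle P (n /\<^sub>R real N) *\<^sub>R f (n /\<^sub>R real N))"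
    by (rule infsum_finite[OF finite_integer_lattice_ball])
  finally have eq: "(\<Sum>\<^sub>\<infinity>n\<in>integer_lattice. solid_angle P (n /\<^sub>R real N) *\<^sub>R f (n /\<^sub>R real N)) = \<dots>" .
  have "(1 / of_nat N ^ CARD('n)) * z = (1 / real N ^ CARD('n)) *\<^sub>R z" for z :: 'b
    by (simp add: scaleR_conv_of_real)
  then show ?thesis unfolding lattice_sum_def eq .
qed

text \<open>
  The solid angle at \<open>n / N\<close> is the proportion of the ball of radius \<open>\<epsilon> / N\<close> around \<open>n / N\<close>
  that lies in \<open>P\<close>. Exchanging the sum over \<open>n\<close> with the integral over \<open>P\<close>, a point \<open>x\<close> lies
  in at most one of these balls, as \<open>\<epsilon> < 1/2\<close>, and then \<open>n\<close> is the lattice point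
  nearest to \<open>N x\<close>.
\<close>

lemma lattice_sum_eq_mollified_sum:
  fixes f :: "real ^ 'n \<Rightarrow> 'b::{real_normed_field, euclidean_space}" and P :: "(real ^ 'n) set"
  assumes P: "lattice_conic \<epsilon> P" and \<epsilon>: "0 < \<epsilon>" "\<epsilon> < 1 / 2" and N: "N > 0"
    and cl: "closed P" and R: "\<forall>x\<in>P. norm x \<le> R"
  shows "lattice_sum N f P = mollified_sum \<epsilon> f P (int N)"
proof -
  let ?L = "{n \<in> integer_lattice. norm (n :: real ^ 'n) \<le> real N * (R + 1)}"
  let ?W = "measure lborel (cball (0 :: real ^ 'n) 1)"
  define \<kappa> where "\<kappa> = 1 / (?W * \<epsilon> ^ CARD('n))"
  define g where "g n x = indicat_real P x * (if norm (real N *\<^sub>R x - n) \<le> \<epsilon> then 1 else 0)" for n x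
  have [measurable]: "P \<in> sets borel" using cl by simp
  have gm [measurable]: "g n \<in> borel_measurable borel" for n unfolding g_def by measurable
  have gi: "integrable lborel (g n)" for n
    using R by (intro bounded_supported_integrable bounded_supportedI[where K = 1 and R = R])
      (auto simp: g_def indicator_def split: if_splits)
  have J: "1 / real N ^ CARD('n) * solid_angle P (n /\<^sub>R real N) = \<kappa> * (LINT x|lborel. g n x)"
    if n: "n \<in> integer_lattice" for n
  proof -
    let ?c = "- (\<epsilon> / real N)"
    have c: "?c \<noteq> 0" using \<epsilon> N by simp
    have "(LINT x|lborel. g n x) = \<bar>?c\<bar> ^ DIM(real ^ 'n) *\<^sub>R (LINT y|lborel. g n (n /\<^sub>R real N + ?c *\<^sub>R y))"
      by (rule integral_scaling[OF gm c])
    also have "(\<lambda>y. g n (n /\<^sub>R real N + ?c *\<^sub>R y)) = (\<lambda>y. indicator (cball 0 1) y *\<^sub>R indicat_real P ((n - \<epsilon> *\<^sub>R y) /\<^sub>R real N))"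
    proof
      fix y
      have "n /\<^sub>R real N + ?c *\<^sub>R y = (n - \<epsilon> *\<^sub>R y) /\<^sub>R real N"
        by (simp add: scaleR_diff_right divide_inverse mult.commute)
      moreover have "real N *\<^sub>R ((n - \<epsilon> *\<^sub>R y) /\<^sub>R real N) - n = - (\<epsilon> *\<^sub>R y)" using N by simp
      ultimately show "g n (n /\<^sub>R real N + ?c *\<^sub>R y) = indicator (cball 0 1) y *\<^sub>R indicat_real P ((n - \<epsilon> *\<^sub>R y) /\<^sub>R real N)"
        using \<epsilon> by (simp add: g_def indicator_def)
    qed
    finally have "(LINT x|lborel. g n x) = (\<epsilon> / real N) ^ CARD('n) *
        (LINT y:cball 0 1|lborel. indicat_real P ((n - \<epsilon> *\<^sub>R y) /\<^sub>R real N))"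
      using \<epsilon> by (simp add: set_lebesgue_integral_def)
    then show ?thesis
      unfolding solid_angle_lattice_point[OF P \<epsilon>(1) N n] \<kappa>_def using \<epsilon> N by (simp add: power_divide)
  qed
  have "lattice_sum N f P = (\<Sum>n\<in>?L. (1 / real N ^ CARD('n) * solid_angle P (n /\<^sub>R real N)) *\<^sub>R f (n /\<^sub>R real N))"
    by (simp only: lattice_sum_eq_finite_sum[OF cl R N] scaleR_sum_right scaleR_scaleR)
  also have "\<dots> = (\<Sum>n\<in>?L. \<kappa> *\<^sub>R (LINT x|lborel. g n x *\<^sub>R f (n /\<^sub>R real N)))"
    using gi by (intro sum.cong refl) (auto simp only: mem_Collect_eq J scaleR_scaleR[symmetric] integral_scaleR_left)
  also have "\<dots> = \<kappa> *\<^sub>R (LINT x|lborel. (\<Sum>n\<in>?L. g n x *\<^sub>R f (n /\<^sub>R real N)))"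
    using gi by (subst Bochner_Integration.integral_sum) (auto simp: scaleR_sum_right)
  also have "(\<lambda>x. (\<Sum>n\<in>?L. g n x *\<^sub>R f (n /\<^sub>R real N))) = (\<lambda>x. indicator P x *\<^sub>R mollified_integrand \<epsilon> f (int N) x)"
  proof
    fix x :: "real ^ 'n"
    let ?y = "real N *\<^sub>R x"
    let ?n = "?y + lattice_offset ?y"
    show "(\<Sum>n\<in>?L. g n x *\<^sub>R f (n /\<^sub>R real N)) = indicator P x *\<^sub>R mollified_integrand \<epsilon> f (int N) x"
    proof (cases "x \<in> P \<and> norm (lattice_offset ?y) \<le> \<epsilon>")
      case True
      have "norm ?n \<le> real N * R + \<epsilon>"
        using True mult_left_mono[OF R[rule_format, of x], of "real N"] by (intro norm_triangle_mono) auto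
      also have "\<dots> \<le> real N * (R + 1)"
      proof -
        have "1 \<le> real N" using N by simp
        then show ?thesis using \<epsilon>(2) by (simp add: distrib_left)
      qed
      finally have nL: "?n \<in> ?L" using lattice_offset_lattice by auto
      have "g n x *\<^sub>R f (n /\<^sub>R real N) = (if n = ?n then f (?n /\<^sub>R real N) else 0)" if "n \<in> ?L" for n
        using near_lattice_iff[OF \<epsilon>(2), of n ?y] that True by (auto simp: g_def)
      then have "(\<Sum>n\<in>?L. g n x *\<^sub>R f (n /\<^sub>R real N)) = (\<Sum>n\<in>?L. if n = ?n then f (?n /\<^sub>R real N) else 0)"
        by (rule sum.cong[OF refl])
      also have "\<dots> = f (?n /\<^sub>R real N)"
        using nL by (subst sum.delta[OF finite_integer_lattice_ball]) simp
      also have "?n /\<^sub>R real N = x + (1 / real N) *\<^sub>R lattice_offset ?y"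
        using N by (simp add: scaleR_add_right divide_inverse)
      finally show ?thesis using True by (simp add: mollified_integrand_def near_lattice_def)
    next
      case False
      have "g n x = 0" if "n \<in> ?L" for n
        using near_lattice_iff[OF \<epsilon>(2), of n ?y] that False by (auto simp: g_def)
      then have "(\<Sum>n\<in>?L. g n x *\<^sub>R f (n /\<^sub>R real N)) = 0" by (intro sum.neutral) simp
      then show ?thesis using False by (auto simp: mollified_integrand_def near_lattice_def)
    qed
  qed
  finally show ?thesis by (simp add: mollified_sum_def \<kappa>_def set_lebesgue_integral_def)
qed

section \<open>Convergence to the integral\<close>

lemma measure_floor_cube:
  fixes n :: "real ^ 'n"
  assumes N: "N > (0::nat)" and n: "n \<in> integer_lattice"
  shows "(LINT x|lborel. indicat_real {x :: real ^ 'n. \<forall>i. of_int \<lfloor>real N * x $ i\<rfloor> = n $ i} x) = 1 / real N ^ CARD('n)"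
proof -
  let ?S = "{x :: real ^ 'n. \<forall>i. of_int \<lfloor>real N * x $ i\<rfloor> = n $ i}"
  let ?Q = "{y :: real ^ 'n. \<forall>i. 0 \<le> y $ i \<and> y $ i < 1}"
  have [measurable]: "?S \<in> sets borel" by measurable
  have Qm: "?Q \<in> sets borel" by measurable
  have "(LINT x|lborel. indicat_real ?S x) = \<bar>1 / real N\<bar> ^ DIM(real ^ 'n) *\<^sub>R
      (LINT y|lborel. indicat_real ?S (n /\<^sub>R real N + (1 / real N) *\<^sub>R y))"
    using N by (intro integral_scaling) auto
  also have "(\<lambda>y. indicat_real ?S (n /\<^sub>R real N + (1 / real N) *\<^sub>R y)) = indicat_real ?Q"
  proof
    fix y :: "real ^ 'n"
    have "of_int \<lfloor>real N * (n /\<^sub>R real N + (1 / real N) *\<^sub>R y) $ i\<rfloor> = n $ i \<longleftrightarrow> 0 \<le> y $ i \<and> y $ i < 1" for i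
    proof -
      obtain k where k: "n $ i = of_int k" using n by (auto simp: integer_lattice_def elim: Ints_cases)
      have "real N * (n /\<^sub>R real N + (1 / real N) *\<^sub>R y) $ i = of_int k + y $ i"
        using N k by (simp add: distrib_left)
      then show ?thesis unfolding k by (simp add: floor_eq_iff)
    qed
    then show "indicat_real ?S (n /\<^sub>R real N + (1 / real N) *\<^sub>R y) = indicat_real ?Q y"
      unfolding indicator_def by simp
  qed
  also have "(LINT y|lborel. indicat_real ?Q y) = measure lborel ?Q" using Qm by simp
  also have "measure lborel ?Q = 1"
  proof (rule antisym)
    let ?c = "cbox 0 (\<chi> i. 1) :: (real ^ 'n) set" and ?b = "box 0 (\<chi> i. 1) :: (real ^ 'n) set"
    have c1: "measure lborel ?c = 1" by (subst content_cbox_cart) (auto simp: interval_eq_empty_cart)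
    have cfin: "emeasure lborel ?c < \<infinity>" by (rule emeasure_bounded_finite) simp
    have Qc: "?Q \<subseteq> ?c" by (auto simp: mem_box_cart less_imp_le)
    have bQ: "?b \<subseteq> ?Q" by (auto simp: mem_box_cart less_imp_le)
    have cf: "?c \<in> fmeasurable lborel" using cfin by (intro fmeasurableI) auto
    have Qf: "?Q \<in> fmeasurable lborel" by (rule fmeasurableI2[OF cf Qc]) (use Qm in simp)
    show "measure lborel ?Q \<le> 1" using measure_mono_fmeasurable[OF Qc _ cf] Qm c1 by simp
    have "measure lborel ?b = measure lborel ?c"
      by (simp only: measure_def emeasure_lborel_box_eq emeasure_lborel_cbox_eq)
    then show "1 \<le> measure lborel ?Q" using measure_mono_fmeasurable[OF bQ _ Qf] c1 by simp
  qed
  finally show ?thesis by (simp add: power_one_over)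
qed

text \<open>
  The lattice sum is the integral of the step function \<open>h\<^sub>N\<close> that takes on each cube of side
  \<open>1 / N\<close> the value of \<open>\<omega>\<^sub>P f\<close> at the lower corner \<open>z\<^sub>N x\<close> of the cube. Off the boundary of \<open>P\<close>, a
  null set, these functions converge to \<open>f\<close> restricted to \<open>P\<close>, and they are dominated by a
  constant on a fixed ball.
\<close>

lemma lattice_sum_tendsto_integral:
  fixes f :: "real ^ 'n \<Rightarrow> 'b::{real_normed_field, euclidean_space}" and P :: "(real ^ 'n) set"
  assumes P: "lattice_conic \<epsilon> P" and \<epsilon>: "\<epsilon> > 0" and cl: "closed P" and R: "\<forall>x\<in>P. norm x \<le> R"
    and fr: "negligible (frontier P)" and f: "continuous_on UNIV f"
  shows "(\<lambda>N. lattice_sum (Suc N) f P) \<longlonglongrightarrow> (LINT x:P|lborel. f x)"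
proof -
  have Pm [measurable]: "P \<in> sets borel" using cl by simp
  have [measurable]: "f \<in> borel_measurable borel" using f by (rule borel_measurable_continuous_onI)
  define L where "L N = {n \<in> integer_lattice. norm (n :: real ^ 'n) \<le> real (Suc N) * (R + 1)}" for N
  have Lfin: "finite (L N)" for N unfolding L_def by (rule finite_integer_lattice_ball)
  define Q where "Q N n = {x :: real ^ 'n. \<forall>i. of_int \<lfloor>real (Suc N) * x $ i\<rfloor> = n $ i}" for N and n :: "real ^ 'n"
  have Qm [measurable]: "Q N n \<in> sets borel" for N n unfolding Q_def by measurable
  \<comment> \<open>the lower corner of the cube of side \<open>1 / (N + 1)\<close> that contains \<open>x\<close>\<close>
  define z where "z N x = (\<chi> i. of_int \<lfloor>real (Suc N) * x $ i\<rfloor> / real (Suc N))" for N and x :: "real ^ 'n"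
  define a where "a x = solid_angle P x *\<^sub>R f x" for x
  define h where "h N x = (\<Sum>n\<in>L N. indicat_real (Q N n) x *\<^sub>R a (n /\<^sub>R real (Suc N)))" for N x
  have hz: "h N x = (if norm (z N x) \<le> R + 1 then a (z N x) else 0)" for N x
  proof -
    define m where "m = real (Suc N) *\<^sub>R z N x"
    have mi: "m $ i = of_int \<lfloor>real (Suc N) * x $ i\<rfloor>" for i by (simp add: m_def z_def)
    have mL: "m \<in> integer_lattice" by (simp add: integer_lattice_def mi)
    have "x \<in> Q N n \<longleftrightarrow> n = m" for n by (auto simp: Q_def vec_eq_iff mi)
    then have "h N x = (\<Sum>n\<in>L N. if n = m then a (m /\<^sub>R real (Suc N)) else 0)"
      unfolding h_def by (intro sum.cong) (auto simp: indicator_def)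
    also have "\<dots> = (if m \<in> L N then a (m /\<^sub>R real (Suc N)) else 0)"
      using Lfin by (simp add: sum.delta)
    also have "m /\<^sub>R real (Suc N) = z N x" by (simp add: m_def)
    also have "m \<in> L N \<longleftrightarrow> norm (z N x) \<le> R + 1" using mL by (simp add: L_def m_def)
    finally show ?thesis .
  qed
  have zx: "norm (z N x - x) \<le> real CARD('n) / real (Suc N)" for N x
  proof -
    have "norm (z N x - x) \<le> (\<Sum>i\<in>UNIV. \<bar>(z N x - x) $ i\<bar>)" by (rule norm_le_l1_cart)
    also have "\<dots> \<le> (\<Sum>i\<in>(UNIV :: 'n set). 1 / real (Suc N))"
    proof (rule sum_mono)
      fix i
      have "(z N x - x) $ i = (of_int \<lfloor>real (Suc N) * x $ i\<rfloor> - real (Suc N) * x $ i) / real (Suc N)"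
        by (simp add: z_def diff_divide_distrib del: of_nat_Suc)
      then have "\<bar>(z N x - x) $ i\<bar> = \<bar>of_int \<lfloor>real (Suc N) * x $ i\<rfloor> - real (Suc N) * x $ i\<bar> / real (Suc N)"
        by (simp add: abs_divide)
      also have "\<dots> \<le> 1 / real (Suc N)"
        by (intro divide_right_mono) linarith+
      finally show "\<bar>(z N x - x) $ i\<bar> \<le> 1 / real (Suc N)" .
    qed
    finally show ?thesis by simp
  qed
  have zlim: "(\<lambda>N. z N x) \<longlonglongrightarrow> x" for x
  proof -
    have "(\<lambda>N. real CARD('n) / real (Suc N)) \<longlonglongrightarrow> 0"
      using LIMSEQ_inverse_real_of_nat tendsto_mult_right_zero[of "\<lambda>N. inverse (real (Suc N))" sequentially "real CARD('n)"]
      by (simp add: divide_inverse)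
    then have "(\<lambda>N. z N x - x) \<longlonglongrightarrow> 0" by (rule Lim_null_comparison[OF always_eventually[OF allI[OF zx]]])
    then show ?thesis by (simp add: LIM_zero_iff)
  qed
  have "compact (f ` cball 0 (R + 1))"
    using f by (intro compact_continuous_image) (auto elim: continuous_on_subset)
  then have "bounded (f ` cball 0 (R + 1))" by (rule compact_imp_bounded)
  then obtain B where B: "\<forall>x\<in>cball 0 (R + 1). norm (f x) \<le> B" by (auto simp: bounded_iff)
  define B' where "B' = \<bar>B\<bar>"
  have hB: "norm (h N x) \<le> indicator (cball 0 (R + 1 + CARD('n))) x *\<^sub>R B'" for N x
  proof (cases "norm (z N x) \<le> R + 1")
    case True
    have "real (Suc N) *\<^sub>R z N x \<in> integer_lattice" by (simp add: integer_lattice_def z_def)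
    from solid_angle_lattice_point_le_1[OF P \<epsilon> zero_less_Suc this Pm, of N]
    have "\<bar>solid_angle P (z N x)\<bar> \<le> 1" by simp
    moreover have "norm (f (z N x)) \<le> B'" using B True by (force simp: B'_def)
    ultimately have "norm (a (z N x)) \<le> 1 * B'"
      unfolding a_def norm_scaleR by (intro mult_mono) auto
    moreover have "norm x \<le> R + 1 + CARD('n)"
    proof -
      have "real CARD('n) / real (Suc N) \<le> real CARD('n)" by (simp add: divide_le_eq)
      then have "norm (z N x - x) \<le> real CARD('n)" using zx[of N x] by linarith
      then show ?thesis using norm_triangle_ineq4[of "z N x" "z N x - x"] True by simp
    qed
    ultimately show ?thesis using True by (simp add: hz)
  next
    case False
    then show ?thesis by (simp add: hz B'_def)
  qed
  have lim: "(\<lambda>N. h N x) \<longlonglongrightarrow> indicator P x *\<^sub>R f x" if "x \<notin> frontier P" for x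
  proof (cases "x \<in> P")
    case True
    then have "x \<in> interior P" using that cl by (simp add: frontier_def closure_closed)
    then have ev: "\<forall>\<^sub>F N in sequentially. z N x \<in> interior P"
      using zlim[of x] by (intro topological_tendstoD) auto
    have "(\<lambda>N. f (z N x)) \<longlonglongrightarrow> f x"
      using f zlim by (intro continuous_on_tendsto_compose[OF f]) auto
    moreover have "\<forall>\<^sub>F N in sequentially. f (z N x) = h N x"
      using ev
    proof eventually_elim
      case (elim N)
      then have "z N x \<in> P" using interior_subset by blast
      from R[rule_format, OF this] show ?case using elim by (simp add: hz a_def solid_angle_interior)
    qed
    ultimately have "(\<lambda>N. h N x) \<longlonglongrightarrow> f x" by (rule Lim_transform_eventually)
    then show ?thesis using True by simp
  next
    case False
    then have ev: "\<forall>\<^sub>F N in sequentially. z N x \<in> - P"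
      using zlim[of x] cl by (intro topological_tendstoD) auto
    have "\<forall>\<^sub>F N in sequentially. h N x = 0"
      using ev by eventually_elim (simp add: hz a_def solid_angle_outside[OF cl])
    then show ?thesis using False by (auto intro: tendsto_eventually)
  qed
  have sum: "lattice_sum (Suc N) f P = (LINT x|lborel. h N x)" for N
  proof -
    have ind: "integrable lborel (indicat_real (Q N n))" if "n \<in> L N" for n
    proof (rule ccontr)
      assume "\<not> integrable lborel (indicat_real (Q N n))"
      then have "(LINT x|lborel. indicat_real (Q N n) x) = 0" by (rule not_integrable_integral_eq)
      then show False using measure_floor_cube[of "Suc N" n] that by (simp add: L_def Q_def del: of_nat_Suc)
    qed
    have "(LINT x|lborel. h N x) = (\<Sum>n\<in>L N. LINT x|lborel. indicat_real (Q N n) x *\<^sub>R a (n /\<^sub>R real (Suc N)))"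
      unfolding h_def using ind by (intro Bochner_Integration.integral_sum) auto
    also have "\<dots> = (\<Sum>n\<in>L N. (LINT x|lborel. indicat_real (Q N n) x) *\<^sub>R a (n /\<^sub>R real (Suc N)))"
      using ind by (intro sum.cong refl integral_scaleR_left) auto
    also have "\<dots> = (\<Sum>n\<in>L N. (1 / real (Suc N) ^ CARD('n)) *\<^sub>R a (n /\<^sub>R real (Suc N)))"
      unfolding Q_def by (intro sum.cong refl arg_cong2[where f = scaleR] measure_floor_cube) (auto simp: L_def)
    also have "\<dots> = lattice_sum (Suc N) f P"
      unfolding lattice_sum_eq_finite_sum[OF cl R zero_less_Suc] L_def a_def scaleR_sum_right ..
    finally show ?thesis by (rule sym)
  qed
  have "(\<lambda>N. LINT x|lborel. h N x) \<longlonglongrightarrow> (LINT x|lborel. indicator P x *\<^sub>R f x)"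
  proof (rule integral_dominated_convergence[where w = "\<lambda>x. indicator (cball 0 (R + 1 + CARD('n))) x *\<^sub>R B'"])
    show "h N \<in> borel_measurable lborel" for N unfolding h_def by measurable
    show "integrable lborel (\<lambda>x :: real ^ 'n. indicator (cball 0 (R + 1 + CARD('n))) x *\<^sub>R B')"
      by (intro integrableI_bounded_set_indicator[where B = "\<bar>B'\<bar>"] emeasure_bounded_finite[OF bounded_cball, THEN order_less_le_trans]) auto
    have "frontier P \<in> null_sets lborel"
      using fr by (simp add: negligible_iff_null_sets null_sets_completion_iff)
    then have "AE x in lborel. x \<notin> frontier P" by (rule AE_not_in)
    then show "AE x in lborel. (\<lambda>N. h N x) \<longlonglongrightarrow> indicat_real P x *\<^sub>R f x" by (rule AE_mp) (auto intro!: AE_I2 lim)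
  qed (use hB in auto)
  then show ?thesis by (simp add: sum set_lebesgue_integral_def)
qed

section \<open>The asymptotic expansion\<close>

lemma mollified_integrand_osc:
  fixes f :: "real ^ 'n \<Rightarrow> 'b::euclidean_space"
  assumes "C_k m f"
  shows "osc_expandable m (mollified_integrand \<epsilon> f)"
  unfolding mollified_integrand_def[abs_def] by (rule osc_taylor[OF assms bounded_periodic_near_lattice bounded_periodic_lattice_offset])

lemma osc_bounded_supported:
  fixes F :: "int \<Rightarrow> real ^ 'n \<Rightarrow> 'b::euclidean_space"
  assumes F: "osc_expandable m F" and N: "N \<noteq> 0" and T: "compact T"
  shows "bounded_supported (\<lambda>x. indicator T x *\<^sub>R F N x)"
proof -
  obtain R where R: "\<forall>x\<in>T. norm x \<le> R" using compact_imp_bounded[OF T] by (auto simp: bounded_iff)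
  obtain K where K: "\<forall>N u. N \<noteq> 0 \<longrightarrow> norm u \<le> R \<longrightarrow> norm (F N u) \<le> K"
    by (rule uniformly_locally_boundedE[OF osc_bounded[OF F], where R = R])
  have [measurable]: "T \<in> sets borel" using compact_imp_closed[OF T] by simp
  note osc_measurable[OF F N, measurable]
  show ?thesis
  proof (rule bounded_supportedI[where K = "\<bar>K\<bar>" and R = R])
    show "norm (indicator T x *\<^sub>R F N x) \<le> \<bar>K\<bar>" for x
    proof (cases "x \<in> T")
      case True
      then have "norm (F N x) \<le> K" using K N R by blast
      with True show ?thesis by simp
    qed simp
    show "norm x \<le> R" if "indicat_real T x *\<^sub>R F N x \<noteq> 0" for x
      using that R by (auto simp: indicator_def split: if_splits)
  qed measurable
qed

lemma integral_simplex_expansion: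
  fixes F :: "int \<Rightarrow> real ^ 'n \<Rightarrow> 'b::euclidean_space" and T :: "(real ^ 'n) set"
  assumes F: "osc_expandable m F" and T: "int CARD('n) simplex T"
    and V: "\<forall>x. {x} face_of T \<longrightarrow> x \<in> integer_lattice"
  shows "has_expansion m (\<lambda>N. LINT x:T|lborel. F N x)"
proof -
  obtain e :: "nat \<Rightarrow> 'n" where e: "bij_betw e {..<CARD('n)} UNIV" by (rule ex_coord_enumeration)
  obtain v A where vA: "v \<in> integer_lattice" "\<And>i j. A $ i $ j \<in> \<int>" and inv: "invertible A"
    and TA: "T = (\<lambda>u. v + A *v u) ` chain_region e 0"
    by (rule integer_simplex_parametrization[OF T e V]) (rule that; assumption)
  obtain b where b: "\<forall>G :: real ^ 'n \<Rightarrow> 'b. bounded_supported G \<longrightarrow>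
      (LINT x|lborel. G x) = b *\<^sub>R (LINT u|lborel. G (v + A *v u))"
    using integral_affine_change[OF inv, of v] by (elim exE)
  have inj: "v + A *v u \<in> T \<longleftrightarrow> u \<in> chain_region e 0" for u
  proof -
    have "inj ((*v) A)" using inv by (metis invertible_def matrix_left_invertible_injective)
    then have "v + A *v u = v + A *v u' \<longleftrightarrow> u = u'" for u' by (auto dest: injD)
    then show ?thesis unfolding TA image_iff by simp
  qed
  have ind: "indicat_real T (v + A *v u) = indicat_real (chain_region e 0) u" for u
    by (simp only: indicator_def inj)
  show ?thesis
  proof (rule has_expansion_cong[OF has_expansion_scaleR
        [OF integral_ordered_simplex_expansion[OF osc_substitute[OF F vA] e], of b]])
    fix N :: int assume N: "N \<noteq> 0"
    have "(LINT x:T|lborel. F N x) = b *\<^sub>R (LINT u|lborel. indicator T (v + A *v u) *\<^sub>R F N (v + A *v u))"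
      unfolding set_lebesgue_integral_def
      by (rule b[rule_format, OF osc_bounded_supported[OF F N compact_simplex[OF T]]])
    also have "\<dots> = b *\<^sub>R (LINT u:chain_region e 0|lborel. F N (v + A *v u))"
      unfolding ind set_lebesgue_integral_def ..
    finally show "(LINT x:T|lborel. F N x) = b *\<^sub>R (LINT u:chain_region e 0|lborel. F N (v + A *v u))" .
  qed
qed

lemma integral_complex_expansion:
  fixes F :: "int \<Rightarrow> real ^ 'n \<Rightarrow> 'b::euclidean_space" and \<C> :: "(real ^ 'n) set set"
  assumes F: "osc_expandable m F" and C: "homogeneous_complex CARD('n) \<C>" and V: "complex_vertices \<C> \<subseteq> integer_lattice"
  shows "has_expansion m (\<lambda>N. LINT x:\<Union>\<C>|lborel. F N x)"
proof -
  have sc: "simplicial_complex \<C>" using C by (simp add: homogeneous_complex_def)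
  note full = full_simplicesD[OF sc]
  show ?thesis
  proof (rule has_expansion_cong[OF has_expansion_sum])
    show "has_expansion m (\<lambda>N. LINT x:T|lborel. F N x)" if "T \<in> full_simplices \<C>" for T
      using full(2)[OF that] full(3)[OF that V] by (rule integral_simplex_expansion[OF F])
    fix N :: int assume N: "N \<noteq> 0"
    show "(LINT x:\<Union>\<C>|lborel. F N x) = (\<Sum>T\<in>full_simplices \<C>. LINT x:T|lborel. F N x)"
      unfolding Union_full_simplices[OF C]
    proof (rule integral_Union_almost_disjoint[OF full(1)])
      show "set_integrable lborel T (F N)" if "T \<in> full_simplices \<C>" for T
        unfolding set_integrable_def
        by (rule bounded_supported_integrable[OF osc_bounded_supported[OF F N compact_simplex[OF full(2)[OF that]]]])
    qed (auto intro: closed_simplex full(2) negligible_Int_full_simplices[OF sc] osc_measurable[OF F N])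
  qed
qed

text \<open>
  For an even function of \<open>N\<close> the expansions at \<open>N\<close> and \<open>- N\<close> may be averaged, and the odd
  powers cancel.
\<close>

lemma even_expansion:
  fixes I :: "int \<Rightarrow> 'b::real_normed_vector"
  assumes I: "\<And>N. N \<noteq> 0 \<Longrightarrow> norm (I N - (\<Sum>j<m. (1 / of_int N ^ j) *\<^sub>R c j)) \<le> K / \<bar>of_int N\<bar> ^ m"
    and sym: "\<And>N. I (- N) = I N" and N: "N \<noteq> 0"
  shows "norm (I N - (\<Sum>j | j < m \<and> even j. (1 / of_int N ^ j) *\<^sub>R c j)) \<le> K / \<bar>of_int N\<bar> ^ m"
proof -
  define A where "A N = (\<Sum>j<m. (1 / of_int N ^ j) *\<^sub>R c j)" for N :: int
  have "(1 / 2) *\<^sub>R (A N + A (- N)) = (\<Sum>j<m. if even j then (1 / of_int N ^ j) *\<^sub>R c j else 0)"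
    unfolding A_def sum.distrib[symmetric] scaleR_sum_right
  proof (intro sum.cong refl)
    fix j
    show "(1 / 2) *\<^sub>R ((1 / of_int N ^ j) *\<^sub>R c j + (1 / of_int (- N) ^ j) *\<^sub>R c j)
      = (if even j then (1 / of_int N ^ j) *\<^sub>R c j else 0)"
    proof (cases "even j")
      case True
      then have "real_of_int (- N) ^ j = of_int N ^ j" by simp
      then show ?thesis using True by (simp only: scaleR_half_double if_True)
    next
      case False
      then have "real_of_int (- N) ^ j = - (of_int N ^ j)" by simp
      then show ?thesis using False by simp
    qed
  qed
  also have "\<dots> = (\<Sum>j | j < m \<and> even j. (1 / of_int N ^ j) *\<^sub>R c j)"
    by (simp add: sum.If_cases Int_def lessThan_def)
  finally have S: "(1 / 2) *\<^sub>R (A N + A (- N)) = (\<Sum>j | j < m \<and> even j. (1 / of_int N ^ j) *\<^sub>R c j)" .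
  have "(I N - A N) + (I N - A (- N)) = (I N + I N) - (A N + A (- N))" by simp
  then have "(1 / 2) *\<^sub>R ((I N - A N) + (I (- N) - A (- N)))
    = (1 / 2) *\<^sub>R (I N + I N) - (1 / 2) *\<^sub>R (A N + A (- N))"
    by (simp only: sym[of N] scaleR_diff_right)
  then have "I N - (\<Sum>j | j < m \<and> even j. (1 / of_int N ^ j) *\<^sub>R c j)
     = (1 / 2) *\<^sub>R ((I N - A N) + (I (- N) - A (- N)))"
    unfolding S scaleR_half_double by (rule HOL.sym)
  also have "norm \<dots> \<le> (1 / 2) * (K / \<bar>of_int N\<bar> ^ m + K / \<bar>of_int N\<bar> ^ m)"
    unfolding norm_scaleR using I[OF N] I[of "- N"] N
    by (intro mult_mono norm_triangle_mono) (auto simp: A_def)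
  finally show ?thesis by simp
qed

lemma tendsto_finite_expansion:
  fixes c :: "nat \<Rightarrow> 'b::real_normed_vector"
  assumes "finite J" "0 \<in> J"
  shows "(\<lambda>N. \<Sum>j\<in>J. (1 / real (Suc N) ^ j) *\<^sub>R c j) \<longlonglongrightarrow> c 0"
proof -
  have i: "(\<lambda>N. 1 / real (Suc N)) \<longlonglongrightarrow> 0" by (rule LIMSEQ_Suc[OF lim_1_over_n])
  have "(\<lambda>N. (1 / real (Suc N) ^ j) *\<^sub>R c j) \<longlonglongrightarrow> (if j = 0 then c 0 else 0)" for j
  proof (cases "j = 0")
    case False
    have "(\<lambda>N. (1 / real (Suc N)) ^ j *\<^sub>R c j) \<longlonglongrightarrow> 0 ^ j *\<^sub>R c j"
      by (intro tendsto_intros i)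
    then show ?thesis using False by (simp add: power_one_over power_0_left del: of_nat_Suc)
  qed simp
  then have "(\<lambda>N. \<Sum>j\<in>J. (1 / real (Suc N) ^ j) *\<^sub>R c j) \<longlonglongrightarrow> (\<Sum>j\<in>J. if j = 0 then c 0 else 0)"
    by (rule tendsto_sum)
  then show ?thesis using assms by simp
qed

(* The class constraint on 'b covers real-valued and complex-valued functions alike. *)
theorem theorem10:
  fixes \<C> :: "(real ^ 'n) set set"
    and w :: nat
    and f :: "real ^ 'n \<Rightarrow> 'b::{real_normed_field, euclidean_space}"
  assumes "homogeneous_complex CARD('n) \<C>"
    and "complex_vertices \<C> \<subseteq> integer_lattice"
    and "C_k (w + 1) f"
  shows "\<exists>\<gamma> :: nat \<Rightarrow> 'b. \<exists>K :: real. \<forall>N :: nat. N > 0 \<longrightarrow>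
    norm (lattice_sum N f (\<Union>\<C>) -
      ((LINT x:\<Union>\<C>|lborel. f x) + (\<Sum>k | 0 < k \<and> real k \<le> real w / 2. \<gamma> k / of_nat N ^ (2 * k))))
    \<le> K / real N ^ (w + 1)"
proof -
  note C = assms(1) and V = assms(2) and f = assms(3)
  let ?P = "\<Union>\<C>" and ?T = "full_simplices \<C>" and ?m = "w + 1"
  have sc: "simplicial_complex \<C>" using C by (simp add: homogeneous_complex_def)
  note fin = full_simplicesD(1)[OF sc] and full = full_simplicesD(2)[OF sc]
  note vert = full_simplicesD(3)[OF sc _ V]
  have PT: "?P = \<Union>?T" by (rule Union_full_simplices[OF C])
  have comp: "compact ?P" unfolding PT using fin full compact_simplex by (intro compact_Union) auto
  then have cl: "closed ?P" by (rule compact_imp_closed)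
  obtain R where R: "\<forall>x\<in>?P. norm x \<le> R" using compact_imp_bounded[OF comp] unfolding bounded_iff by blast
  have fr: "negligible (frontier ?P)"
  proof (rule negligible_subset)
    show "frontier ?P \<subseteq> (\<Union>T\<in>?T. frontier T)" unfolding PT by (rule frontier_Union_subset[OF fin])
    show "negligible (\<Union>T\<in>?T. frontier T)"
      using fin full convex_simplex by (intro negligible_Union) (auto intro: negligible_convex_frontier)
  qed
  obtain e :: "nat \<Rightarrow> 'n" where e: "bij_betw e {..<CARD('n)} UNIV" by (rule ex_coord_enumeration)
  have "\<exists>\<epsilon>>0. lattice_conic \<epsilon> T" if T: "T \<in> ?T" for T
  proof -
    obtain v A where "v \<in> integer_lattice" "\<And>i j. A $ i $ j \<in> \<int>" "invertible A"
      and TA: "T = (\<lambda>u. v + A *v u) ` chain_region e 0"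
      by (rule integer_simplex_parametrization[OF full[OF T] e vert[OF T]]) (rule that; assumption)
    then show ?thesis unfolding TA by (intro lattice_conic_affine_image)
  qed
  from lattice_conic_Union[OF fin this] obtain \<epsilon>0 where \<epsilon>0: "\<epsilon>0 > 0" "lattice_conic \<epsilon>0 ?P"
    unfolding PT by blast
  \<comment> \<open>balls of radius \<open>\<epsilon>\<close> around distinct lattice points must be disjoint\<close>
  define \<epsilon> where "\<epsilon> = min \<epsilon>0 (1 / 4)"
  have \<epsilon>: "0 < \<epsilon>" "\<epsilon> < 1 / 2" and conic: "lattice_conic \<epsilon> ?P"
    using \<epsilon>0 lattice_conic_mono[OF \<epsilon>0(2), of \<epsilon>] by (auto simp: \<epsilon>_def)
  define I where "I = mollified_sum \<epsilon> f ?P"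
  have LI: "lattice_sum N f ?P = I (int N)" if "N > 0" for N
    unfolding I_def by (rule lattice_sum_eq_mollified_sum[OF conic \<epsilon> that cl R])
  have "has_expansion ?m I"
    unfolding I_def mollified_sum_def[abs_def]
    by (intro has_expansion_scaleR integral_complex_expansion[OF mollified_integrand_osc[OF f] C V])
  then obtain c K where
    cK: "\<forall>N. N \<noteq> 0 \<longrightarrow> norm (I N - (\<Sum>j<?m. (1 / of_int N ^ j) *\<^sub>R c j)) \<le> K / \<bar>of_int N\<bar> ^ ?m"
    by (rule has_expansionE)
  define E where "E N = (\<Sum>j | j < ?m \<and> even j. (1 / real N ^ j) *\<^sub>R c j)" for N :: nat
  have LE: "norm (lattice_sum N f ?P - E N) \<le> K / real N ^ ?m" if N: "N > 0" for N
    using even_expansion[where I = I and m = ?m and c = c and K = K and N = "int N", OF cK[rule_format]] mollified_sum_minus[OF \<epsilon>(2), of f ?P] N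
    by (simp add: LI I_def E_def)
  \<comment> \<open>both sides are the limit of the lattice sums\<close>
  have c0_eq: "c 0 = (LINT x:?P|lborel. f x)"
  proof -
    have "(\<lambda>N. lattice_sum (Suc N) f ?P) \<longlonglongrightarrow> (LINT x:?P|lborel. f x)"
      by (rule lattice_sum_tendsto_integral[OF conic \<epsilon>(1) cl R fr C_k_continuous[OF f]])
    moreover have "(\<lambda>N. E (Suc N)) \<longlonglongrightarrow> c 0"
      unfolding E_def by (rule tendsto_finite_expansion) auto
    moreover have "(\<lambda>N. lattice_sum (Suc N) f ?P - E (Suc N)) \<longlonglongrightarrow> 0"
    proof (rule Lim_null_comparison)
      show "\<forall>\<^sub>F N in sequentially. norm (lattice_sum (Suc N) f ?P - E (Suc N)) \<le> \<bar>K\<bar> * (1 / real (Suc N))"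
      proof (rule always_eventually, rule allI)
        fix N
        have "norm (lattice_sum (Suc N) f ?P - E (Suc N)) \<le> K / real (Suc N) ^ ?m" by (rule LE) simp
        also have "\<dots> \<le> \<bar>K\<bar> / real (Suc N)"
          using self_le_power[of "real (Suc N)" ?m] by (intro frac_le) auto
        finally show "norm (lattice_sum (Suc N) f ?P - E (Suc N)) \<le> \<bar>K\<bar> * (1 / real (Suc N))" by simp
      qed
      show "(\<lambda>N. \<bar>K\<bar> * (1 / real (Suc N))) \<longlonglongrightarrow> 0"
        using tendsto_mult_right_zero[OF LIMSEQ_Suc[OF lim_1_over_n]] by blast
    qed
    ultimately have "(\<lambda>N. lattice_sum (Suc N) f ?P - (lattice_sum (Suc N) f ?P - E (Suc N))) \<longlonglongrightarrow> (LINT x:?P|lborel. f x) - 0"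
      by (intro tendsto_diff)
    then have "(\<lambda>N. E (Suc N)) \<longlonglongrightarrow> (LINT x:?P|lborel. f x)" by simp
    with \<open>(\<lambda>N. E (Suc N)) \<longlonglongrightarrow> c 0\<close> show ?thesis by (rule LIMSEQ_unique)
  qed
  have E_eq: "E N = (LINT x:?P|lborel. f x) + (\<Sum>k | 0 < k \<and> real k \<le> real w / 2. c (2 * k) / of_nat N ^ (2 * k))" for N
  proof -
    have J: "{j. j < ?m \<and> even j} = insert 0 ((\<lambda>k. 2 * k) ` {k. 0 < k \<and> real k \<le> real w / 2})"
    proof (intro set_eqI iffI)
      fix j assume "j \<in> {j. j < ?m \<and> even j}"
      then obtain k where "j = 2 * k" "2 * k \<le> w" by (auto elim: evenE)
      then have "real (2 * k) \<le> real w" by (simp only: of_nat_le_iff)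
      then show "j \<in> insert 0 ((\<lambda>k. 2 * k) ` {k. 0 < k \<and> real k \<le> real w / 2})"
        using \<open>j = 2 * k\<close> by (cases "k = 0") auto
    next
      fix j assume "j \<in> insert 0 ((\<lambda>k. 2 * k) ` {k. 0 < k \<and> real k \<le> real w / 2})"
      then consider "j = 0" | k where "j = 2 * k" "real k \<le> real w / 2" by blast
      then show "j \<in> {j. j < ?m \<and> even j}"
      proof cases
        case 2
        then have "real (2 * k) \<le> real w" by simp
        then have "2 * k \<le> w" by (simp only: of_nat_le_iff)
        then show ?thesis using 2 by simp
      qed simp
    qed
    have "finite {j. j < ?m \<and> even j}" by simp
    then have "finite ((\<lambda>k::nat. 2 * k) ` {k. 0 < k \<and> real k \<le> real w / 2})" unfolding J by simp
    moreover have "0 \<notin> (\<lambda>k::nat. 2 * k) ` {k. 0 < k \<and> real k \<le> real w / 2}" by auto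
    ultimately have "E N = c 0 + (\<Sum>j\<in>(\<lambda>k. 2 * k) ` {k. 0 < k \<and> real k \<le> real w / 2}. (1 / real N ^ j) *\<^sub>R c j)"
      unfolding E_def J by (subst sum.insert) auto
    also have "(\<Sum>j\<in>(\<lambda>k. 2 * k) ` {k. 0 < k \<and> real k \<le> real w / 2}. (1 / real N ^ j) *\<^sub>R c j)
      = (\<Sum>k | 0 < k \<and> real k \<le> real w / 2. (1 / real N ^ (2 * k)) *\<^sub>R c (2 * k))"
      by (subst sum.reindex) (auto simp: inj_on_def)
    finally show ?thesis by (simp add: c0_eq scaleR_conv_of_real)
  qed
  show ?thesis
    using LE unfolding E_eq by (intro exI[of _ "\<lambda>k. c (2 * k)"] exI[of _ K]) simp
qed

end
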